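(* $\mathbf{AGWP}(G)\in\mathbf{P}$ for every finitely generated virtually nilpotent group $G$.
   Context: For a group $G$ with a finite generating set $X$, the acyclic graph word problem $\mathbf{AGWP}(G)$ is the following decision problem. Input: a finite acyclic directed graph $\Gamma$ with edges labeled by letters in $X\cup X^{-1}\cup\{\varepsilon\}$ ($\varepsilon$ the empty word), with two marked vertices $\alpha$ and $\omega$. Question: is there an oriented path in $\Gamma$ from $\alpha$ to $\omega$ labeled by a word $w$ such that $w=1$ in $G$? The size of an instance is the number of vertices plus the number of edges plus the total length of edge labels. The complexity does not depend on the choice of finite $X$. $\mathbf{P}$ is the class of problems decidable in polynomial time. *)

theory Defs
  imports
    "HOL-Algebra.Generated_Groups"
    "HOL-Computational_Algebra.Polynomial"
begin

section \<open>Virtually nilpotent groups\<close>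

fun lower_central :: "('a, 'b) monoid_scheme \<Rightarrow> nat \<Rightarrow> 'a set" where
  "lower_central G 0 = carrier G"
| "lower_central G (Suc n) =
     generate G {h \<otimes>\<^bsub>G\<^esub> g \<otimes>\<^bsub>G\<^esub> inv\<^bsub>G\<^esub> h \<otimes>\<^bsub>G\<^esub> inv\<^bsub>G\<^esub> g | h g. h \<in> lower_central G n \<and> g \<in> carrier G}"

definition nilpotent_group :: "('a, 'b) monoid_scheme \<Rightarrow> bool" where
  "nilpotent_group G \<longleftrightarrow> group G \<and> (\<exists>n. lower_central G n = {\<one>\<^bsub>G\<^esub>})"

definition virtually_nilpotent :: "('a, 'b) monoid_scheme \<Rightarrow> bool" where
  "virtually_nilpotent G \<longleftrightarrow> group G \<and>
     (\<exists>H. subgroup H G \<and> finite (rcosets\<^bsub>G\<^esub> H) \<and> nilpotent_group (G\<lparr>carrier := H\<rparr>))"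


section \<open>Deterministic multi-tape Turing machines and polynomial time\<close>

text \<open>
  Tapes are two-way infinite. States and tape symbols are natural numbers below the bounds
  given in the machine; symbol 0 is the blank, and 1, 2 represent the input bits.
\<close>

datatype head_move = Move_Left | Stay | Move_Right

fun shift :: "head_move \<Rightarrow> int" where
  "shift Move_Left = -1"
| "shift Stay = 0"
| "shift Move_Right = 1"

record turing_machine =
  num_tapes :: nat
  num_states :: nat
  num_symbols :: nat
  start_state :: nat
  accept_state :: nat
  reject_state :: nat
  delta :: "nat \<Rightarrow> nat list \<Rightarrow> nat \<times> (nat \<times> head_move) list"

definition wf_turing_machine :: "turing_machine \<Rightarrow> bool" where
  "wf_turing_machine M \<longleftrightarrow>
     num_tapes M \<ge> 1 \<and> num_symbols M \<ge> 3 \<and>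
     start_state M < num_states M \<and> accept_state M < num_states M \<and>
     reject_state M < num_states M \<and> accept_state M \<noteq> reject_state M \<and>
     (\<forall>q ss. q < num_states M \<and> length ss = num_tapes M \<and> set ss \<subseteq> {..<num_symbols M} \<longrightarrow>
        fst (delta M q ss) < num_states M \<and>
        length (snd (delta M q ss)) = num_tapes M \<and>
        (\<forall>(s, d) \<in> set (snd (delta M q ss)). s < num_symbols M))"

record tape =
  content :: "int \<Rightarrow> nat"
  head_pos :: int

type_synonym config = "nat \<times> tape list"

definition read_tape :: "tape \<Rightarrow> nat" where
  "read_tape T = content T (head_pos T)"

definition act :: "nat \<times> head_move \<Rightarrow> tape \<Rightarrow> tape" where
  "act a T = \<lparr>content = (content T)(head_pos T := fst a), head_pos = head_pos T + shift (snd a)\<rparr>"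

text \<open>Halting configurations are fixed points of the step function.\<close>

definition step :: "turing_machine \<Rightarrow> config \<Rightarrow> config" where
  "step M c =
     (let q = fst c; ts = snd c in
      if q = accept_state M \<or> q = reject_state M then c
      else let r = delta M q (map read_tape ts) in (fst r, map2 act (snd r) ts))"

definition bit_symbol :: "bool \<Rightarrow> nat" where
  "bit_symbol b = (if b then 2 else 1)"

definition blank_tape :: tape where
  "blank_tape = \<lparr>content = (\<lambda>_. 0), head_pos = 0\<rparr>"

definition input_tape :: "bool list \<Rightarrow> tape" where
  "input_tape w =
     \<lparr>content = (\<lambda>i. if 0 \<le> i \<and> i < int (length w) then bit_symbol (w ! nat i) else 0), head_pos = 0\<rparr>"

definition init_config :: "turing_machine \<Rightarrow> bool list \<Rightarrow> config" where
  "init_config M w = (start_state M, input_tape w # replicate (num_tapes M - 1) blank_tape)"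

definition run :: "turing_machine \<Rightarrow> bool list \<Rightarrow> nat \<Rightarrow> config" where
  "run M w t = (step M ^^ t) (init_config M w)"

definition decides_in_time :: "turing_machine \<Rightarrow> bool list set \<Rightarrow> (nat \<Rightarrow> nat) \<Rightarrow> bool" where
  "decides_in_time M L T \<longleftrightarrow>
     (\<forall>w. \<exists>t \<le> T (length w).
        fst (run M w t) = (if w \<in> L then accept_state M else reject_state M))"

definition PTIME :: "bool list set set" where
  "PTIME = {L. \<exists>M (p :: nat poly). wf_turing_machine M \<and> decides_in_time M L (poly p)}"


section \<open>The acyclic graph word problem\<close>

text \<open>An edge label is a letter, or \<^term>\<open>None\<close> for the empty word.\<close>

datatype 'a letter = Gen 'a | Inv 'a

fun generator :: "'a letter \<Rightarrow> 'a" where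
  "generator (Gen x) = x"
| "generator (Inv x) = x"

fun letter_value :: "('a, 'b) monoid_scheme \<Rightarrow> 'a letter \<Rightarrow> 'a" where
  "letter_value G (Gen x) = x"
| "letter_value G (Inv x) = inv\<^bsub>G\<^esub> x"

definition word_value :: "('a, 'b) monoid_scheme \<Rightarrow> 'a letter list \<Rightarrow> 'a" where
  "word_value G w = foldr (\<lambda>l g. letter_value G l \<otimes>\<^bsub>G\<^esub> g) w \<one>\<^bsub>G\<^esub>"

type_synonym 'a edge = "nat \<times> 'a letter option \<times> nat"

text \<open>
  The vertices are \<open>0, \<dots>, num_vertices - 1\<close>; an edge \<open>(u, l, v)\<close> goes from \<open>u\<close> to \<open>v\<close>.
  Parallel edges are allowed.
\<close>

record 'a instance_graph =
  num_vertices :: nat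
  edges :: "'a edge list"
  source :: nat
  target :: nat

definition wf_instance :: "'a set \<Rightarrow> 'a instance_graph \<Rightarrow> bool" where
  "wf_instance X \<Gamma> \<longleftrightarrow>
     source \<Gamma> < num_vertices \<Gamma> \<and> target \<Gamma> < num_vertices \<Gamma> \<and>
     (\<forall>(u, l, v) \<in> set (edges \<Gamma>).
        u < num_vertices \<Gamma> \<and> v < num_vertices \<Gamma> \<and> (\<forall>a. l = Some a \<longrightarrow> generator a \<in> X)) \<and>
     acyclic {(u, v). \<exists>l. (u, l, v) \<in> set (edges \<Gamma>)}"

inductive labeled_path :: "'a edge set \<Rightarrow> nat \<Rightarrow> 'a letter list \<Rightarrow> nat \<Rightarrow> bool"
  for E where
  path_empty: "labeled_path E u [] u"
| path_eps: "(u, None, v) \<in> E \<Longrightarrow> labeled_path E v w z \<Longrightarrow> labeled_path E u w z"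
| path_letter: "(u, Some a, v) \<in> E \<Longrightarrow> labeled_path E v w z \<Longrightarrow> labeled_path E u (a # w) z"

definition yes_instance :: "('a, 'b) monoid_scheme \<Rightarrow> 'a instance_graph \<Rightarrow> bool" where
  "yes_instance G \<Gamma> \<longleftrightarrow>
     (\<exists>w. labeled_path (set (edges \<Gamma>)) (source \<Gamma>) w (target \<Gamma>) \<and> word_value G w = \<one>\<^bsub>G\<^esub>)"

definition instance_size :: "'a instance_graph \<Rightarrow> nat" where
  "instance_size \<Gamma> = num_vertices \<Gamma> + length (edges \<Gamma>) +
     (\<Sum>(u, l, v) \<leftarrow> edges \<Gamma>. case l of None \<Rightarrow> 0 | Some _ \<Rightarrow> 1)"

text \<open>
  Instances are written as sequences of numbers in self-delimiting unary notation, with the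
  generators numbered by a function \<open>c\<close>. Since each vertex contributes 1 to the size of an
  instance, the length of the unary code is polynomially related to that size, as is proved below.
\<close>

definition encode_nats :: "nat list \<Rightarrow> bool list" where
  "encode_nats ns = concat (map (\<lambda>n. replicate n True @ [False]) ns)"

fun label_code :: "('a \<Rightarrow> nat) \<Rightarrow> 'a letter option \<Rightarrow> nat" where
  "label_code c None = 0"
| "label_code c (Some (Gen x)) = 2 * c x + 1"
| "label_code c (Some (Inv x)) = 2 * c x + 2"

definition instance_nats :: "('a \<Rightarrow> nat) \<Rightarrow> 'a instance_graph \<Rightarrow> nat list" where
  "instance_nats c \<Gamma> =
     [num_vertices \<Gamma>, source \<Gamma>, target \<Gamma>] @
     concat (map (\<lambda>(u, l, v). [u, label_code c l, v]) (edges \<Gamma>))"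

definition encode_instance :: "('a \<Rightarrow> nat) \<Rightarrow> 'a instance_graph \<Rightarrow> bool list" where
  "encode_instance c \<Gamma> = encode_nats (instance_nats c \<Gamma>)"

definition AGWP :: "('a, 'b) monoid_scheme \<Rightarrow> 'a set \<Rightarrow> ('a \<Rightarrow> nat) \<Rightarrow> bool list set" where
  "AGWP G X c = {encode_instance c \<Gamma> | \<Gamma>. wf_instance X \<Gamma> \<and> yes_instance G \<Gamma>}"

lemma encode_nats_Cons: "encode_nats (n # ns) = replicate n True @ False # encode_nats ns"
  by (simp add: encode_nats_def)

lemma encode_nats_Nil: "encode_nats [] = []"
  by (simp add: encode_nats_def)

lemma replicate_True_inj:
  "replicate m True @ False # xs = replicate n True @ False # ys \<Longrightarrow> m = n \<and> xs = ys"
proof (induction m arbitrary: n)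
  case 0
  then show ?case by (cases n) auto
next
  case (Suc m)
  then show ?case by (cases n) auto
qed

lemma encode_nats_inj: "encode_nats ms = encode_nats ns \<Longrightarrow> ms = ns"
proof (induction ms arbitrary: ns)
  case Nil
  then show ?case by (cases ns) (auto simp: encode_nats_Cons encode_nats_Nil)
next
  case (Cons m ms)
  then obtain n ns' where ns: "ns = n # ns'"
    by (cases ns) (auto simp: encode_nats_Cons encode_nats_Nil)
  with Cons show ?case
    by (auto simp: encode_nats_Cons dest!: replicate_True_inj)
qed

lemma label_code_inj:
  assumes "inj_on c X" "\<And>a. l = Some a \<Longrightarrow> generator a \<in> X" "\<And>a. l' = Some a \<Longrightarrow> generator a \<in> X"
    and "label_code c l = label_code c l'"
  shows "l = l'"
  using assms
  by (cases "(c, l)" rule: label_code.cases; cases "(c, l')" rule: label_code.cases)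
     (auto dest: inj_onD | presburger)+

lemma edge_nats_inj:
  assumes "inj_on c X"
    and "\<And>u a v. (u, Some a, v) \<in> set es \<Longrightarrow> generator a \<in> X"
    and "\<And>u a v. (u, Some a, v) \<in> set es' \<Longrightarrow> generator a \<in> X"
    and "concat (map (\<lambda>(u, l, v). [u, label_code c l, v]) es) =
         concat (map (\<lambda>(u, l, v). [u, label_code c l, v]) es')"
  shows "es = es'"
  using assms(2-)
proof (induction es arbitrary: es')
  case Nil
  then show ?case by (cases es') auto
next
  case (Cons e es)
  obtain u l v where e: "e = (u, l, v)" by (cases e)
  from Cons.prems(3) e obtain u' l' v' es2 where es': "es' = (u', l', v') # es2"
    by (cases es') auto
  have "es = es2"
  proof (rule Cons.IH)
    show "generator a \<in> X" if "(u, Some a, v) \<in> set es" for u a v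
      using that Cons.prems(1)[of u a v] by simp
    show "generator a \<in> X" if "(u, Some a, v) \<in> set es2" for u a v
      using that Cons.prems(2)[of u a v] es' by simp
  qed (use Cons.prems(3) e es' in auto)
  moreover have "l = l'"
  proof (rule label_code_inj[OF assms(1)])
    show "generator a \<in> X" if "l = Some a" for a
      using that Cons.prems(1)[of u a v] e by simp
    show "generator a \<in> X" if "l' = Some a" for a
      using that Cons.prems(2)[of u' a v'] es' by simp
  qed (use Cons.prems(3) e es' in auto)
  ultimately show ?case using Cons.prems(3) e es' by auto
qed

lemma encode_instance_inj:
  assumes "inj_on c X" "wf_instance X \<Gamma>" "wf_instance X \<Gamma>'"
    and "encode_instance c \<Gamma> = encode_instance c \<Gamma>'"
  shows "\<Gamma> = \<Gamma>'"
proof -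
  have eq: "instance_nats c \<Gamma> = instance_nats c \<Gamma>'"
    using assms(4) by (simp add: encode_instance_def encode_nats_inj)
  have "edges \<Gamma> = edges \<Gamma>'"
    by (rule edge_nats_inj[OF assms(1)])
       (use assms(2,3) eq in \<open>auto simp: wf_instance_def instance_nats_def\<close>)
  with eq show ?thesis by (simp add: instance_nats_def)
qed

lemma length_encode_nats: "length (encode_nats ns) = sum_list ns + length ns"
  by (induction ns) (auto simp: encode_nats_Cons encode_nats_Nil)

lemma instance_size_le_length_encode: "instance_size \<Gamma> \<le> length (encode_instance c \<Gamma>)"
proof -
  have "length es + (\<Sum>(u, l, v) \<leftarrow> es. case l of None \<Rightarrow> 0 | Some _ \<Rightarrow> 1) \<le>
        length (encode_nats (concat (map (\<lambda>(u, l, v). [u, label_code c l, v]) es)))"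
    for es :: "'a edge list"
    by (induction es) (auto simp: length_encode_nats split: option.splits)
  from this[of "edges \<Gamma>"] show ?thesis
    by (simp add: instance_size_def encode_instance_def instance_nats_def length_encode_nats)
qed

lemma length_encode_le_instance_size:
  assumes "wf_instance X \<Gamma>" "\<And>x. x \<in> X \<Longrightarrow> c x \<le> B"
  shows "length (encode_instance c \<Gamma>) \<le> (2 * B + 8) * (instance_size \<Gamma> + 1)\<^sup>2"
proof -
  define n where "n = num_vertices \<Gamma>"
  define m where "m = length (edges \<Gamma>)"
  define s where "s = instance_size \<Gamma>"
  have label: "label_code c l \<le> 2 * B + 2" if "\<And>a. l = Some a \<Longrightarrow> generator a \<in> X" for l
    using that assms(2) by (cases "(c, l)" rule: label_code.cases) fastforce+
  have *: "length (encode_nats (concat (map (\<lambda>(u, l, v). [u, label_code c l, v]) es))) \<le>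
        length es * (2 * n + 2 * B + 5)" if "set es \<subseteq> set (edges \<Gamma>)" for es
    using that
  proof (induction es)
    case Nil
    then show ?case by (simp add: encode_nats_Nil)
  next
    case (Cons e es)
    obtain u l v where e: "e = (u, l, v)" by (cases e)
    have "u \<le> n" "v \<le> n" and l: "\<And>a. l = Some a \<Longrightarrow> generator a \<in> X"
      using Cons.prems assms(1) e by (auto simp: wf_instance_def n_def)
    moreover have "label_code c l \<le> 2 * B + 2"
      by (rule label) (rule l)
    ultimately have "u \<le> n" "v \<le> n" "label_code c l \<le> 2 * B + 2"
      by auto
    with Cons e show ?case by (simp add: length_encode_nats)
  qed
  have "source \<Gamma> \<le> n" "target \<Gamma> \<le> n"
    using assms(1) by (auto simp: wf_instance_def n_def)
  then have "length (encode_instance c \<Gamma>) \<le> 3 * n + 3 + m * (2 * n + 2 * B + 5)"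
    using *[of "edges \<Gamma>"]
    by (simp add: encode_instance_def instance_nats_def length_encode_nats n_def m_def)
  also have "\<dots> \<le> 3 * (s + 1) + s * (2 * s + 2 * B + 5)"
    by (intro add_mono mult_mono) (auto simp: s_def instance_size_def n_def m_def)
  also have "\<dots> \<le> (2 * B + 8) * (s + 1)\<^sup>2"
    by (simp add: power2_eq_square algebra_simps)
  finally show ?thesis by (simp add: s_def)
qed

end

theory Submission
  imports Defs
begin

text \<open>
  Let \<open>H\<close> be a nilpotent subgroup of finite index in \<open>G\<close>, and choose representatives of its right
  cosets. Write an element of \<open>G\<close> as \<open>h r\<close> with \<open>h \<in> H\<close> and \<open>r\<close> a representative. Reading a letter
  replaces \<open>r\<close> by another representative and multiplies \<open>h\<close> on the right by one of finitely many
  elements of \<open>H\<close> (\<open>coset_transducer_exists\<close>). So a path in the graph is followed by a finite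
  control together with a product in \<open>H\<close>, and the question is how to store that product in few bits.

  The finitely many elements lie in the set of ordered products \<open>c\<^sub>1\<^bsup>e\<^sub>1\<^esup> \<dots> c\<^sub>k\<^bsup>e\<^sub>k\<^esup>\<close> with natural
  exponents, for a list that starts with them and continues with their iterated commutators, level
  by level, down to the end of the lower central series, each entry next to its inverse
  (\<open>nilpotent_triangular\<close>). Conjugating a later entry by an earlier one changes it by an ordered
  product of still later ones. The exponents of an element are not unique, and there is no need for
  that: all that counts is that exponents of products can be computed. Call a function definable
  if it is given by an expression in addition, multiplication, truncated subtraction, bounded sums
  and look-ups in 0/1 arrays. If a family \<open>g\<^sub>t\<close> of elements has definable exponents, then so has
  the iterated product \<open>g\<^sub>0 \<dots> g\<^bsub>b-1\<^esub>\<close> (\<open>triangular_product_closed\<close>): collect the powers of the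
  first entry on the left, and treat the conjugates that arise in the same way with a shorter list.
  Two things follow. Expressions grow at most polynomially, so a product of \<open>n\<close> elements of a finite
  set has exponents bounded by a polynomial in \<open>n\<close> (\<open>bounded_products\<close>). And equality of two
  families with definable exponents is decided by an expression (\<open>decidable_in_eq\<close>).

  This leaves polynomially many states: representative, vertex of the graph, and exponents below the
  bound. Dynamic programming over the length of paths finds the reachable ones; a transition is
  allowed between any two exponent vectors whose elements fit together, so that non-uniqueness does
  no harm. A second kind of state ignores the group and only follows arcs; it detects cycles, since a
  graph with fewer vertices than the input has bits is cyclic iff it has walks as long as the input. Decoding the input, the transitions and
  acceptance are all given by expressions in the input and the earlier entries of the table.

  Finally, a language decided by filling in a table of definable length, with definable entries, is in
  \<^const>\<open>PTIME\<close> (\<open>PTIME_if_table\<close>). Here the head position of a tape serves as a counter. Expressions are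
  compiled to programs with bounded loops over such counters, and the pending commands of a program
  become the states of a Turing machine.
\<close>

section \<open>Loop programs\<close>

text \<open>
  Programs for a machine whose tapes serve as counters: register \<open>i\<close> is the position of the head of
  tape \<open>i\<close>, never negative. Tapes 0 and 1 also carry 0/1 arrays, the input (array \<^term>\<open>False\<close>) and a
  table (array \<^term>\<open>True\<close>). \<open>Read b i\<close> increments register \<open>i\<close> if array \<open>b\<close> holds \<^term>\<open>True\<close> under the head
  of its tape; \<open>Write\<close> stores \<^term>\<open>True\<close> in the table. \<open>Loop i c\<close> counts register \<open>i\<close> down to 0
  and runs \<open>c\<close> after each decrement, so that every program terminates and its effect is a total
  function.
\<close>

datatype com = Skip | Inc nat | Dec nat | Read bool nat | Write | Seq com com | Loop nat com

type_synonym arrays = "bool \<Rightarrow> nat \<Rightarrow> bool"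
type_synonym store = "(nat \<Rightarrow> nat) \<times> arrays"

definition dec :: "nat \<Rightarrow> store \<Rightarrow> store" where
  "dec i s = ((fst s)(i := fst s i - 1), snd s)"

primrec exec :: "com \<Rightarrow> store \<Rightarrow> store" where
  "exec Skip s = s"
| "exec (Inc i) s = ((fst s)(i := Suc (fst s i)), snd s)"
| "exec (Dec i) s = dec i s"
| "exec (Read b i) s = (if snd s b (fst s (of_bool b)) then ((fst s)(i := Suc (fst s i)), snd s) else s)"
| "exec Write s = (fst s, (snd s)(True := (snd s True)(fst s 1 := True)))"
| "exec (Seq c d) s = exec d (exec c s)"
| "exec (Loop i c) s = ((\<lambda>s. exec c (dec i s)) ^^ fst s i) s"

text \<open>
  Each command costs one step besides the steps of its parts; these are the steps of the
  stack machine below, and of the Turing machine.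
\<close>

primrec time :: "com \<Rightarrow> store \<Rightarrow> nat" where
  "time Skip s = 1"
| "time (Inc i) s = 1"
| "time (Dec i) s = 1"
| "time (Read b i) s = 1"
| "time Write s = 1"
| "time (Seq c d) s = 1 + time c s + time d (exec c s)"
| "time (Loop i c) s = 1 + (\<Sum>k<fst s i. 1 + time c (dec i (((\<lambda>s. exec c (dec i s)) ^^ k) s)))"

primrec modified :: "com \<Rightarrow> nat set" where
  "modified Skip = {}"
| "modified (Inc i) = {i}"
| "modified (Dec i) = {i}"
| "modified (Read b i) = {i}"
| "modified Write = {}"
| "modified (Seq c d) = modified c \<union> modified d"
| "modified (Loop i c) = insert i (modified c)"

text \<open>
  A loop whose body leaves the loop register alone runs exactly as often as the register says at
  the beginning, which is what \<^const>\<open>exec\<close> assumes.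
\<close>

primrec wf_com :: "com \<Rightarrow> bool" where
  "wf_com Skip = True"
| "wf_com (Inc i) = True"
| "wf_com (Dec i) = True"
| "wf_com (Read b i) = True"
| "wf_com Write = True"
| "wf_com (Seq c d) = (wf_com c \<and> wf_com d)"
| "wf_com (Loop i c) = (wf_com c \<and> i \<notin> modified c)"

lemma exec_unmodified: "i \<notin> modified c \<Longrightarrow> fst (exec c s) i = fst s i"
proof (induction c arbitrary: s)
  case (Loop j c)
  have "fst (((\<lambda>s. exec c (dec j s)) ^^ k) s) i = fst s i" for k
    by (induction k) (use Loop in \<open>auto simp: dec_def\<close>)
  then show ?case by simp
qed (auto simp: dec_def)

text \<open>
  One step at a time, with the commands still to be done kept on a stack. Unfolding \<^const>\<open>Seq\<close> and
  \<^const>\<open>Loop\<close> onto the stack turns control flow into a finite set of stacks.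
\<close>

fun small_step :: "com list \<times> store \<Rightarrow> com list \<times> store" where
  "small_step ([], s) = ([], s)"
| "small_step (Seq c d # K, s) = (c # d # K, s)"
| "small_step (Loop i c # K, s) = (if fst s i = 0 then (K, s) else (c # Loop i c # K, dec i s))"
| "small_step (c # K, s) = (K, exec c s)"

lemma funpow_trans: "(f ^^ m) x = y \<Longrightarrow> (f ^^ n) y = z \<Longrightarrow> (f ^^ (m + n)) x = z"
  by (simp add: add.commute[of m n] funpow_add)

lemma small_steps_exec:
  "wf_com c \<Longrightarrow> (small_step ^^ time c s) (c # K, s) = (K, exec c s)"
proof (induction c arbitrary: s K)
  case (Seq c d)
  have "(small_step ^^ (1 + time c s + time d (exec c s))) (Seq c d # K, s) = (K, exec d (exec c s))"
    by (rule funpow_trans[OF funpow_trans[OF _ Seq.IH(1)] Seq.IH(2)]) (use Seq.prems in simp_all)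
  then show ?case by simp
next
  case (Loop i c)
  define F where "F = (\<lambda>s. exec c (dec i s))"
  have F: "fst (F s) i = fst s i - 1" for s
    using Loop.prems by (simp add: F_def exec_unmodified dec_def)
  have "(small_step ^^ (1 + (\<Sum>k<n. 1 + time c (dec i ((F ^^ k) s))))) (Loop i c # K, s) = (K, (F ^^ n) s)"
    if "fst s i = n" for n s
    using that
  proof (induction n arbitrary: s)
    case 0
    then show ?case by simp
  next
    case (Suc n)
    have sum: "1 + (\<Sum>k<Suc n. 1 + time c (dec i ((F ^^ k) s)))
      = 1 + time c (dec i s) + (1 + (\<Sum>k<n. 1 + time c (dec i ((F ^^ k) (F s)))))"
      by (simp only: sum.lessThan_Suc_shift funpow_Suc_right comp_def) simp
    have "(small_step ^^ \<dots>) (Loop i c # K, s) = (K, (F ^^ n) (F s))"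
    proof (rule funpow_trans[OF funpow_trans])
      show "(small_step ^^ 1) (Loop i c # K, s) = (c # Loop i c # K, dec i s)"
        using Suc.prems by simp
      show "(small_step ^^ time c (dec i s)) (c # Loop i c # K, dec i s) = (Loop i c # K, F s)"
        using Loop by (simp add: F_def)
      show "(small_step ^^ (1 + (\<Sum>k<n. 1 + time c (dec i ((F ^^ k) (F s))))))
          (Loop i c # K, F s) = (K, (F ^^ n) (F s))"
        by (rule Suc.IH) (use F Suc.prems in simp)
    qed
    then show ?case by (simp only: sum funpow_Suc_right comp_def)
  qed
  from this[OF refl, of s] show ?case by (simp add: F_def)
qed auto

text \<open>
  The stacks that occur while \<open>c\<close> is executed on top of \<open>K\<close>. They are finitely many, because a
  command is only ever pushed onto the context in which it occurs in the program; so they can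
  serve as states of a Turing machine.
\<close>

primrec controls :: "com \<Rightarrow> com list \<Rightarrow> com list set" where
  "controls Skip K = {Skip # K}"
| "controls (Inc i) K = {Inc i # K}"
| "controls (Dec i) K = {Dec i # K}"
| "controls (Read b i) K = {Read b i # K}"
| "controls Write K = {Write # K}"
| "controls (Seq c d) K = {Seq c d # K} \<union> controls c (d # K) \<union> controls d K"
| "controls (Loop i c) K = {Loop i c # K} \<union> controls c (Loop i c # K)"

lemma finite_controls: "finite (controls c K)"
  by (induction c arbitrary: K) auto

lemma start_in_controls: "c # K \<in> controls c K"
  by (induction c arbitrary: K) auto

lemma controls_closed:
  "Y \<in> controls c K \<Longrightarrow> fst (small_step (Y, s)) \<in> insert K (controls c K)"
proof (induction c arbitrary: K)
  case (Seq c d)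
  show ?case
    using Seq.prems Seq.IH(1)[of "d # K"] Seq.IH(2)[of K] start_in_controls
    by (auto simp: start_in_controls)
next
  case (Loop i c)
  show ?case
    using Loop.prems Loop.IH[of "Loop i c # K"] start_in_controls[of c "Loop i c # K"]
    by (cases "fst s i = 0") auto
qed auto

primrec head_reg :: "com \<Rightarrow> nat set" where
  "head_reg Skip = {}"
| "head_reg (Inc i) = {i}"
| "head_reg (Dec i) = {i}"
| "head_reg (Read b i) = {i}"
| "head_reg Write = {}"
| "head_reg (Seq c d) = {}"
| "head_reg (Loop i c) = {i}"

lemma controls_regs:
  "Y \<in> controls c K \<Longrightarrow> Y \<noteq> [] \<and> head_reg (hd Y) \<subseteq> modified c"
  by (induction c arbitrary: K) fastforce+

section \<open>Loop programs on Turing machines\<close>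

text \<open>
  A small step in terms of the symbols under the heads. A symbol of at least 3 marks position 0 of
  a tape, and the residue 2 modulo 3 stands for an array entry \<^term>\<open>True\<close>.
\<close>

fun next_control :: "com list \<Rightarrow> nat list \<Rightarrow> com list" where
  "next_control [] ss = []"
| "next_control (Seq c d # K) ss = c # d # K"
| "next_control (Loop i c # K) ss = (if ss ! i \<ge> 3 then K else c # Loop i c # K)"
| "next_control (c # K) ss = K"

fun head_action :: "com \<Rightarrow> nat list \<Rightarrow> nat \<Rightarrow> head_move" where
  "head_action (Inc i) ss j = (if j = i then Move_Right else Stay)"
| "head_action (Dec i) ss j = (if j = i \<and> ss ! i < 3 then Move_Left else Stay)"
| "head_action (Loop i c) ss j = (if j = i \<and> ss ! i < 3 then Move_Left else Stay)"
| "head_action (Read b i) ss j = (if j = i \<and> ss ! of_bool b mod 3 = 2 then Move_Right else Stay)"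
| "head_action _ ss j = Stay"

definition written :: "com \<Rightarrow> nat list \<Rightarrow> nat \<Rightarrow> nat" where
  "written c ss j = (if c = Write \<and> j = 1 then (if ss ! 1 \<ge> 3 then 5 else 2) else ss ! j)"

text \<open>
  Cells hold 0, 1 or 2, increased by 3 exactly at position 0, so that a head sees whether its register
  is 0. Since \<^const>\<open>bit_symbol\<close> maps \<^term>\<open>True\<close> to 2, the input needs no recoding except for that mark.
  Cells at negative positions are never visited.
\<close>

definition represents :: "nat \<Rightarrow> tape list \<Rightarrow> store \<Rightarrow> bool" where
  "represents m ts s \<longleftrightarrow> length ts = m \<and>
     (\<forall>j<m. head_pos (ts ! j) = int (fst s j) \<and>
        (\<forall>p. content (ts ! j) (int p) < 6 \<and> (3 \<le> content (ts ! j) (int p) \<longleftrightarrow> p = 0))) \<and>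
     (\<forall>b p. content (ts ! of_bool b) (int p) mod 3 = 2 \<longleftrightarrow> snd s b p)"

lemma represents_step:
  assumes rep: "represents m ts s" and m: "m \<ge> 2" and K: "K \<noteq> []" "head_reg (hd K) \<subseteq> {..<m}"
    and ss: "ss = map read_tape ts"
  shows "next_control K ss = fst (small_step (K, s))"
    and "represents m (map2 act (map (\<lambda>j. (written (hd K) ss j, head_action (hd K) ss j)) [0..<m]) ts)
           (snd (small_step (K, s)))"
proof -
  have len: "length ts = m" using rep by (simp add: represents_def)
  have ssj: "ss ! j = content (ts ! j) (int (fst s j))" if "j < m" for j
    using that rep by (simp add: ss represents_def read_tape_def)
  have zero: "3 \<le> ss ! j \<longleftrightarrow> fst s j = 0" if "j < m" for j
    using that rep by (simp add: ssj represents_def)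
  have zero': "ss ! j < 3 \<longleftrightarrow> fst s j \<noteq> 0" if "j < m" for j
    using zero[OF that] by linarith
  have lt6: "ss ! j < 6" if "j < m" for j
    using that rep by (simp add: ssj represents_def)
  have b: "of_bool b < m" for b :: bool using m by (cases b) auto
  have rd: "ss ! of_bool b mod 3 = 2 \<longleftrightarrow> snd s b (fst s (of_bool b))" for b
    using rep b by (simp add: ssj represents_def)
  obtain c K' where Kc: "K = c # K'" using K by (cases K) auto
  have reg: "head_reg c \<subseteq> {..<m}" using K Kc by simp
  show "next_control K ss = fst (small_step (K, s))"
    using reg unfolding Kc by (cases c) (auto simp: zero dest!: leI split: if_splits)
  define s' where "s' = snd (small_step (K, s))"
  define ts' where "ts' = map2 act (map (\<lambda>j. (written (hd K) ss j, head_action (hd K) ss j)) [0..<m]) ts"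
  have nth: "ts' ! j = act (written c ss j, head_action c ss j) (ts ! j)" if "j < m" for j
    using that len by (simp add: Kc ts'_def)
  have len': "length ts' = m" using len by (simp add: ts'_def)
  have pos: "head_pos (ts' ! j) = int (fst s' j)" if "j < m" for j
  proof -
    have "int (fst s j) + shift (head_action c ss j) = int (fst s' j)"
      using reg that unfolding s'_def Kc
      by (cases c) (auto simp: zero zero' rd dec_def split: if_splits)
    then show ?thesis using that rep by (simp add: nth act_def represents_def)
  qed
  have con: "content (ts' ! j) q = (if q = int (fst s j) then written c ss j else content (ts ! j) q)"
    if "j < m" for j q
    using that rep by (simp add: nth act_def represents_def)
  have w: "written c ss j < 6 \<and> (3 \<le> written c ss j \<longleftrightarrow> fst s j = 0)" if "j < m" for j
    using that lt6[OF that] zero[OF that] m zero[of 1] by (auto simp: written_def)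
  have arr: "content (ts' ! of_bool b) (int p) mod 3 = 2 \<longleftrightarrow> snd s' b p" for b p
  proof -
    have "snd s' = (if c = Write then (snd s)(True := (snd s True)(fst s 1 := True)) else snd s)"
      unfolding s'_def Kc by (cases c) (auto simp: dec_def)
    moreover have "content (ts ! of_bool b) (int p) mod 3 = 2 \<longleftrightarrow> snd s b p"
      using rep by (simp add: represents_def)
    moreover have "content (ts' ! of_bool b) (int p) =
        (if p = fst s (of_bool b) then written c ss (of_bool b) else content (ts ! of_bool b) (int p))"
      using con[OF b] by simp
    ultimately show ?thesis
      using rd[of b] by (cases b) (auto simp: written_def)
  qed
  show "represents m (map2 act (map (\<lambda>j. (written (hd K) ss j, head_action (hd K) ss j)) [0..<m]) ts) (snd (small_step (K, s)))"
    unfolding s'_def[symmetric] ts'_def[symmetric] represents_def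
    using pos arr w rep len' by (auto simp: con represents_def)
qed

definition arrays_of :: "bool list \<Rightarrow> (nat \<Rightarrow> bool) \<Rightarrow> arrays" where
  "arrays_of w A = (\<lambda>b. if b then A else (\<lambda>p. p < length w \<and> w ! p))"

text \<open>
  Before the program starts, the heads of tapes 0 and 2 are moved to the end of the input together,
  which leaves its length in both registers.
\<close>

definition initial_store :: "bool list \<Rightarrow> store" where
  "initial_store w = ((\<lambda>_. 0)(0 := length w, 2 := length w), arrays_of w (\<lambda>_. False))"

text \<open>
  State 2 puts the mark on position 0 of every tape, state 3 moves heads 0 and 2 to the end of the
  input, and the states from 4 on are the control stacks. The empty stack accepts iff register
  \<open>out\<close> is not 0.
\<close>

definition machine :: "com \<Rightarrow> nat \<Rightarrow> nat \<Rightarrow> (com list \<Rightarrow> nat) \<Rightarrow> turing_machine" where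
  "machine c m out idx = (let Q = insert [] (controls c []) in
    \<lparr>num_tapes = m, num_states = card Q + 4, num_symbols = 6, start_state = 2,
     accept_state = 0, reject_state = 1,
     delta = (\<lambda>q ss.
       if q = 2 then (3, map (\<lambda>j. (if ss ! j < 3 then ss ! j + 3 else ss ! j, Stay)) [0..<m])
       else if q = 3 then
         (if ss ! 0 mod 3 = 0 then (idx [c] + 4, map (\<lambda>j. (ss ! j, Stay)) [0..<m])
          else (3, map (\<lambda>j. (ss ! j, if j = 0 \<or> j = 2 then Move_Right else Stay)) [0..<m]))
       else let K = inv_into Q idx (q - 4) in
         if K = [] then (if ss ! out \<ge> 3 then 1 else 0, map (\<lambda>j. (ss ! j, Stay)) [0..<m])
         else (idx (next_control K ss) + 4,
               map (\<lambda>j. (written (hd K) ss j, head_action (hd K) ss j)) [0..<m]))\<rparr>)"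

locale machine_setup =
  fixes c :: com and m out :: nat and idx :: "com list \<Rightarrow> nat"
  assumes wf: "wf_com c" and regs: "modified c \<subseteq> {..<m}" and m: "m \<ge> 3" and out: "out < m"
    and idx: "bij_betw idx (insert [] (controls c [])) {..<card (insert [] (controls c []))}"
begin

abbreviation "M \<equiv> machine c m out idx"
abbreviation "Q \<equiv> insert [] (controls c [])"

lemma sel [simp]:
  "num_tapes M = m" "num_symbols M = 6" "num_states M = card Q + 4" "start_state M = 2"
  "accept_state M = 0" "reject_state M = 1"
  by (simp_all add: machine_def Let_def)

lemma idx_less: "K \<in> Q \<Longrightarrow> idx K < card Q"
  using idx by (auto simp: bij_betw_def)

lemma inv_idx: "K \<in> Q \<Longrightarrow> inv_into Q idx (idx K) = K"
  using idx by (meson bij_betw_inv_into_left)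

lemma inv_idx_in: "q < card Q \<Longrightarrow> inv_into Q idx q \<in> Q"
  using idx by (metis bij_betw_def inv_into_into lessThan_iff)

lemma next_in: "K \<in> Q \<Longrightarrow> next_control K ss \<in> Q"
proof -
  assume K: "K \<in> Q"
  have "next_control K ss = fst (small_step (K, (\<lambda>i. if 3 \<le> ss ! i then 0 else 1, undefined)))"
    by (cases "(K, ss)" rule: next_control.cases) auto
  then show ?thesis using K controls_closed[of K c "[]"] by auto
qed

lemma head_reg_less: "K \<in> Q \<Longrightarrow> K \<noteq> [] \<Longrightarrow> head_reg (hd K) \<subseteq> {..<m}"
  using controls_regs[of K c "[]"] regs by auto

lemma wf_machine: "wf_turing_machine M"
proof -
  have *: "fst (delta M q ss) < card Q + 4 \<and> length (snd (delta M q ss)) = m \<and>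
        (\<forall>(s, d) \<in> set (snd (delta M q ss)). s < 6)"
    if q: "q < card Q + 4" and len: "length ss = m" and ss: "set ss \<subseteq> {..<6}" for q ss
  proof -
    have ss6: "ss ! j < 6" if "j < m" for j
      using ss that len by (metis lessThan_iff nth_mem subsetD)
    have "idx [c] < card Q" by (rule idx_less) (simp add: start_in_controls)
    moreover have "idx (next_control (inv_into Q idx (q - 4)) ss) < card Q" if "q \<noteq> 2" "q \<noteq> 3" "inv_into Q idx (q - 4) \<noteq> []"
    proof (rule idx_less, rule next_in)
      have "q - 4 < card Q" using q by (cases "q < 4") (auto simp: card_gt_0_iff finite_controls)
      then show "inv_into Q idx (q - 4) \<in> Q" by (rule inv_idx_in)
    qed
    moreover have "card Q > 0" by (simp add: card_gt_0_iff finite_controls)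
    ultimately have "fst (delta M q ss) < card Q + 4" "length (snd (delta M q ss)) = m"
      by (simp_all add: machine_def Let_def)
    moreover have "written c' ss j < 6" if "j < m" for c' j
      using ss6[OF that] by (simp add: written_def)
    then have "\<forall>(s, d) \<in> set (snd (delta M q ss)). s < 6"
      using ss6 by (simp add: machine_def Let_def)
    ultimately show ?thesis by blast
  qed
  have "\<forall>q ss. q < card Q + 4 \<and> length ss = m \<and> set ss \<subseteq> {..<6} \<longrightarrow>
      fst (delta M q ss) < card Q + 4 \<and> length (snd (delta M q ss)) = m \<and>
      (\<forall>(s, d) \<in> set (snd (delta M q ss)). s < 6)"
    using * by blast
  then show ?thesis
    unfolding wf_turing_machine_def sel using m by (intro conjI; (assumption | simp))
qed

lemma sim_step:
  assumes "K \<in> Q" "K \<noteq> []" "represents m ts s"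
  obtains ts' where "step M (idx K + 4, ts) = (idx (fst (small_step (K, s))) + 4, ts')"
    "represents m ts' (snd (small_step (K, s)))"
proof -
  have "step M (idx K + 4, ts) = (idx (next_control K (map read_tape ts)) + 4,
      map2 act (map (\<lambda>j. (written (hd K) (map read_tape ts) j, head_action (hd K) (map read_tape ts) j)) [0..<m]) ts)"
    using assms by (simp add: step_def Let_def machine_def inv_idx)
  then show ?thesis
    using that represents_step[OF assms(3) _ assms(2) head_reg_less[OF assms(1,2)] refl] m by auto
qed

lemma sim_steps:
  assumes "K \<in> Q" "represents m ts s" "(small_step ^^ t) (K, s) = ([], s')"
  shows "\<exists>t'\<le>t. \<exists>ts'. (step M ^^ t') (idx K + 4, ts) = (idx [] + 4, ts') \<and> represents m ts' s'"
  using assms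
proof (induction t arbitrary: K ts s)
  case 0
  then show ?case by auto
next
  case (Suc t)
  show ?case
  proof (cases "K = []")
    case True
    have "(small_step ^^ n) ([], s) = ([], s)" for n by (induction n) auto
    then have "s' = s" using Suc.prems(3) True by (metis Pair_inject)
    then show ?thesis using Suc.prems True by (intro exI[of _ 0]) auto
  next
    case False
    obtain ts1 where ts1: "step M (idx K + 4, ts) = (idx (fst (small_step (K, s))) + 4, ts1)"
      "represents m ts1 (snd (small_step (K, s)))"
      using sim_step[OF Suc.prems(1) False Suc.prems(2)] .
    have "fst (small_step (K, s)) \<in> Q"
      using Suc.prems(1) controls_closed[of K c "[]" s] by auto
    moreover have "(small_step ^^ t) (fst (small_step (K, s)), snd (small_step (K, s))) = ([], s')"
      using Suc.prems(3) by (simp add: funpow_swap1)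
    ultimately obtain t' ts' where "t' \<le> t"
      "(step M ^^ t') (idx (fst (small_step (K, s))) + 4, ts1) = (idx [] + 4, ts')" "represents m ts' s'"
      using Suc.IH ts1(2) by blast
    then show ?thesis
      by (intro exI[of _ "Suc t'"]) (auto simp: funpow_swap1 ts1(1))
  qed
qed

text \<open>
  The tapes while state 3 scans the input, \<open>i\<close> cells after the beginning.
\<close>

definition scan_tapes :: "bool list \<Rightarrow> nat \<Rightarrow> tape list" where
  "scan_tapes w i = map (\<lambda>j.
     \<lparr>content = (if j = 0 then content (input_tape w) else (\<lambda>_. 0))
         (0 := if j = 0 then content (input_tape w) 0 + 3 else 3),
      head_pos = if j = 0 \<or> j = 2 then int i else 0\<rparr>) [0..<m]"

lemma read_scan: "j < m \<Longrightarrow> map read_tape (scan_tapes w i) ! j =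
   (if j = 0 then (if i < length w then bit_symbol (w ! i) else 0) else 0) + (if i = 0 \<or> j \<noteq> 0 \<and> j \<noteq> 2 then 3 else 0)"
  by (auto simp: scan_tapes_def read_tape_def input_tape_def)

lemma map2_act:
  "length ts = m \<Longrightarrow> map2 act (map f [0..<m]) ts = map (\<lambda>j. act (f j) (ts ! j)) [0..<m]"
  by (auto intro!: nth_equalityI)

lemma first_step: "step M (init_config M w) = (3, scan_tapes w 0)"
proof -
  define ts where "ts = input_tape w # replicate (m - 1) blank_tape"
  let ?ss = "map read_tape ts" and ?f = "\<lambda>ss j. (if ss ! j < 3 then ss ! j + 3 else ss ! j, Stay)"
  have len: "length ts = m" using m by (simp add: ts_def)
  have nth: "ts ! j = (if j = 0 then input_tape w else blank_tape)" if "j < m" for j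
    using that by (auto simp: ts_def nth_Cons split: nat.split)
  have "map2 act (map (?f ?ss) [0..<m]) ts = scan_tapes w 0"
    using len by (subst map2_act) (auto intro!: nth_equalityI simp: scan_tapes_def act_def nth
        read_tape_def blank_tape_def input_tape_def bit_symbol_def)
  moreover have "delta M 2 ?ss = (3, map (?f ?ss) [0..<m])"
    by (simp add: machine_def Let_def del: map_map)
  ultimately have "step M (2, ts) = (3, scan_tapes w 0)"
    by (simp add: step_def del: map_map)
  then show ?thesis by (simp add: init_config_def ts_def)
qed

lemma scan_step:
  assumes "i < length w"
  shows "step M (3, scan_tapes w i) = (3, scan_tapes w (Suc i))"
proof -
  let ?ss = "map read_tape (scan_tapes w i)"
  have "?ss ! 0 mod 3 \<noteq> 0"
    using assms m by (subst read_scan) (auto simp: bit_symbol_def)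
  then have "delta M 3 ?ss = (3, map (\<lambda>j. (?ss ! j, if j = 0 \<or> j = 2 then Move_Right else Stay)) [0..<m])"
    by (simp add: machine_def Let_def)
  moreover have "map2 act (map (\<lambda>j. (?ss ! j, if j = 0 \<or> j = 2 then Move_Right else Stay)) [0..<m]) (scan_tapes w i)
      = scan_tapes w (Suc i)"
    by (subst map2_act) (auto intro!: nth_equalityI simp: scan_tapes_def act_def read_tape_def)
  ultimately show ?thesis by (simp add: step_def del: map_map)
qed

lemma last_scan_step:
  "step M (3, scan_tapes w (length w)) = (idx [c] + 4, scan_tapes w (length w))"
proof -
  let ?ss = "map read_tape (scan_tapes w (length w))"
  have "?ss ! 0 mod 3 = 0"
    using m by (subst read_scan) auto
  then have "delta M 3 ?ss = (idx [c] + 4, map (\<lambda>j. (?ss ! j, Stay)) [0..<m])"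
    by (simp add: machine_def Let_def)
  moreover have "map2 act (map (\<lambda>j. (?ss ! j, Stay)) [0..<m]) (scan_tapes w (length w))
      = scan_tapes w (length w)"
    by (subst map2_act) (auto intro!: nth_equalityI simp: scan_tapes_def act_def read_tape_def)
  ultimately show ?thesis by (simp add: step_def del: map_map)
qed

lemma represents_scan: "represents m (scan_tapes w (length w)) (initial_store w)"
proof -
  have b: "of_bool b < m" for b :: bool using m by (cases b) auto
  show ?thesis
    using m b by (auto simp: represents_def scan_tapes_def initial_store_def arrays_of_def
        input_tape_def bit_symbol_def)
qed

lemma run_machine:
  "\<exists>t \<le> length w + 3 + time c (initial_store w).
     fst (run M w t) = (if fst (exec c (initial_store w)) out \<noteq> 0 then 0 else 1)"
proof -
  have scan: "(step M ^^ i) (3, scan_tapes w 0) = (3, scan_tapes w i)" if "i \<le> length w" for i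
    using that by (induction i) (auto simp: scan_step)
  obtain t ts where t: "t \<le> time c (initial_store w)"
    "(step M ^^ t) (idx [c] + 4, scan_tapes w (length w)) = (idx [] + 4, ts)"
    "represents m ts (exec c (initial_store w))"
    using sim_steps[OF _ represents_scan small_steps_exec[OF wf]] start_in_controls[of c "[]"] by blast
  have halt: "(step M ^^ 1) (idx [] + 4, ts) =
     (if fst (exec c (initial_store w)) out \<noteq> 0 then 0 else 1, snd (step M (idx [] + 4, ts)))"
  proof -
    let ?ss = "map read_tape ts"
    have "?ss ! out \<ge> 3 \<longleftrightarrow> fst (exec c (initial_store w)) out = 0"
      using t(3) out by (simp add: represents_def read_tape_def)
    moreover have "fst (delta M (idx [] + 4) ?ss) = (if ?ss ! out \<ge> 3 then 1 else 0)"
      by (simp add: machine_def Let_def inv_idx del: map_map)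
    ultimately have "fst (step M (idx [] + 4, ts)) = (if fst (exec c (initial_store w)) out \<noteq> 0 then 0 else 1)"
      by (simp add: step_def Let_def del: map_map)
    then show ?thesis by (simp add: prod_eq_iff)
  qed
  have one: "(step M ^^ 1) (init_config M w) = (3, scan_tapes w 0)"
    by (simp add: first_step)
  have three: "(step M ^^ 1) (3, scan_tapes w (length w)) = (idx [c] + 4, scan_tapes w (length w))"
    by (simp add: last_scan_step)
  note funpow_trans[OF funpow_trans[OF funpow_trans[OF funpow_trans[OF one scan[OF order_refl]] three] t(2)] halt]
  then have res: "fst (run M w (1 + length w + 1 + t + 1)) = (if fst (exec c (initial_store w)) out \<noteq> 0 then 0 else 1)"
    by (simp only: run_def fst_conv)
  have "1 + length w + 1 + t + 1 \<le> length w + 3 + time c (initial_store w)"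
    using t(1) by linarith
  with res show ?thesis by (intro exI[of _ "1 + length w + 1 + t + 1"] conjI)
qed

end

theorem PTIME_if_com:
  assumes wf: "wf_com c"
    and dec: "\<And>w. w \<in> L \<longleftrightarrow> fst (exec c (initial_store w)) out \<noteq> 0"
    and time: "\<And>w. time c (initial_store w) \<le> poly p (length w)"
  shows "L \<in> PTIME"
proof -
  define m where "m = Max (insert out (insert 2 (modified c))) + 1"
  have fin: "finite (modified c)" by (induction c) auto
  have less: "x < m" if "x \<in> insert out (insert 2 (modified c))" for x
    using that fin unfolding m_def by (metis Max_ge finite_insert le_imp_less_Suc Suc_eq_plus1)
  obtain idx where "bij_betw idx (insert [] (controls c [])) {0..<card (insert [] (controls c []))}"
    using ex_bij_betw_finite_nat[of "insert [] (controls c [])"] finite_controls by blast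
  moreover have "m \<ge> 3" using less[of 2] by simp
  ultimately interpret machine_setup c m out idx
    using less wf by unfold_locales (auto simp: lessThan_atLeast0)
  have "decides_in_time M L (poly (monom 1 1 + [:3:] + p))"
    unfolding decides_in_time_def
  proof
    fix w
    obtain t where "t \<le> length w + 3 + time c (initial_store w)"
      "fst (run M w t) = (if fst (exec c (initial_store w)) out \<noteq> 0 then 0 else 1)"
      using run_machine by blast
    then show "\<exists>t\<le>poly (monom 1 1 + [:3:] + p) (length w).
        fst (run M w t) = (if w \<in> L then accept_state M else reject_state M)"
      using time[of w] by (intro exI[of _ t]) (auto simp: dec poly_monom)
  qed
  then show ?thesis using wf_machine by (auto simp: PTIME_def)
qed

section \<open>Arithmetic expressions\<close>

text \<open>
  \<open>Sum d e\<close> binds a variable: it adds up the values of \<open>e\<close> with variable 0 running from 0 to the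
  value of \<open>d\<close> minus 1 and the outer variables shifted by one. \<open>Arr b e\<close> looks up an entry of an array.
\<close>

datatype exp = Var nat | Const nat | Add exp exp | Mul exp exp | Sub exp exp | Sum exp exp | Arr bool exp

primrec value_of :: "exp \<Rightarrow> arrays \<Rightarrow> (nat \<Rightarrow> nat) \<Rightarrow> nat" where
  "value_of (Var i) a \<rho> = \<rho> i"
| "value_of (Const n) a \<rho> = n"
| "value_of (Add d e) a \<rho> = value_of d a \<rho> + value_of e a \<rho>"
| "value_of (Mul d e) a \<rho> = value_of d a \<rho> * value_of e a \<rho>"
| "value_of (Sub d e) a \<rho> = value_of d a \<rho> - value_of e a \<rho>"
| "value_of (Sum d e) a \<rho> = (\<Sum>t<value_of d a \<rho>. value_of e a (case_nat t \<rho>))"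
| "value_of (Arr b e) a \<rho> = of_bool (a b (value_of e a \<rho>))"

primrec bound :: "exp \<Rightarrow> nat poly" where
  "bound (Var i) = [:0, 1:]"
| "bound (Const n) = [:n:]"
| "bound (Add d e) = bound d + bound e"
| "bound (Mul d e) = bound d * bound e"
| "bound (Sub d e) = bound d"
| "bound (Sum d e) = bound d * pcompose (bound e) ([:0, 1:] + bound d)"
| "bound (Arr b e) = 1"

lemma poly_nat_mono: "x \<le> y \<Longrightarrow> poly p x \<le> poly p y" for p :: "nat poly"
  by (induction p) (auto intro!: add_mono mult_mono)

text \<open>
  Sums and products of polynomially bounded functions are polynomially bounded, whatever the arrays
  contain.
\<close>

lemma value_of_le_bound:
  "(\<And>i. \<rho> i \<le> N) \<Longrightarrow> value_of e a \<rho> \<le> poly (bound e) N"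
proof (induction e arbitrary: \<rho> N)
  case (Sum d e)
  have d: "value_of d a \<rho> \<le> poly (bound d) N" using Sum by blast
  have "(\<Sum>t<value_of d a \<rho>. value_of e a (case_nat t \<rho>)) \<le>
      (\<Sum>t<value_of d a \<rho>. poly (bound e) (N + poly (bound d) N))"
  proof (rule sum_mono, rule Sum.IH)
    fix t i assume "t \<in> {..<value_of d a \<rho>}"
    then show "case_nat t \<rho> i \<le> N + poly (bound d) N"
      using d Sum.prems by (auto split: nat.split intro: trans_le_add1)
  qed
  also have "\<dots> \<le> poly (bound d) N * poly (bound e) (N + poly (bound d) N)"
    using d by simp
  finally show ?case by (simp add: poly_pcompose)
qed (auto intro: add_mono mult_mono diff_le_self le_trans)

text \<open>
  The program adds the value of the expression to register \<open>out\<close>. Variable \<open>i\<close> is kept in register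
  \<open>v i\<close>; the registers from \<open>f\<close> on are scratch space, equal to 0 before and after. Registers 0 and 1
  position the heads of the arrays and are 0 in between.
\<close>

primrec compile :: "exp \<Rightarrow> (nat \<Rightarrow> nat) \<Rightarrow> nat \<Rightarrow> nat \<Rightarrow> com" where
  "compile (Var i) v f out = Seq (Loop (v i) (Seq (Inc f) (Inc out))) (Loop f (Inc (v i)))"
| "compile (Const n) v f out = (Seq (Inc out) ^^ n) Skip"
| "compile (Add d e) v f out = Seq (compile d v f out) (compile e v f out)"
| "compile (Mul d e) v f out = Seq (compile d v (Suc f) f) (Loop f (compile e v (Suc f) out))"
| "compile (Sub d e) v f out =
     Seq (compile d v (Suc f) f) (Seq (compile e v (Suc (Suc f)) (Suc f))
       (Seq (Loop (Suc f) (Dec f)) (Loop f (Inc out))))"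
| "compile (Sum d e) v f out =
     Seq (compile d v (Suc f) f)
       (Seq (Loop f (Seq (compile e (case_nat (Suc f) v) (Suc (Suc f)) out) (Inc (Suc f))))
         (Loop (Suc f) Skip))"
| "compile (Arr b e) v f out =
     Seq (compile e v (Suc f) f)
       (Seq (Loop f (Inc (of_bool b))) (Seq (Read b out) (Loop (of_bool b) Skip)))"

primrec time_bound :: "exp \<Rightarrow> nat poly" where
  "time_bound (Var i) = [:3, 6:]"
| "time_bound (Const n) = [:1 + 2 * n:]"
| "time_bound (Add d e) = 1 + time_bound d + time_bound e"
| "time_bound (Mul d e) = 2 + time_bound d + bound d * (1 + time_bound e)"
| "time_bound (Sub d e) = 5 + time_bound d + time_bound e + 2 * bound e + 2 * bound d"
| "time_bound (Sum d e) = 4 + time_bound d +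
     bound d * (3 + pcompose (time_bound e) ([:0, 1:] + bound d)) + 2 * bound d"
| "time_bound (Arr b e) = 6 + time_bound e + 4 * bound e"

definition ready :: "(nat \<Rightarrow> nat) \<Rightarrow> nat \<Rightarrow> nat \<Rightarrow> (nat \<Rightarrow> nat) \<Rightarrow> bool" where
  "ready v f out r \<longleftrightarrow> 2 \<le> out \<and> out < f \<and> (\<forall>i. 2 \<le> v i \<and> v i < f \<and> v i \<noteq> out) \<and>
     r 0 = 0 \<and> r 1 = 0 \<and> (\<forall>i\<ge>f. r i = 0)"

lemma modified_compile:
  "x \<in> modified (compile e v f out) \<Longrightarrow> x = out \<or> x \<in> range v \<or> x < 2 \<or> x \<ge> f"
proof (induction e arbitrary: v f out)
  case (Const n)
  have "modified ((Seq (Inc out) ^^ n) Skip) \<subseteq> {out}" by (induction n) auto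
  then show ?case using Const by auto
next
  case (Add d e)
  show ?case using Add.IH[of v f out] Add.prems by auto
next
  case (Mul d e)
  show ?case using Mul.IH(1)[of v "Suc f" f] Mul.IH(2)[of v "Suc f" out] Mul.prems by auto
next
  case (Sub d e)
  show ?case using Sub.IH(1)[of v "Suc f" f] Sub.IH(2)[of v "Suc (Suc f)" "Suc f"] Sub.prems by auto
next
  case (Sum d e)
  have "x = Suc f \<or> x \<in> range v" if "x \<in> range (case_nat (Suc f) v)"
    using that by (auto split: nat.splits)
  then show ?case
    using Sum.IH(1)[of v "Suc f" f] Sum.IH(2)[of "case_nat (Suc f) v" "Suc (Suc f)" out] Sum.prems by auto
next
  case (Arr b e)
  show ?case using Arr.IH[of v "Suc f" f] Arr.prems by (cases b) auto
qed auto

text \<open>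
  Loop registers are not assigned in the body: expressions evaluated in a loop work with scratch space
  beyond the loop register, and variables differ from \<open>out\<close> and from all scratch registers.
\<close>

lemma wf_compile:
  "2 \<le> out \<Longrightarrow> out < f \<Longrightarrow> (\<And>i. 2 \<le> v i \<and> v i < f \<and> v i \<noteq> out) \<Longrightarrow> wf_com (compile e v f out)"
proof (induction e arbitrary: v f out)
  case (Var i)
  then show ?case using Var.prems(3)[of i] by auto
next
  case (Const n)
  have "wf_com ((Seq (Inc out) ^^ n) Skip)" by (induction n) auto
  then show ?case by simp
next
  case (Add d e)
  show ?case using Add.IH[OF Add.prems] by simp
next
  case (Mul d e)
  have v: "2 \<le> v i \<and> v i < Suc f \<and> v i \<noteq> out" "v i \<noteq> f" for i using Mul.prems(3)[of i] by auto
  have "f \<notin> modified (compile e v (Suc f) out)"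
    using modified_compile[of f e v "Suc f" out] Mul.prems(1,2) v by fastforce
  then show ?case using Mul.IH(1)[of f "Suc f" v] Mul.IH(2)[of out "Suc f" v] Mul.prems v by simp
next
  case (Sub d e)
  have v: "2 \<le> v i \<and> v i < Suc f \<and> v i < Suc (Suc f)" "v i \<noteq> out" "v i \<noteq> f" "v i \<noteq> Suc f" for i
    using Sub.prems(3)[of i] by auto
  show ?case using Sub.IH(1)[of f "Suc f" v] Sub.IH(2)[of "Suc f" "Suc (Suc f)" v] Sub.prems v by simp
next
  case (Sum d e)
  have v: "2 \<le> v i \<and> v i < Suc f \<and> v i \<noteq> out" "v i \<noteq> f" for i using Sum.prems(3)[of i] by auto
  have v': "2 \<le> case_nat (Suc f) v i \<and> case_nat (Suc f) v i < Suc (Suc f) \<and> case_nat (Suc f) v i \<noteq> out"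
    "case_nat (Suc f) v i \<noteq> f" for i
    using Sum.prems(1,2) v[of "i - 1"] by (auto split: nat.split)
  have "f \<notin> range (case_nat (Suc f) v)" using v'(2) by (metis rangeE)
  then have "f \<notin> modified (compile e (case_nat (Suc f) v) (Suc (Suc f)) out)"
    using modified_compile[of f e "case_nat (Suc f) v" "Suc (Suc f)" out] Sum.prems(1,2) by auto
  then show ?case
    using Sum.IH(1)[of f "Suc f" v] Sum.IH(2)[of out "Suc (Suc f)" "case_nat (Suc f) v"] Sum.prems(1,2) v v'
    by simp
next
  case (Arr b e)
  have v: "2 \<le> v i \<and> v i < Suc f" "v i \<noteq> f" for i using Arr.prems(3)[of i] by auto
  show ?case using Arr.IH[of f "Suc f" v] Arr.prems v by (cases b) auto
qed

lemma funpow_chain: "(\<And>k. k < n \<Longrightarrow> F (S k) = S (Suc k)) \<Longrightarrow> k \<le> n \<Longrightarrow> (F ^^ k) (S 0) = S k"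
  by (induction k) auto

text \<open>
  The form in which loops are used below: \<open>S k\<close> is the store after \<open>k\<close> rounds.
\<close>

lemma exec_Loop_chain:
  assumes "r i = n" "\<And>k. k < n \<Longrightarrow> exec c (dec i (S k)) = S (Suc k)" "S 0 = (r, a)"
  shows "exec (Loop i c) (r, a) = S n"
    "(\<And>k. k < n \<Longrightarrow> time c (dec i (S k)) \<le> B) \<Longrightarrow> time (Loop i c) (r, a) \<le> 1 + n * (1 + B)"
proof -
  have *: "((\<lambda>s. exec c (dec i s)) ^^ k) (r, a) = S k" if "k \<le> n" for k
    using funpow_chain[of n "\<lambda>s. exec c (dec i s)" S k] assms that by simp
  show "exec (Loop i c) (r, a) = S n" using * assms(1) by simp
  assume B: "\<And>k. k < n \<Longrightarrow> time c (dec i (S k)) \<le> B"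
  have "time (Loop i c) (r, a) = 1 + (\<Sum>k<n. 1 + time c (dec i (S k)))"
    using assms(1) * by (auto intro!: sum.cong)
  also have "\<dots> \<le> 1 + (\<Sum>k<n. 1 + B)"
    using B by (intro add_mono sum_mono) auto
  finally show "time (Loop i c) (r, a) \<le> 1 + n * (1 + B)" by simp
qed

lemma exec_Loop_Inc:
  assumes "i \<noteq> j"
  shows "exec (Loop i (Inc j)) (r, a) = (r(i := 0, j := r j + r i), a)"
    "time (Loop i (Inc j)) (r, a) = 1 + 2 * r i"
proof -
  show "exec (Loop i (Inc j)) (r, a) = (r(i := 0, j := r j + r i), a)"
    using assms exec_Loop_chain(1)[where S = "\<lambda>k. (r(i := r i - k, j := r j + k), a)" and r = r and i = i and n = "r i" and c = "Inc j" and a = a]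
    by (auto simp: dec_def fun_upd_twist fun_eq_iff)
qed simp

lemma exec_Loop_Inc2:
  assumes "i \<noteq> j" "i \<noteq> k" "j \<noteq> k"
  shows "exec (Loop i (Seq (Inc j) (Inc k))) (r, a) = (r(i := 0, j := r j + r i, k := r k + r i), a)"
    "time (Loop i (Seq (Inc j) (Inc k))) (r, a) = 1 + 4 * r i"
proof -
  show "exec (Loop i (Seq (Inc j) (Inc k))) (r, a) = (r(i := 0, j := r j + r i, k := r k + r i), a)"
    using assms exec_Loop_chain(1)[where S = "\<lambda>x. (r(i := r i - x, j := r j + x, k := r k + x), a)" and r = r and i = i and n = "r i" and c = "Seq (Inc j) (Inc k)" and a = a]
    by (auto simp: dec_def fun_eq_iff)
qed simp

lemma exec_Loop_Dec:
  assumes "i \<noteq> j"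
  shows "exec (Loop i (Dec j)) (r, a) = (r(i := 0, j := r j - r i), a)"
    "time (Loop i (Dec j)) (r, a) = 1 + 2 * r i"
proof -
  show "exec (Loop i (Dec j)) (r, a) = (r(i := 0, j := r j - r i), a)"
    using assms exec_Loop_chain(1)[where S = "\<lambda>k. (r(i := r i - k, j := r j - k), a)" and r = r and i = i and n = "r i" and c = "Dec j" and a = a]
    by (auto simp: dec_def fun_eq_iff)
qed simp

lemma exec_Loop_Skip:
  "exec (Loop i Skip) (r, a) = (r(i := 0), a)"
  "time (Loop i Skip) (r, a) = 1 + 2 * r i"
proof -
  show "exec (Loop i Skip) (r, a) = (r(i := 0), a)"
    using exec_Loop_chain(1)[where S = "\<lambda>k. (r(i := r i - k), a)" and r = r and i = i and n = "r i" and c = Skip and a = a]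
    by (auto simp: dec_def fun_eq_iff)
qed simp


lemma compile_correct:
  assumes "ready v f out r" "\<And>i. r (v i) \<le> N"
  shows "exec (compile e v f out) (r, a) = (r(out := r out + value_of e a (\<lambda>i. r (v i))), a) \<and>
    time (compile e v f out) (r, a) \<le> poly (time_bound e) N"
  using assms
proof (induction e arbitrary: v f out r N)
  case (Var i)
  have i: "v i \<noteq> f" "v i \<noteq> out" "out \<noteq> f" "r f = 0"
    using Var.prems(1) unfolding ready_def by (metis less_irrefl, blast, blast, blast)
  have N: "r (v i) \<le> N" by (rule Var.prems)
  show ?case using i N
    by (auto simp add: exec_Loop_Inc2 exec_Loop_Inc fun_eq_iff simp del: exec.simps(7) time.simps(7))
next
  case (Const n)
  have "exec ((Seq (Inc out) ^^ n) Skip) (r, a) = (r(out := r out + n), a) \<and>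
      time ((Seq (Inc out) ^^ n) Skip) (r, a) = 1 + 2 * n" for r
    by (induction n arbitrary: r) auto
  then show ?case by auto
next
  case (Add d e)
  define r1 where "r1 = r(out := r out + value_of d a (\<lambda>i. r (v i)))"
  have "v i \<noteq> out" for i using Add.prems(1) by (simp add: ready_def)
  then have env: "(\<lambda>i. r1 (v i)) = (\<lambda>i. r (v i))" by (simp add: r1_def)
  have rd: "ready v f out r1" using Add.prems(1) by (auto simp: ready_def r1_def)
  have le: "r1 (v i) \<le> N" for i using Add.prems(2)[of i] fun_cong[OF env, of i] by simp
  from Add.IH(2)[OF rd le, unfolded env]
    Add.IH(1)[OF Add.prems] show ?case by (auto simp: r1_def fun_upd_def add.assoc)
next
  case (Mul d e)
  define x where "x = value_of d a (\<lambda>i. r (v i))"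
  define y where "y = value_of e a (\<lambda>i. r (v i))"
  define S where "S k = (r(f := x - k, out := r out + k * y), a)" for k
  have f: "r f = 0" "out \<noteq> f" "v i \<noteq> out" "v i \<noteq> f" for i
    using Mul.prems(1) unfolding ready_def by (blast, blast, blast, metis less_irrefl)
  have x: "x \<le> poly (bound d) N" unfolding x_def by (rule value_of_le_bound) (rule Mul.prems)
  have 1: "exec (compile d v (Suc f) f) (r, a) = (r(f := x), a)"
      "time (compile d v (Suc f) f) (r, a) \<le> poly (time_bound d) N"
    using Mul.IH(1)[of v "Suc f" f r N] Mul.prems f by (auto simp: ready_def x_def less_SucI)
  have 2: "exec (compile e v (Suc f) out) (dec f (S k)) = S (Suc k) \<and>
      time (compile e v (Suc f) out) (dec f (S k)) \<le> poly (time_bound e) N" if "k < x" for k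
  proof -
    define r2 where "r2 = r(f := x - Suc k, out := r out + k * y)"
    have d: "dec f (S k) = (r2, a)" using f by (auto simp: S_def dec_def r2_def fun_eq_iff)
    have env: "(\<lambda>i. r2 (v i)) = (\<lambda>i. r (v i))" using f by (simp add: r2_def)
    have rd: "ready v (Suc f) out r2"
      using Mul.prems(1) f by (auto simp: ready_def less_SucI r2_def)
    have "r2 (v i) \<le> N" for i using Mul.prems(2)[of i] fun_cong[OF env, of i] by simp
    note IH = Mul.IH(2)[OF rd this, unfolded env, folded y_def]
    have "S (Suc k) = (r2(out := r2 out + y), a)" using f by (auto simp: S_def r2_def fun_eq_iff)
    with IH show ?thesis by (simp only: d)
  qed
  have S0: "S 0 = (r(f := x), a)" using f by (auto simp: S_def fun_eq_iff)
  have L: "exec (Loop f (compile e v (Suc f) out)) (r(f := x), a) = S x"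
    "time (Loop f (compile e v (Suc f) out)) (r(f := x), a) \<le> 1 + x * (1 + poly (time_bound e) N)"
    by (rule exec_Loop_chain[where n = x and S = S]; use 2 S0 in simp)+
  have "x * (1 + poly (time_bound e) N) \<le> poly (bound d) N * (1 + poly (time_bound e) N)"
    using x by (rule mult_le_mono1)
  moreover have "S x = (r(out := r out + x * y), a)"
    using f by (auto simp: S_def fun_eq_iff)
  ultimately show ?case using 1 L
    by (auto simp add: x_def[symmetric] y_def[symmetric] fun_eq_iff simp del: exec.simps(7) time.simps(7))
next
  case (Sub d e)
  define x where "x = value_of d a (\<lambda>i. r (v i))"
  define y where "y = value_of e a (\<lambda>i. r (v i))"
  have f: "r f = 0" "r (Suc f) = 0" "out \<noteq> f" "out \<noteq> Suc f" "v i \<noteq> f" "v i \<noteq> Suc f" for i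
    using Sub.prems(1) unfolding ready_def
    by (blast, simp, blast, (metis less_SucI less_irrefl), metis less_irrefl, metis less_SucI less_irrefl)
  have x: "x \<le> poly (bound d) N" unfolding x_def by (rule value_of_le_bound) (rule Sub.prems)
  have y: "y \<le> poly (bound e) N" unfolding y_def by (rule value_of_le_bound) (rule Sub.prems)
  have 1: "exec (compile d v (Suc f) f) (r, a) = (r(f := x), a)"
      "time (compile d v (Suc f) f) (r, a) \<le> poly (time_bound d) N"
    using Sub.IH(1)[of v "Suc f" f r N] Sub.prems f by (auto simp: ready_def x_def less_SucI)
  define r1 where "r1 = r(f := x)"
  have rd: "ready v (Suc (Suc f)) (Suc f) r1"
    using Sub.prems(1) f by (auto simp: ready_def less_SucI r1_def intro: less_imp_neq)
  have env: "(\<lambda>i. r1 (v i)) = (\<lambda>i. r (v i))" using f by (simp add: r1_def)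
  have le: "r1 (v i) \<le> N" for i using Sub.prems(2)[of i] fun_cong[OF env, of i] by simp
  have "r1 (Suc f) = 0" using f by (simp add: r1_def)
  then have 2: "exec (compile e v (Suc (Suc f)) (Suc f)) (r(f := x), a) = (r(f := x, Suc f := y), a)"
      "time (compile e v (Suc (Suc f)) (Suc f)) (r(f := x), a) \<le> poly (time_bound e) N"
    using Sub.IH(2)[OF rd le, unfolded env, folded y_def] unfolding r1_def[symmetric] by (simp_all add: fun_upd_def)
  have "r(f := x - y, Suc f := 0, f := 0, out := r out + (x - y)) = r(out := r out + (x - y))"
    using f by (auto simp: fun_eq_iff)
  then show ?case using 1 2 f x y
    by (auto simp add: x_def[symmetric] y_def[symmetric] exec_Loop_Dec exec_Loop_Inc fun_eq_iff simp del: exec.simps(7) time.simps(7))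
next
  case (Sum d e)
  define x where "x = value_of d a (\<lambda>i. r (v i))"
  define g where "g t = value_of e a (case_nat t (\<lambda>i. r (v i)))" for t
  define S where "S k = (r(f := x - k, Suc f := k, out := r out + (\<Sum>t<k. g t)), a)" for k
  let ?N = "N + poly (bound d) N"
  let ?c = "Seq (compile e (case_nat (Suc f) v) (Suc (Suc f)) out) (Inc (Suc f))"
  have f: "r f = 0" "r (Suc f) = 0" "out \<noteq> f" "out \<noteq> Suc f" "v i \<noteq> out" "v i \<noteq> f" "v i \<noteq> Suc f" for i
    using Sum.prems(1) unfolding ready_def
    by (blast, simp, blast, (metis less_SucI less_irrefl), blast, metis less_irrefl, metis less_SucI less_irrefl)
  have x: "x \<le> poly (bound d) N" unfolding x_def by (rule value_of_le_bound) (rule Sum.prems)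
  have 1: "exec (compile d v (Suc f) f) (r, a) = (r(f := x), a)"
      "time (compile d v (Suc f) f) (r, a) \<le> poly (time_bound d) N"
    using Sum.IH(1)[of v "Suc f" f r N] Sum.prems f by (auto simp: ready_def x_def less_SucI)
  have 2: "exec ?c (dec f (S k)) = S (Suc k) \<and>
      time ?c (dec f (S k)) \<le> 2 + poly (time_bound e) ?N" if k: "k < x" for k
  proof -
    define r2 where "r2 = r(f := x - Suc k, Suc f := k, out := r out + (\<Sum>t<k. g t))"
    have d: "dec f (S k) = (r2, a)" using f by (auto simp: S_def dec_def r2_def fun_eq_iff)
    have "2 \<le> case_nat (Suc f) v i \<and> case_nat (Suc f) v i < Suc (Suc f) \<and> case_nat (Suc f) v i \<noteq> out" for i
      using Sum.prems(1) f by (auto simp: ready_def less_SucI split: nat.split)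
    then have rd: "ready (case_nat (Suc f) v) (Suc (Suc f)) out r2"
      using Sum.prems(1) by (auto simp: ready_def r2_def)
    have env: "(\<lambda>i. r2 (case_nat (Suc f) v i)) = case_nat k (\<lambda>i. r (v i))"
      using f by (auto simp: fun_eq_iff r2_def split: nat.split)
    have le: "r2 (case_nat (Suc f) v i) \<le> ?N" for i
      using k x Sum.prems(2) f by (auto simp: r2_def split: nat.split intro: trans_le_add1)
    have IH: "exec (compile e (case_nat (Suc f) v) (Suc (Suc f)) out) (r2, a) = (r2(out := r2 out + g k), a) \<and>
        time (compile e (case_nat (Suc f) v) (Suc (Suc f)) out) (r2, a) \<le> poly (time_bound e) ?N"
      using Sum.IH(2)[OF rd le] unfolding env g_def by (simp add: fun_upd_def)
    define R where "R = r2(out := r2 out + g k)"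
    have "R (Suc f) = k" using f by (simp add: R_def r2_def)
    moreover have "S (Suc k) = (R(Suc f := Suc k), a)"
      using f by (auto simp: S_def R_def r2_def fun_eq_iff)
    ultimately show ?thesis using IH unfolding d R_def[symmetric] by simp
  qed
  have S0: "S 0 = (r(f := x), a)" using f by (auto simp: S_def fun_eq_iff)
  have L: "exec (Loop f ?c) (r(f := x), a) = S x"
    "time (Loop f ?c) (r(f := x), a) \<le> 1 + x * (1 + (2 + poly (time_bound e) ?N))"
    by (rule exec_Loop_chain[where n = x and S = S]; use 2 S0 in \<open>simp del: exec.simps time.simps\<close>)+
  have e3: "1 + (2 + z) = 3 + z" for z :: nat by simp
  have "x * (1 + (2 + poly (time_bound e) ?N)) \<le> poly (bound d) N * (1 + (2 + poly (time_bound e) ?N))"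
    using x by (rule mult_le_mono1)
  with L(2) have L2: "time (Loop f ?c) (r(f := x), a) \<le> 1 + poly (bound d) N * (3 + poly (time_bound e) ?N)"
    unfolding e3 by linarith
  have "(r(f := x - x, Suc f := x, out := r out + (\<Sum>t<x. g t)))(Suc f := 0) = r(out := r out + (\<Sum>t<x. g t))"
    using f by (auto simp: fun_eq_iff)
  moreover have "(r(f := x - x, Suc f := x, out := r out + (\<Sum>t<x. g t))) (Suc f) = x" using f by simp
  ultimately show ?case using 1 L(1) L2 x
    unfolding compile.simps exec.simps(6) time.simps(6) S_def
    by (auto simp add: x_def[symmetric] g_def[symmetric] exec_Loop_Skip poly_pcompose
        simp del: exec.simps(7) time.simps(7) compile.simps exec.simps(6) time.simps(6) fun_upd_apply diff_self_eq_0)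
next
  case (Arr b e)
  define x where "x = value_of e a (\<lambda>i. r (v i))"
  let ?j = "of_bool b :: nat"
  have j: "?j < 2" by (cases b) auto
  have f: "r f = 0" "out \<noteq> f" "f \<noteq> ?j" "out \<noteq> ?j" "r ?j = 0"
    using Arr.prems(1) j unfolding ready_def by (cases b; auto)+
  have vf: "\<forall>i. v i \<noteq> f" using Arr.prems(1) unfolding ready_def by (metis less_irrefl)
  have x: "x \<le> poly (bound e) N" unfolding x_def by (rule value_of_le_bound) (rule Arr.prems)
  have 1: "exec (compile e v (Suc f) f) (r, a) = (r(f := x), a)"
      "time (compile e v (Suc f) f) (r, a) \<le> poly (time_bound e) N"
    using Arr.IH[of v "Suc f" f r N] Arr.prems f vf by (auto simp: ready_def x_def less_SucI fun_upd_def)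
  have "r(f := 0, ?j := x, out := y, ?j := 0) = r(out := y)" for y
    using f by (auto simp: fun_eq_iff)
  moreover have "r(f := 0, ?j := x, ?j := 0) = r"
    using f by (auto simp: fun_eq_iff)
  ultimately show ?case using 1 f x
    by (auto simp add: x_def[symmetric] exec_Loop_Inc exec_Loop_Skip fun_eq_iff simp del: exec.simps(7) time.simps(7))
qed


section \<open>Languages decided by tabulation\<close>

definition definable :: "(arrays \<Rightarrow> (nat \<Rightarrow> nat) \<Rightarrow> nat) \<Rightarrow> bool" where
  "definable f \<longleftrightarrow> (\<exists>e. \<forall>a \<rho>. f a \<rho> = value_of e a \<rho>)"

text \<open>
  Entry \<open>t\<close> is computed from the input, the length of the input, \<open>t\<close>, and the entries before \<open>t\<close>.
\<close>

primrec table :: "(arrays \<Rightarrow> (nat \<Rightarrow> nat) \<Rightarrow> nat) \<Rightarrow> bool list \<Rightarrow> nat \<Rightarrow> nat \<Rightarrow> bool" where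
  "table \<phi> w 0 = (\<lambda>_. False)"
| "table \<phi> w (Suc t) = (table \<phi> w t)
     (t := \<phi> (arrays_of w (table \<phi> w t)) (case_nat t (case_nat (length w) (\<lambda>_. 0))) \<noteq> 0)"

lemma table_outside: "t \<le> i \<Longrightarrow> \<not> table \<phi> w t i"
  by (induction t) auto

text \<open>
  Register 2 holds the length of the input, 3 remains 0 and stands for all variables that have no
  value, 4 is the index \<open>t\<close> of the next entry, 5 counts the entries still to come, and 6 receives
  the values of \<open>\<phi>\<close> and \<open>\<psi>\<close>. To write an entry, register 1 is set to \<open>t\<close> by means of register 7, and
  the loop on register 6 writes iff the value of \<open>\<phi>\<close> is not 0.
\<close>

definition table_program :: "exp \<Rightarrow> exp \<Rightarrow> exp \<Rightarrow> com" where
  "table_program T \<phi> \<psi> =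
    Seq (Loop 0 Skip)
    (Seq (compile T (case_nat 2 (\<lambda>_. 3)) 7 5)
    (Seq (Loop 5
      (Seq (compile \<phi> (case_nat 4 (case_nat 2 (\<lambda>_. 3))) 7 6)
      (Seq (Loop 4 (Seq (Inc 7) (Inc 1)))
      (Seq (Loop 7 (Inc 4))
      (Seq (Loop 6 Write)
      (Seq (Loop 1 Skip) (Inc 4)))))))
    (compile \<psi> (case_nat 2 (\<lambda>_. 3)) 7 6)))"

lemma exec_Loop_Write:
  assumes "i \<noteq> 1"
  shows "exec (Loop i Write) (r, a) =
     (r(i := 0), if r i = 0 then a else a(True := (a True)((r(i := 0)) 1 := True)))"
  "time (Loop i Write) (r, a) = 1 + 2 * r i"
proof -
  show "exec (Loop i Write) (r, a) =
     (r(i := 0), if r i = 0 then a else a(True := (a True)((r(i := 0)) 1 := True)))"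
    using assms exec_Loop_chain(1)[where S = "\<lambda>k. (r(i := r i - k), if k = 0 then a else a(True := (a True)(r 1 := True)))"
        and r = r and i = i and n = "r i" and c = Write and a = a]
    by (auto simp: dec_def fun_eq_iff)
qed simp

text \<open>
  Each round of the main loop restores all registers except the counters 4 and 5. So the registers
  are polynomially bounded throughout, and the polynomial bounds for single expressions give one for
  the whole program.
\<close>

theorem PTIME_if_table:
  assumes "definable T" "definable \<phi>" "definable \<psi>"
    and L: "\<And>w. w \<in> L \<longleftrightarrow>
      \<psi> (arrays_of w (table \<phi> w (T (arrays_of w (\<lambda>_. False)) (case_nat (length w) (\<lambda>_. 0)))))
        (case_nat (length w) (\<lambda>_. 0)) \<noteq> 0"
  shows "L \<in> PTIME"
proof -
  obtain eT e\<phi> e\<psi> where e: "\<And>a \<rho>. T a \<rho> = value_of eT a \<rho>" "\<And>a \<rho>. \<phi> a \<rho> = value_of e\<phi> a \<rho>"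
      "\<And>a \<rho>. \<psi> a \<rho> = value_of e\<psi> a \<rho>"
    using assms(1-3) unfolding definable_def by blast
  define P where "P = bound eT"
  \<comment> \<open>the constants leave room for the loops that copy and clear counters; only the shape matters\<close>
  define p where "p = [:100, 100:] * (1 + time_bound eT + time_bound e\<psi> +
     P * (100 + 100 * P + pcompose (time_bound e\<phi>) ([:0, 1:] + P) + 2 * pcompose (bound e\<phi>) ([:0, 1:] + P)))"
  let ?v = "case_nat 2 (\<lambda>_. 3) :: nat \<Rightarrow> nat" and ?u = "case_nat 4 (case_nat 2 (\<lambda>_. 3)) :: nat \<Rightarrow> nat"
  let ?c = "Seq (compile e\<phi> ?u 7 6) (Seq (Loop 4 (Seq (Inc 7) (Inc 1))) (Seq (Loop 7 (Inc 4))
      (Seq (Loop 6 Write) (Seq (Loop 1 Skip) (Inc 4)))))"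
  have wf: "wf_com (table_program eT e\<phi> e\<psi>)"
  proof -
    have v: "2 \<le> ?v i \<and> ?v i < 7 \<and> ?v i \<noteq> 5 \<and> ?v i \<noteq> 6" for i by (auto split: nat.split)
    have u: "2 \<le> ?u i \<and> ?u i < 7 \<and> ?u i \<noteq> 5 \<and> ?u i \<noteq> 6" for i by (auto split: nat.split)
    have "5 \<notin> range ?u" using u by (metis rangeE)
    then have "5 \<notin> modified (compile e\<phi> ?u 7 6)"
      using modified_compile[of 5 e\<phi> ?u 7 6] by auto
    then show ?thesis
      using wf_compile[of 5 7 ?v eT] wf_compile[of 6 7 ?u e\<phi>] wf_compile[of 6 7 ?v e\<psi>] u v
      by (simp add: table_program_def)
  qed
  show ?thesis
  proof (rule PTIME_if_com[OF wf, where out = 6 and p = p])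
    fix w :: "bool list"
    define n where "n = length w"
    define r0 where "r0 = (\<lambda>_ :: nat. 0 :: nat)(2 := n)"
    define m where "m = T (arrays_of w (\<lambda>_. False)) (case_nat n (\<lambda>_. 0))"
    define N where "N = n + poly P n"
    have i0: "exec (Loop 0 Skip) (initial_store w) = (r0, arrays_of w (\<lambda>_. False))"
      "time (Loop 0 Skip) (initial_store w) = 1 + 2 * n"
      by (auto simp: initial_store_def exec_Loop_Skip r0_def n_def fun_eq_iff simp del: exec.simps time.simps)
    have env: "(\<lambda>i. r (?v i)) = case_nat n (\<lambda>_. 0)" if "r 2 = n" "r 3 = 0" for r :: "nat \<Rightarrow> nat"
      using that by (auto simp: fun_eq_iff split: nat.split)
    have env': "(\<lambda>i. r (?u i)) = case_nat k (case_nat n (\<lambda>_. 0))" if "r 4 = k" "r 2 = n" "r 3 = 0" for r :: "nat \<Rightarrow> nat" and k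
      using that by (auto simp: fun_eq_iff split: nat.split)
    have m: "m \<le> poly P n"
      unfolding m_def e P_def by (rule value_of_le_bound) (auto split: nat.split)
    have rd: "ready ?v 7 5 r0" by (auto simp: ready_def r0_def split: nat.split)
    have i1: "exec (compile eT ?v 7 5) (r0, arrays_of w (\<lambda>_. False)) = (r0(5 := m), arrays_of w (\<lambda>_. False))"
      "time (compile eT ?v 7 5) (r0, arrays_of w (\<lambda>_. False)) \<le> poly (time_bound eT) n"
      using compile_correct[OF rd, of n eT "arrays_of w (\<lambda>_. False)"] env[of r0]
      by (auto simp: r0_def m_def e split: nat.split)
    define S where "S k = (r0(5 := m - k, 4 := k), arrays_of w (table \<phi> w k))" for k
    define B where "B = 10 + poly (time_bound e\<phi>) N + 8 * N + 2 * poly (bound e\<phi>) N"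
    have body: "exec ?c (dec 5 (S k)) = S (Suc k) \<and> time ?c (dec 5 (S k)) \<le> B" if k: "k < m" for k
    proof -
      define r where "r = r0(5 := m - Suc k, 4 := k)"
      define a where "a = arrays_of w (table \<phi> w k)"
      define y where "y = \<phi> a (case_nat k (case_nat n (\<lambda>_. 0)))"
      have d: "dec 5 (S k) = (r, a)" by (auto simp: S_def dec_def r_def a_def fun_eq_iff)
      have r: "r 0 = 0" "r 1 = 0" "r 2 = n" "r 3 = 0" "r 4 = k" "r 6 = 0" "\<And>i. i \<ge> 7 \<Longrightarrow> r i = 0"
        by (auto simp: r_def r0_def)
      have rd: "ready ?u 7 6 r" using r by (auto simp: ready_def split: nat.split)
      have kN: "k \<le> N" using k m by (simp add: N_def)
      have le: "r (?u i) \<le> N" for i using r kN by (auto simp: N_def split: nat.split)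
      have le': "case_nat k (case_nat n (\<lambda>_. 0)) i \<le> N" for i using kN by (auto simp: N_def split: nat.split)
      have c: "exec (compile e\<phi> ?u 7 6) (r, a) = (r(6 := y), a)"
        "time (compile e\<phi> ?u 7 6) (r, a) \<le> poly (time_bound e\<phi>) N"
        using compile_correct[OF rd le, of e\<phi> a] env'[of r k] r by (auto simp: y_def e)
      have y: "y \<le> poly (bound e\<phi>) N" unfolding y_def e by (rule value_of_le_bound) (rule le')
      have "table \<phi> w (Suc k) = (table \<phi> w k)(k := y \<noteq> 0)"
        by (simp add: y_def a_def n_def)
      moreover have "\<not> table \<phi> w k k" by (rule table_outside) simp
      ultimately have arr: "(if y = 0 then a else a(True := (a True)(k := True))) = arrays_of w (table \<phi> w (Suc k))"
        by (auto simp: a_def arrays_of_def fun_eq_iff)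
      have reg: "r(4 := 0, 7 := k, 1 := k, 7 := 0, 4 := k, 6 := 0, 1 := 0, 4 := Suc k) = r0(5 := m - Suc k, 4 := Suc k)"
        using r by (auto simp: r_def r0_def fun_eq_iff)
      have "exec ?c (r, a) = S (Suc k)"
        using c r unfolding S_def arr[symmetric] reg[symmetric]
        by (auto simp: exec_Loop_Inc2 exec_Loop_Inc exec_Loop_Skip exec_Loop_Write fun_eq_iff
            simp del: exec.simps(7) table.simps)
      moreover have "time ?c (r, a) \<le> B"
        using c r y kN
        by (simp add: exec_Loop_Inc2 exec_Loop_Inc exec_Loop_Skip exec_Loop_Write B_def
            del: exec.simps(7) time.simps(7) table.simps)
      ultimately show ?thesis unfolding d by blast
    qed
    have S0: "S 0 = (r0(5 := m), arrays_of w (\<lambda>_. False))" by (auto simp: S_def r0_def fun_eq_iff)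
    have L5: "exec (Loop 5 ?c) (r0(5 := m), arrays_of w (\<lambda>_. False)) = S m"
      "time (Loop 5 ?c) (r0(5 := m), arrays_of w (\<lambda>_. False)) \<le> 1 + m * (1 + B)"
      by (rule exec_Loop_chain[where n = m and S = S]; use body S0 in \<open>simp del: exec.simps time.simps\<close>)+
    define r1 where "r1 = r0(5 := 0, 4 := m)"
    define a1 where "a1 = arrays_of w (table \<phi> w m)"
    have Sm: "S m = (r1, a1)" by (simp add: S_def r1_def a1_def)
    have r1: "r1 2 = n" "r1 3 = 0" "r1 6 = 0" by (simp_all add: r1_def r0_def)
    have rd1: "ready ?v 7 6 r1" by (auto simp: ready_def r0_def r1_def split: nat.split)
    have le1: "r1 (?v i) \<le> n" for i by (auto simp: r1_def r0_def split: nat.split)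
    have i2: "exec (compile e\<psi> ?v 7 6) (r1, a1) = (r1(6 := \<psi> a1 (case_nat n (\<lambda>_. 0))), a1)"
      "time (compile e\<psi> ?v 7 6) (r1, a1) \<le> poly (time_bound e\<psi>) n"
      using compile_correct[OF rd1 le1, of e\<psi> a1] env[of r1] r1 by (simp_all add: e)
    have "exec (table_program eT e\<phi> e\<psi>) (initial_store w) = (r1(6 := \<psi> a1 (case_nat n (\<lambda>_. 0))), a1)"
      unfolding table_program_def exec.simps(6) i0 i1 L5 Sm i2 by (rule refl)
    then show "w \<in> L \<longleftrightarrow> fst (exec (table_program eT e\<phi> e\<psi>) (initial_store w)) 6 \<noteq> 0"
      by (simp add: L a1_def m_def n_def)
    have "time (table_program eT e\<phi> e\<psi>) (initial_store w) \<le>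
      3 + (1 + 2 * n) + poly (time_bound eT) n + (1 + m * (1 + B)) + poly (time_bound e\<psi>) n"
      unfolding table_program_def exec.simps(6) time.simps(6) i0 i1 L5 Sm i2
      using i1(2) L5(2) i2(2) by simp
    also have "\<dots> \<le> poly p n"
    proof -
      let ?Q = "poly P n"
      let ?t = "poly (time_bound e\<phi>) N" and ?b = "poly (bound e\<phi>) N"
      have "m * (1 + B) \<le> ?Q * (1 + B)" using m by (rule mult_le_mono1)
      also have "\<dots> \<le> ?Q * ((n + 1) * (11 + 8 * ?Q + ?t + 2 * ?b))"
        by (rule mult_le_mono2) (simp add: B_def N_def algebra_simps)
      also have "\<dots> = (n + 1) * (?Q * (11 + 8 * ?Q + ?t + 2 * ?b))" by (rule mult.left_commute)
      also have "\<dots> \<le> (n + 1) * (?Q * (100 + 100 * ?Q + ?t + 2 * ?b))"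
        by (intro mult_le_mono2) simp
      finally have 1: "m * (1 + B) \<le> (n + 1) * (?Q * (100 + 100 * ?Q + ?t + 2 * ?b))" .
      have 2: "n + (1 + poly (time_bound eT) n + poly (time_bound e\<psi>) n) \<le>
          (n + 1) * (1 + poly (time_bound eT) n + poly (time_bound e\<psi>) n)" by simp
      have "poly p n = 100 * ((n + 1) * (1 + poly (time_bound eT) n + poly (time_bound e\<psi>) n)) +
          100 * ((n + 1) * (?Q * (100 + 100 * ?Q + ?t + 2 * ?b)))"
        by (simp add: p_def poly_pcompose N_def algebra_simps)
      then show ?thesis using 1 2 by linarith
    qed
    finally show "time (table_program eT e\<phi> e\<psi>) (initial_store w) \<le> poly p (length w)"
      by (simp add: n_def)
  qed
qed

section \<open>Definable functions\<close>

primrec rename :: "exp \<Rightarrow> (nat \<Rightarrow> nat) \<Rightarrow> exp" where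
  "rename (Var i) s = Var (s i)"
| "rename (Const n) s = Const n"
| "rename (Add d e) s = Add (rename d s) (rename e s)"
| "rename (Mul d e) s = Mul (rename d s) (rename e s)"
| "rename (Sub d e) s = Sub (rename d s) (rename e s)"
| "rename (Sum d e) s = Sum (rename d s) (rename e (case_nat 0 (\<lambda>i. Suc (s i))))"
| "rename (Arr b e) s = Arr b (rename e s)"

lemma value_of_rename: "value_of (rename e s) a \<rho> = value_of e a (\<lambda>i. \<rho> (s i))"
proof (induction e arbitrary: s \<rho>)
  case (Sum d e)
  have "(\<lambda>i. case_nat t \<rho> (case_nat 0 (\<lambda>i. Suc (s i)) i)) = case_nat t (\<lambda>i. \<rho> (s i))" for t
    by (auto split: nat.split)
  then show ?case by (simp add: Sum)
qed auto

primrec substitute :: "exp \<Rightarrow> (nat \<Rightarrow> exp) \<Rightarrow> exp" where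
  "substitute (Var i) s = s i"
| "substitute (Const n) s = Const n"
| "substitute (Add d e) s = Add (substitute d s) (substitute e s)"
| "substitute (Mul d e) s = Mul (substitute d s) (substitute e s)"
| "substitute (Sub d e) s = Sub (substitute d s) (substitute e s)"
| "substitute (Sum d e) s =
     Sum (substitute d s) (substitute e (case_nat (Var 0) (\<lambda>i. rename (s i) Suc)))"
| "substitute (Arr b e) s = Arr b (substitute e s)"

lemma value_of_substitute: "value_of (substitute e s) a \<rho> = value_of e a (\<lambda>i. value_of (s i) a \<rho>)"
proof (induction e arbitrary: s \<rho>)
  case (Sum d e)
  have "(\<lambda>i. value_of (case_nat (Var 0) (\<lambda>i. rename (s i) Suc) i) a (case_nat t \<rho>)) =
      case_nat t (\<lambda>i. value_of (s i) a \<rho>)" for t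
    by (auto simp: value_of_rename split: nat.split)
  then show ?case by (simp add: Sum)
qed auto

text \<open>
  Closure under composition, used to reduce functions of several arguments to variables.
\<close>

lemma definable_substitute:
  assumes "definable g" "\<And>i. definable (s i)"
  shows "definable (\<lambda>a \<rho>. g a (\<lambda>i. s i a \<rho>))"
proof -
  obtain e where e: "\<And>a \<rho>. g a \<rho> = value_of e a \<rho>" using assms(1) by (auto simp: definable_def)
  obtain es where "\<And>i a \<rho>. s i a \<rho> = value_of (es i) a \<rho>"
    using assms(2) unfolding definable_def by metis
  then have "g a (\<lambda>i. s i a \<rho>) = value_of (substitute e es) a \<rho>" for a \<rho>
    by (simp add: e value_of_substitute)
  then show ?thesis by (auto simp: definable_def)
qed

text \<open>
  The rules for binders are stated so that a goal with a bounded quantifier or sum unifies with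
  their conclusion: the bound variable becomes variable 0 and the others are shifted.
\<close>

named_theorems definable_intros

lemma definable_var [definable_intros]: "definable (\<lambda>a \<rho>. \<rho> i)"
  unfolding definable_def by (intro exI[of _ "Var i"]) simp

lemma definable_const [definable_intros]: "definable (\<lambda>a \<rho>. n)"
  unfolding definable_def by (intro exI[of _ "Const n"]) simp

lemma definable_add [definable_intros]:
  "definable f \<Longrightarrow> definable g \<Longrightarrow> definable (\<lambda>a \<rho>. f a \<rho> + g a \<rho>)"
  unfolding definable_def by (metis value_of.simps(3))

lemma definable_mult [definable_intros]:
  "definable f \<Longrightarrow> definable g \<Longrightarrow> definable (\<lambda>a \<rho>. f a \<rho> * g a \<rho>)"
  unfolding definable_def by (metis value_of.simps(4))

lemma definable_diff [definable_intros]: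
  "definable f \<Longrightarrow> definable g \<Longrightarrow> definable (\<lambda>a \<rho>. f a \<rho> - g a \<rho>)"
  unfolding definable_def by (metis value_of.simps(5))

lemma definable_sum [definable_intros]:
  assumes "definable f" "definable (\<lambda>a \<rho>. g a (\<lambda>i. \<rho> (Suc i)) (\<rho> 0))"
  shows "definable (\<lambda>a \<rho>. \<Sum>t<f a \<rho>. g a \<rho> t)"
proof -
  obtain d e where d: "\<And>a \<rho>. f a \<rho> = value_of d a \<rho>"
    and e: "\<And>a \<rho>. g a (\<lambda>i. \<rho> (Suc i)) (\<rho> 0) = value_of e a \<rho>"
    using assms unfolding definable_def by blast
  have "g a \<rho> t = value_of e a (case_nat t \<rho>)" for a \<rho> t
    using e[of a "case_nat t \<rho>"] by simp
  then have "(\<Sum>t<f a \<rho>. g a \<rho> t) = value_of (Sum d e) a \<rho>" for a \<rho> by (simp add: d)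
  then show ?thesis unfolding definable_def by blast
qed

lemma definable_Suc [definable_intros]: "definable f \<Longrightarrow> definable (\<lambda>a \<rho>. Suc (f a \<rho>))"
  using definable_add[OF _ definable_const[of 1]] by simp

lemma definable_power [definable_intros]: "definable f \<Longrightarrow> definable (\<lambda>a \<rho>. f a \<rho> ^ k)"
  by (induction k) (auto intro: definable_intros)

abbreviation decidable :: "(arrays \<Rightarrow> (nat \<Rightarrow> nat) \<Rightarrow> bool) \<Rightarrow> bool" where
  "decidable P \<equiv> definable (\<lambda>a \<rho>. of_bool (P a \<rho>))"

lemma decidable_array [definable_intros]: "definable f \<Longrightarrow> decidable (\<lambda>a \<rho>. a b (f a \<rho>))"
  unfolding definable_def by (metis value_of.simps(7))

lemma decidable_not [definable_intros]: "decidable P \<Longrightarrow> decidable (\<lambda>a \<rho>. \<not> P a \<rho>)"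
proof -
  assume P: "decidable P"
  have "of_bool (\<not> b) = 1 - (of_bool b :: nat)" for b by simp
  then show ?thesis by (simp only:) (intro definable_diff definable_const P)
qed

lemma decidable_conj [definable_intros]:
  "decidable P \<Longrightarrow> decidable Q \<Longrightarrow> decidable (\<lambda>a \<rho>. P a \<rho> \<and> Q a \<rho>)"
  by (simp only: of_bool_conj) (rule definable_mult)

lemma decidable_disj [definable_intros]:
  "decidable P \<Longrightarrow> decidable Q \<Longrightarrow> decidable (\<lambda>a \<rho>. P a \<rho> \<or> Q a \<rho>)"
  using decidable_not[OF decidable_conj[OF decidable_not decidable_not]] by simp

lemma decidable_le [definable_intros]:
  assumes "definable f" "definable g"
  shows "decidable (\<lambda>a \<rho>. f a \<rho> \<le> g a \<rho>)"
proof -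
  have "of_bool (x \<le> y) = 1 - (x - y)" for x y :: nat by auto
  then show ?thesis by (simp only:) (intro definable_intros assms)
qed

lemma decidable_less [definable_intros]:
  "definable f \<Longrightarrow> definable g \<Longrightarrow> decidable (\<lambda>a \<rho>. f a \<rho> < g a \<rho>)"
  using decidable_not[OF decidable_le] by (simp add: not_le)

lemma decidable_eq [definable_intros]:
  "definable f \<Longrightarrow> definable g \<Longrightarrow> decidable (\<lambda>a \<rho>. f a \<rho> = g a \<rho>)"
  by (simp only: eq_iff) (intro definable_intros)

lemma decidable_ex [definable_intros]:
  assumes "definable f" "decidable (\<lambda>a \<rho>. P a (\<lambda>i. \<rho> (Suc i)) (\<rho> 0))"
  shows "decidable (\<lambda>a \<rho>. \<exists>t<f a \<rho>. P a \<rho> t)"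
proof -
  have "(\<exists>t<n. R t) = (0 < (\<Sum>t<n. of_bool (R t) :: nat))" for n and R :: "nat \<Rightarrow> bool"
    by (auto simp: sum_eq_0_iff zero_less_iff_neq_zero simp del: sum_of_bool_eq)
  then show ?thesis by (simp only:) (intro definable_intros assms)
qed

lemma decidable_all [definable_intros]:
  assumes "definable f" "decidable (\<lambda>a \<rho>. P a (\<lambda>i. \<rho> (Suc i)) (\<rho> 0))"
  shows "decidable (\<lambda>a \<rho>. \<forall>t<f a \<rho>. P a \<rho> t)"
  using decidable_not[OF decidable_ex[OF assms(1) decidable_not[OF assms(2)]]] by simp

lemma decidable_bex_finite:
  assumes "finite S" "\<And>x. x \<in> S \<Longrightarrow> decidable (P x)"
  shows "decidable (\<lambda>a \<rho>. \<exists>x\<in>S. P x a \<rho>)"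
  using assms
proof (induction S rule: finite_induct)
  case (insert x S)
  have "decidable (\<lambda>a \<rho>. P x a \<rho> \<or> (\<exists>y\<in>S. P y a \<rho>))"
    by (intro definable_intros insert.IH insert.prems) auto
  then show ?case by simp
qed (simp add: definable_const)

lemma definable_if [definable_intros]:
  assumes "decidable P" "definable f" "definable g"
  shows "definable (\<lambda>a \<rho>. if P a \<rho> then f a \<rho> else g a \<rho>)"
proof -
  have "(if b then x else y) = of_bool b * x + of_bool (\<not> b) * y" for b and x y :: nat by simp
  then show ?thesis by (simp only:) (intro definable_intros assms)
qed

lemma definable_shift: "definable f \<Longrightarrow> definable (\<lambda>a \<rho>. f a (\<lambda>i. \<rho> (s i)))"
  using definable_substitute[of f "\<lambda>i a \<rho>. \<rho> (s i)"] definable_var by blast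

lemma definable_comp1:
  "definable (\<lambda>a \<rho>. F a (\<rho> 0)) \<Longrightarrow> definable f \<Longrightarrow> definable (\<lambda>a \<rho>. F a (f a \<rho>))"
  using definable_substitute[of "\<lambda>a \<rho>. F a (\<rho> 0)" "\<lambda>i. f"] by simp

lemma definable_comp2:
  assumes "definable (\<lambda>a \<rho>. F a (\<rho> 0) (\<rho> 1))" "definable f" "definable g"
  shows "definable (\<lambda>a \<rho>. F a (f a \<rho>) (g a \<rho>))"
  using definable_substitute[OF assms(1), of "\<lambda>i. if i = 0 then f else g"] assms by simp

lemma definable_div [definable_intros]:
  assumes "definable f" "definable g"
  shows "definable (\<lambda>a \<rho>. f a \<rho> div g a \<rho>)"
proof -
  have "x div y = (\<Sum>q<x. of_bool (0 < y \<and> Suc q * y \<le> x))" for x y :: nat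
  proof (cases "y = 0")
    case False
    have "(0 < y \<and> Suc q * y \<le> x) = (q < x div y)" for q
      using False less_eq_div_iff_mult_less_eq[of y "Suc q" x] by (simp only: Suc_le_eq) simp
    then have "(\<Sum>q<x. of_bool (0 < y \<and> Suc q * y \<le> x)) = (\<Sum>q<x. of_bool (q < x div y) :: nat)"
      by simp
    also have "\<dots> = card ({..<x} \<inter> {q. q < x div y})"
      by (simp add: sum_of_bool_eq)
    also have "{..<x} \<inter> {q. q < x div y} = {..<x div y}"
      by (auto intro: less_le_trans div_le_dividend)
    finally show ?thesis by simp
  qed simp
  then have "definable (\<lambda>a \<rho>. \<rho> 0 div \<rho> 1)"
    by (simp only:) (intro definable_intros)
  then show ?thesis using assms by (rule definable_comp2)
qed

lemma definable_mod [definable_intros]: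
  assumes "definable f" "definable g"
  shows "definable (\<lambda>a \<rho>. f a \<rho> mod g a \<rho>)"
  unfolding minus_mult_div_eq_mod[symmetric]
  by (rule definable_diff[OF assms(1) definable_mult[OF assms(2) definable_div[OF assms]]])

lemma definable_bounded:
  assumes "definable f"
  obtains p :: "nat poly" where "\<And>a \<rho> N. (\<And>i. \<rho> i \<le> N) \<Longrightarrow> f a \<rho> \<le> poly p N"
  using assms value_of_le_bound unfolding definable_def by metis

section \<open>Families of group elements with definable exponents\<close>

text \<open>
  Ordered products with natural exponents. In general this is only a set; for triangular lists it is
  closed under products, and if inverses are present it is a subgroup.
\<close>

primrec span :: "('a, 'b) monoid_scheme \<Rightarrow> 'a list \<Rightarrow> 'a set" where
  "span G [] = {\<one>\<^bsub>G\<^esub>}"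
| "span G (c # cs) = {c [^]\<^bsub>G\<^esub> n \<otimes>\<^bsub>G\<^esub> h | (n :: nat) h. h \<in> span G cs}"

primrec definable_in ::
  "('a, 'b) monoid_scheme \<Rightarrow> 'a list \<Rightarrow> (arrays \<Rightarrow> (nat \<Rightarrow> nat) \<Rightarrow> 'a) \<Rightarrow> bool" where
  "definable_in G [] g = (\<forall>a \<rho>. g a \<rho> = \<one>\<^bsub>G\<^esub>)"
| "definable_in G (c # cs) g = (\<exists>z h. definable z \<and> definable_in G cs h \<and>
     (\<forall>a \<rho>. g a \<rho> = c [^]\<^bsub>G\<^esub> z a \<rho> \<otimes>\<^bsub>G\<^esub> h a \<rho>))"

text \<open>
  Conjugation by \<open>c\<close> changes every entry of the list by an ordered product of the entries after it.
\<close>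

primrec normalizes :: "('a, 'b) monoid_scheme \<Rightarrow> 'a \<Rightarrow> 'a list \<Rightarrow> bool" where
  "normalizes G c [] = True"
| "normalizes G c (d # cs) = ((\<exists>r \<in> span G cs. inv\<^bsub>G\<^esub> c \<otimes>\<^bsub>G\<^esub> d \<otimes>\<^bsub>G\<^esub> c = d \<otimes>\<^bsub>G\<^esub> r) \<and> normalizes G c cs)"

primrec triangular :: "('a, 'b) monoid_scheme \<Rightarrow> 'a list \<Rightarrow> bool" where
  "triangular G [] = True"
| "triangular G (c # cs) = (c \<in> carrier G \<and> normalizes G c cs \<and> triangular G cs)"

primrec gprod :: "('a, 'b) monoid_scheme \<Rightarrow> (nat \<Rightarrow> 'a) \<Rightarrow> nat \<Rightarrow> 'a" where
  "gprod G f 0 = \<one>\<^bsub>G\<^esub>"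
| "gprod G f (Suc n) = gprod G f n \<otimes>\<^bsub>G\<^esub> f n"

definition product_closed :: "('a, 'b) monoid_scheme \<Rightarrow> 'a list \<Rightarrow> bool" where
  "product_closed G cs \<longleftrightarrow> (\<forall>g b. definable_in G cs g \<longrightarrow> definable b \<longrightarrow>
     definable_in G cs (\<lambda>a \<rho>. gprod G (\<lambda>t. g a (case_nat t \<rho>)) (b a \<rho>)))"

primrec suffixes_product_closed :: "('a, 'b) monoid_scheme \<Rightarrow> 'a list \<Rightarrow> bool" where
  "suffixes_product_closed G [] = product_closed G []"
| "suffixes_product_closed G (c # cs) = (product_closed G (c # cs) \<and> suffixes_product_closed G cs)"

context group
begin

lemma triangular_carrier: "triangular G cs \<Longrightarrow> set cs \<subseteq> carrier G"
  by (induction cs) auto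

lemma span_carrier: "set cs \<subseteq> carrier G \<Longrightarrow> span G cs \<subseteq> carrier G"
  by (induction cs) auto

lemma definable_in_const: "r \<in> span G cs \<Longrightarrow> definable_in G cs (\<lambda>a \<rho>. r)"
proof (induction cs arbitrary: r)
  case (Cons c cs)
  then obtain n :: nat and h where r: "r = c [^] n \<otimes> h" "h \<in> span G cs" by auto
  show ?case
    using r Cons.IH[OF r(2)] definable_const[of n]
    by (auto intro!: exI[of _ "\<lambda>a \<rho>. n"] exI[of _ "\<lambda>a \<rho>. h"])
qed auto

lemma definable_in_span: "definable_in G cs g \<Longrightarrow> g a \<rho> \<in> span G cs"
  by (induction cs arbitrary: g) fastforce+

lemma one_in_span: "set cs \<subseteq> carrier G \<Longrightarrow> \<one> \<in> span G cs"
proof (induction cs)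
  case (Cons c cs)
  then show ?case by (auto intro!: exI[of _ "0 :: nat"] exI[of _ "\<one>"])
qed auto

lemma definable_in_substitute:
  assumes "definable_in G cs g" "\<And>i. definable (s i)"
  shows "definable_in G cs (\<lambda>a \<rho>. g a (\<lambda>i. s i a \<rho>))"
  using assms(1)
proof (induction cs arbitrary: g)
  case (Cons c cs)
  then obtain z h where z: "definable z" "definable_in G cs h" "\<And>a \<rho>. g a \<rho> = c [^] z a \<rho> \<otimes> h a \<rho>"
    by auto
  show ?case
    using z(3) Cons.IH[OF z(2)] definable_substitute[OF z(1) assms(2)]
    by (auto intro!: exI[of _ "\<lambda>a \<rho>. z a (\<lambda>i. s i a \<rho>)"] exI[of _ "\<lambda>a \<rho>. h a (\<lambda>i. s i a \<rho>)"])
qed auto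

lemma definable_in_shift: "definable_in G cs g \<Longrightarrow> definable_in G cs (\<lambda>a \<rho>. g a (\<lambda>i. \<rho> (s i)))"
  using definable_in_substitute[of cs g "\<lambda>i a \<rho>. \<rho> (s i)"] definable_var by blast

lemma definable_in_if:
  assumes "decidable P" "definable_in G cs g" "definable_in G cs h"
  shows "definable_in G cs (\<lambda>a \<rho>. if P a \<rho> then g a \<rho> else h a \<rho>)"
  using assms(2,3)
proof (induction cs arbitrary: g h)
  case (Cons c cs)
  obtain z g' where z: "definable z" "definable_in G cs g'" "\<And>a \<rho>. g a \<rho> = c [^] z a \<rho> \<otimes> g' a \<rho>"
    using Cons.prems(1) by auto
  obtain y h' where y: "definable y" "definable_in G cs h'" "\<And>a \<rho>. h a \<rho> = c [^] y a \<rho> \<otimes> h' a \<rho>"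
    using Cons.prems(2) by auto
  show ?case
    using z(3) y(3) Cons.IH[OF z(2) y(2)] definable_if[OF assms(1) z(1) y(1)]
    by (auto intro!: exI[of _ "\<lambda>a \<rho>. if P a \<rho> then z a \<rho> else y a \<rho>"]
        exI[of _ "\<lambda>a \<rho>. if P a \<rho> then g' a \<rho> else h' a \<rho>"])
qed auto

lemma definable_in_Cons:
  assumes "c \<in> carrier G" "set cs \<subseteq> carrier G" "definable_in G cs g"
  shows "definable_in G (c # cs) g"
proof -
  have "g a \<rho> \<in> carrier G" for a \<rho>
    using definable_in_span[OF assms(3)] span_carrier[OF assms(2)] by auto
  then show ?thesis
    using assms(3) definable_const[of 0] by (auto intro!: exI[of _ "\<lambda>a \<rho>. 0"] exI[of _ g])
qed

lemma gprod_closed: "(\<And>t. f t \<in> carrier G) \<Longrightarrow> gprod G f n \<in> carrier G"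
  by (induction n) auto

lemma gprod_const: "x \<in> carrier G \<Longrightarrow> gprod G (\<lambda>t. x) n = x [^] n"
  by (induction n) auto

lemma definable_in_ConsI:
  "definable z \<Longrightarrow> definable_in G cs h \<Longrightarrow> definable_in G (c # cs) (\<lambda>a \<rho>. c [^] z a \<rho> \<otimes> h a \<rho>)"
  by auto

lemma definable_in_gprod:
  "product_closed G cs \<Longrightarrow> definable_in G cs g \<Longrightarrow> definable b \<Longrightarrow>
    definable_in G cs (\<lambda>a \<rho>. gprod G (\<lambda>t. g a (case_nat t \<rho>)) (b a \<rho>))"
  by (auto simp: product_closed_def)

text \<open>
  A product of two factors is an iterated product over \<open>t < 2\<close> of a family defined by cases.
\<close>

lemma definable_in_mult:
  assumes "product_closed G cs" "set cs \<subseteq> carrier G" "definable_in G cs g" "definable_in G cs h"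
  shows "definable_in G cs (\<lambda>a \<rho>. g a \<rho> \<otimes> h a \<rho>)"
proof -
  have "definable_in G cs (\<lambda>a \<rho>. if \<rho> 0 = 0 then g a (\<lambda>i. \<rho> (Suc i)) else h a (\<lambda>i. \<rho> (Suc i)))"
    by (rule definable_in_if[OF _ definable_in_shift[OF assms(3), of Suc] definable_in_shift[OF assms(4), of Suc]])
      (intro definable_intros)
  note definable_in_gprod[OF assms(1) this definable_const[of "Suc (Suc 0)"]]
  moreover have "g a \<rho> \<in> carrier G" "h a \<rho> \<in> carrier G" for a \<rho>
    using span_carrier[OF assms(2)] definable_in_span[OF assms(3)] definable_in_span[OF assms(4)] by auto
  ultimately show ?thesis by simp
qed

lemma definable_in_pow:
  assumes "product_closed G cs" "set cs \<subseteq> carrier G" "definable_in G cs g" "definable y"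
  shows "definable_in G cs (\<lambda>a \<rho>. g a \<rho> [^] y a \<rho>)"
proof -
  have "g a \<rho> \<in> carrier G" for a \<rho>
    using span_carrier[OF assms(2)] definable_in_span[OF assms(3)] by auto
  then show ?thesis
    using definable_in_gprod[OF assms(1) definable_in_shift[OF assms(3), of Suc] assms(4)]
    by (simp add: gprod_const)
qed

abbreviation conj_pow :: "'a \<Rightarrow> nat \<Rightarrow> 'a \<Rightarrow> 'a" where
  "conj_pow c m x \<equiv> inv (c [^] m) \<otimes> x \<otimes> c [^] m"

lemma conj_mult:
  "\<lbrakk>u \<in> carrier G; x \<in> carrier G; y \<in> carrier G\<rbrakk> \<Longrightarrow>
   inv u \<otimes> (x \<otimes> y) \<otimes> u = (inv u \<otimes> x \<otimes> u) \<otimes> (inv u \<otimes> y \<otimes> u)"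
proof -
  assume u: "u \<in> carrier G" "x \<in> carrier G" "y \<in> carrier G"
  then have "(inv u \<otimes> x \<otimes> u) \<otimes> (inv u \<otimes> y \<otimes> u) = inv u \<otimes> x \<otimes> (u \<otimes> inv u) \<otimes> y \<otimes> u"
    by (simp only: m_assoc m_closed inv_closed)
  then show ?thesis using u by (simp add: m_assoc)
qed

lemma conj_pow_power:
  "\<lbrakk>u \<in> carrier G; x \<in> carrier G\<rbrakk> \<Longrightarrow> inv u \<otimes> x [^] (n :: nat) \<otimes> u = (inv u \<otimes> x \<otimes> u) [^] n"
  by (induction n) (auto simp: conj_mult)

lemma conj_gprod:
  "\<lbrakk>u \<in> carrier G; \<And>t. f t \<in> carrier G\<rbrakk> \<Longrightarrow>
   inv u \<otimes> gprod G f n \<otimes> u = gprod G (\<lambda>t. inv u \<otimes> f t \<otimes> u) n"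
  by (induction n) (auto simp: conj_mult gprod_closed)

lemma conj_conj:
  "\<lbrakk>c \<in> carrier G; x \<in> carrier G\<rbrakk> \<Longrightarrow> conj_pow c m (conj_pow c n x) = conj_pow c (n + m) x"
  by (simp only: nat_pow_mult[symmetric] inv_mult_group m_assoc m_closed inv_closed nat_pow_closed)

text \<open>
  Let \<open>d\<close> be the first entry, and \<open>r\<close> the correction with \<open>c\<^sup>-\<^sup>1 d c = d r\<close>. Iterating,
  \<open>c\<close> to the power \<open>m\<close> conjugates \<open>d\<close> to \<open>d\<close> times the product over \<open>t < m\<close> of the conjugates of \<open>r\<close> by the
  powers \<open>t\<close> of \<open>c\<close>. These lie in the span of the shorter list, where the claim is known by induction
  and iterated products are available.
\<close>

lemma definable_in_conj:
  assumes "c \<in> carrier G" "suffixes_product_closed G cs" "triangular G cs" "normalizes G c cs"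
    "definable_in G cs g" "definable m"
  shows "definable_in G cs (\<lambda>a \<rho>. conj_pow c (m a \<rho>) (g a \<rho>))"
  using assms(2-)
proof (induction cs arbitrary: g m)
  case Nil
  then show ?case using assms(1) by simp
next
  case (Cons d cs)
  have cs: "set cs \<subseteq> carrier G" "d \<in> carrier G" "set (d # cs) \<subseteq> carrier G"
    using triangular_carrier[OF Cons.prems(2)] by auto
  have closed: "product_closed G (d # cs)" "suffixes_product_closed G cs" "product_closed G cs"
    using Cons.prems(1) by (auto, cases cs) auto
  obtain y h where y: "definable y" "definable_in G cs h" "\<And>a \<rho>. g a \<rho> = d [^] y a \<rho> \<otimes> h a \<rho>"
    using Cons.prems(4) by auto
  obtain r where r: "r \<in> span G cs" "inv c \<otimes> d \<otimes> c = d \<otimes> r" using Cons.prems(3) by auto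
  have rc: "r \<in> carrier G" using r span_carrier[OF cs(1)] by auto
  have hc: "h a \<rho> \<in> carrier G" for a \<rho> using definable_in_span[OF y(2)] span_carrier[OF cs(1)] by auto
  have IH: "definable_in G cs (\<lambda>a \<rho>. conj_pow c (m a \<rho>) (g a \<rho>))" if "definable_in G cs g" "definable m" for g m
    using Cons.IH[OF closed(2) _ _ that] Cons.prems by simp
  have d: "conj_pow c k d = d \<otimes> gprod G (\<lambda>t. conj_pow c t r) k" for k
  proof (induction k)
    case 0
    then show ?case using cs by simp
  next
    case (Suc k)
    have "conj_pow c (Suc k) d = conj_pow c k (conj_pow c 1 d)"
      using conj_conj[of c d k 1] assms(1) cs(2) by simp
    also have "conj_pow c 1 d = d \<otimes> r" using r(2) assms(1) by simp
    also have "conj_pow c k (d \<otimes> r) = conj_pow c k d \<otimes> conj_pow c k r"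
      by (rule conj_mult) (use assms(1) cs rc in auto)
    finally show ?case using Suc assms(1) cs rc by (simp add: m_assoc gprod_closed)
  qed
  have "definable_in G cs (\<lambda>a \<rho>. gprod G (\<lambda>t. conj_pow c t r) (m a \<rho>))"
    using definable_in_gprod[OF closed(3) IH[OF definable_in_const[OF r(1)] definable_var[of 0]] Cons.prems(5)]
    by simp
  then have "definable_in G (d # cs) (\<lambda>a \<rho>. conj_pow c (m a \<rho>) d)"
    unfolding d definable_in.simps using definable_const[of 1] cs(2)
    by (intro exI[of _ "\<lambda>a \<rho>. 1"] exI[of _ "\<lambda>a \<rho>. gprod G (\<lambda>t. conj_pow c t r) (m a \<rho>)"]) simp
  then have "definable_in G (d # cs) (\<lambda>a \<rho>. conj_pow c (m a \<rho>) d [^] y a \<rho> \<otimes> conj_pow c (m a \<rho>) (h a \<rho>))"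
    by (rule definable_in_mult[OF closed(1) cs(3) definable_in_pow[OF closed(1) cs(3) _ y(1)]
          definable_in_Cons[OF cs(2,1) IH[OF y(2) Cons.prems(5)]]])
  moreover have "conj_pow c (m a \<rho>) d [^] y a \<rho> \<otimes> conj_pow c (m a \<rho>) (h a \<rho>) = conj_pow c (m a \<rho>) (g a \<rho>)" for a \<rho>
    using assms(1) cs hc by (simp add: y(3) conj_mult conj_pow_power)
  ultimately show ?case by simp
qed

text \<open>
  The power of \<open>c\<close> in factor \<open>s\<close> moves to the left past all \<open>h t\<close> with \<open>t < s\<close>. So \<open>h t\<close> is
  conjugated by \<open>c\<close> to the sum of the exponents after position \<open>t\<close>.
\<close>

lemma gprod_collect:
  assumes c: "c \<in> carrier G" and h: "\<And>t. h t \<in> carrier G"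
  shows "gprod G (\<lambda>t. c [^] (z t :: nat) \<otimes> h t) n =
    c [^] (\<Sum>s<n. z s) \<otimes> gprod G (\<lambda>t. conj_pow c ((\<Sum>s<n. z s) - (\<Sum>s<Suc t. z s)) (h t)) n"
proof (induction n)
  case (Suc n)
  define W where "W k = (\<Sum>s<k. z s)" for k
  define P where "P = gprod G (\<lambda>t. conj_pow c (W n - W (Suc t)) (h t)) n"
  have P: "P \<in> carrier G" unfolding P_def using c h by (intro gprod_closed) auto
  have mono: "W (Suc t) \<le> W n" if "t < n" for t
    unfolding W_def using that by (intro sum_mono2) auto
  have cong: "gprod G f n = gprod G f' n" if "\<And>t. t < n \<Longrightarrow> f t = f' t" for f f' n
    using that by (induction n) auto
  have "conj_pow c (z n) P = gprod G (\<lambda>t. conj_pow c (W n - W (Suc t) + z n) (h t)) n"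
    unfolding P_def using c h by (simp add: conj_gprod conj_conj)
  also have "\<dots> = gprod G (\<lambda>t. conj_pow c (W (Suc n) - W (Suc t)) (h t)) n"
    by (rule cong) (use mono in \<open>simp add: W_def\<close>)
  finally have 1: "conj_pow c (z n) P = gprod G (\<lambda>t. conj_pow c (W (Suc n) - W (Suc t)) (h t)) n" .
  have "gprod G (\<lambda>t. c [^] z t \<otimes> h t) (Suc n) = c [^] W n \<otimes> P \<otimes> (c [^] z n \<otimes> h n)"
    using Suc by (simp add: W_def P_def)
  also have "\<dots> = c [^] W n \<otimes> (c [^] z n \<otimes> inv (c [^] z n)) \<otimes> P \<otimes> (c [^] z n \<otimes> h n)"
    using c h P by simp
  also have "\<dots> = (c [^] W n \<otimes> c [^] z n) \<otimes> (conj_pow c (z n) P \<otimes> h n)"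
    using c h P by (simp only: m_assoc m_closed inv_closed nat_pow_closed)
  also have "c [^] W n \<otimes> c [^] z n = c [^] W (Suc n)"
    using c by (simp add: W_def nat_pow_mult)
  also have "conj_pow c (z n) P \<otimes> h n = gprod G (\<lambda>t. conj_pow c (W (Suc n) - W (Suc t)) (h t)) (Suc n)"
    using c h by (simp add: 1)
  finally show ?case by (simp only: W_def)
qed simp

text \<open>
  Collecting the first entry makes its exponent a bounded sum, and leaves an iterated product of
  conjugates over the shorter list, to which conjugation and induction apply.
\<close>

lemma triangular_product_closed:
  "triangular G cs \<Longrightarrow> suffixes_product_closed G cs"
proof (induction cs)
  case Nil
  have "gprod G (\<lambda>t. \<one>) n = \<one>" for n by (induction n) auto
  then show ?case by (simp add: product_closed_def)
next
  case (Cons c cs)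
  then have tri: "c \<in> carrier G" "normalizes G c cs" "triangular G cs" by auto
  have IH: "suffixes_product_closed G cs" using Cons by auto
  then have closed: "product_closed G cs" by (cases cs) auto
  have "definable_in G (c # cs) (\<lambda>a \<rho>. gprod G (\<lambda>t. g a (case_nat t \<rho>)) (b a \<rho>))"
    if g: "definable_in G (c # cs) g" and b: "definable b" for g b
  proof -
    obtain z h where z: "definable z" "definable_in G cs h" "\<And>a \<rho>. g a \<rho> = c [^] z a \<rho> \<otimes> h a \<rho>"
      using g by auto
    have hc: "h a \<rho> \<in> carrier G" for a \<rho>
      using definable_in_span[OF z(2)] span_carrier[OF triangular_carrier[OF tri(3)]] by auto
    define W where "W a \<rho> n = (\<Sum>s<n. z a (case_nat s \<rho>))" for a \<rho> and n :: nat
    have W: "definable (\<lambda>a \<rho>. W a \<rho> (f a \<rho>))" if "definable f" for f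
    proof -
      have "case_nat (\<rho> 0) (\<lambda>i. \<rho> (Suc i)) = \<rho>" for \<rho> :: "nat \<Rightarrow> nat"
        by (auto split: nat.split)
      then show ?thesis unfolding W_def using z(1) by (intro definable_sum that) simp
    qed
    have W': "definable (\<lambda>a \<rho>. W a (\<lambda>i. \<rho> (Suc i)) (f a \<rho>))" if "definable f" for f
    proof -
      have "(\<lambda>i. \<rho> (case_nat 0 (\<lambda>i. Suc (Suc i)) i)) = case_nat (\<rho> 0) (\<lambda>i. \<rho> (Suc (Suc i)))"
        for \<rho> :: "nat \<Rightarrow> nat" by (auto split: nat.split)
      then have "definable (\<lambda>a \<rho>. z a (case_nat (\<rho> 0) (\<lambda>i. \<rho> (Suc (Suc i)))))"
        using definable_shift[OF z(1), of "case_nat 0 (\<lambda>i. Suc (Suc i))"] by simp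
      then show ?thesis unfolding W_def by (intro definable_sum that)
    qed
    define m where "m a \<rho> = W a (\<lambda>i. \<rho> (Suc i)) (b a (\<lambda>i. \<rho> (Suc i))) - W a (\<lambda>i. \<rho> (Suc i)) (Suc (\<rho> 0))" for a \<rho>
    have m: "definable m"
      unfolding m_def by (intro definable_diff W' definable_shift[OF b] definable_Suc definable_var)
    have "definable_in G cs (\<lambda>a \<rho>. conj_pow c (m a \<rho>) (h a \<rho>))"
      by (rule definable_in_conj) (use tri IH z(2) m in auto)
    from definable_in_gprod[OF closed this b]
    have d: "definable_in G cs (\<lambda>a \<rho>. gprod G (\<lambda>t. conj_pow c (m a (case_nat t \<rho>)) (h a (case_nat t \<rho>))) (b a \<rho>))" .
    show ?thesis
      unfolding definable_in.simps
    proof (intro exI conjI allI)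
      show "definable (\<lambda>a \<rho>. W a \<rho> (b a \<rho>))" by (rule W[OF b])
      show "definable_in G cs (\<lambda>a \<rho>. gprod G (\<lambda>t. conj_pow c (m a (case_nat t \<rho>)) (h a (case_nat t \<rho>))) (b a \<rho>))"
        by (rule d)
      show "gprod G (\<lambda>t. g a (case_nat t \<rho>)) (b a \<rho>) = c [^] W a \<rho> (b a \<rho>) \<otimes>
          gprod G (\<lambda>t. conj_pow c (m a (case_nat t \<rho>)) (h a (case_nat t \<rho>))) (b a \<rho>)" for a \<rho>
        using gprod_collect[OF tri(1), of "\<lambda>t. h a (case_nat t \<rho>)" "\<lambda>t. z a (case_nat t \<rho>)" "b a \<rho>"] hc
        by (simp add: z(3) m_def W_def)
    qed
  qed
  then show ?case using IH by (simp add: product_closed_def)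
qed

lemma product_closed_if_triangular: "triangular G cs \<Longrightarrow> product_closed G cs"
  using triangular_product_closed[of cs] by (cases cs) auto

end

text \<open>
  Natural exponents on an element and on its inverse play the role of one integer exponent.
\<close>

definition with_inverses :: "('a, 'b) monoid_scheme \<Rightarrow> 'a list \<Rightarrow> 'a list" where
  "with_inverses G cs = concat (map (\<lambda>c. [c, inv\<^bsub>G\<^esub> c]) cs)"

lemma with_inverses_simps [simp]:
  "with_inverses G [] = []"
  "with_inverses G (c # cs) = c # inv\<^bsub>G\<^esub> c # with_inverses G cs"
  "with_inverses G (cs @ ds) = with_inverses G cs @ with_inverses G ds"
  by (simp_all add: with_inverses_def)

context group
begin

lemma definable_in_inverse:
  "triangular G (with_inverses G cs) \<Longrightarrow> definable_in G (with_inverses G cs) g \<Longrightarrow>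
    definable_in G (with_inverses G cs) (\<lambda>a \<rho>. inv (g a \<rho>))"
proof (induction cs arbitrary: g)
  case (Cons c cs)
  let ?cs = "with_inverses G cs"
  have tri: "triangular G ?cs" "triangular G (c # inv c # ?cs)" using Cons.prems by auto
  have c: "c \<in> carrier G" and cs: "set ?cs \<subseteq> carrier G" and ccs: "set (c # inv c # ?cs) \<subseteq> carrier G"
    using triangular_carrier[OF tri(2)] by auto
  obtain p q h where p: "definable p" "definable q" "definable_in G ?cs h"
    "\<And>a \<rho>. g a \<rho> = c [^] p a \<rho> \<otimes> (inv c [^] q a \<rho> \<otimes> h a \<rho>)"
    using Cons.prems(2) by (auto; metis)
  have h: "h a \<rho> \<in> carrier G" for a \<rho> using definable_in_span[OF p(3)] span_carrier[OF cs] by auto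
  have 1: "definable_in G (c # inv c # ?cs) (\<lambda>a \<rho>. inv (h a \<rho>))"
    using Cons.IH[OF tri(1) p(3)] c cs by (intro definable_in_Cons) auto
  have 2: "definable_in G (c # inv c # ?cs) (\<lambda>a \<rho>. c [^] q a \<rho> \<otimes> (inv c [^] p a \<rho> \<otimes> \<one>))"
    by (intro definable_in_ConsI p definable_in_const one_in_span cs)
  have "inv (c [^] m) = inv c [^] m" "inv (inv c [^] m) = c [^] m" for m :: nat
    using c by (simp_all add: nat_pow_inv)
  then have "inv (g a \<rho>) = inv (h a \<rho>) \<otimes> (c [^] q a \<rho> \<otimes> (inv c [^] p a \<rho> \<otimes> \<one>))" for a \<rho>
    using c h by (simp add: p(4) inv_mult_group m_assoc)
  then show ?case
    using definable_in_mult[OF product_closed_if_triangular[OF tri(2)] ccs 1 2] by simp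
qed auto

lemma span_subgroup:
  assumes "triangular G (with_inverses G cs)"
  shows "subgroup (span G (with_inverses G cs)) G"
proof (rule subgroupI)
  let ?cs = "with_inverses G cs"
  have cs: "set ?cs \<subseteq> carrier G" by (rule triangular_carrier[OF assms])
  show "span G ?cs \<subseteq> carrier G" by (rule span_carrier[OF cs])
  show "span G ?cs \<noteq> {}" using one_in_span[OF cs] by auto
  show "inv x \<in> span G ?cs" if "x \<in> span G ?cs" for x
    using definable_in_span[OF definable_in_inverse[OF assms definable_in_const[OF that]]] by simp
  show "x \<otimes> y \<in> span G ?cs" if "x \<in> span G ?cs" "y \<in> span G ?cs" for x y
    using definable_in_span[OF definable_in_mult[OF product_closed_if_triangular[OF assms] cs
          definable_in_const[OF that(1)] definable_in_const[OF that(2)]]] by simp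
qed

lemma powers_in_subgroup:
  assumes K: "subgroup K G" and c: "c \<in> carrier G"
  shows "\<exists>d :: nat. \<forall>n :: nat. c [^] n \<in> K \<longleftrightarrow> d dvd n"
proof (cases "\<exists>d>0. c [^] (d :: nat) \<in> K")
  case False
  then have "c [^] n \<in> K \<longleftrightarrow> 0 dvd n" for n :: nat
    using False subgroup.one_closed[OF K] by (cases "n = 0") (simp, metis dvd_0_left neq0_conv)
  then show ?thesis by blast
next
  case True
  define d where "d = (LEAST d. d > 0 \<and> c [^] (d :: nat) \<in> K)"
  have d: "d > 0" "c [^] d \<in> K" using LeastI_ex[OF True] by (auto simp: d_def)
  have mult: "c [^] (d * k) \<in> K" for k :: nat
    by (induction k) (use d(2) K c in \<open>auto simp: nat_pow_mult[symmetric] subgroup.m_closed subgroup.one_closed\<close>)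
  have "d dvd n" if "c [^] n \<in> K" for n :: nat
  proof (rule ccontr)
    assume "\<not> d dvd n"
    then have pos: "n mod d > 0" by (simp add: mod_greater_zero_iff_not_dvd)
    have "c [^] n = c [^] (d * (n div d)) \<otimes> c [^] (n mod d)" using c by (simp add: nat_pow_mult)
    then have "c [^] (n mod d) = inv (c [^] (d * (n div d))) \<otimes> c [^] n"
      using c by (simp add: inv_solve_left)
    then have "c [^] (n mod d) \<in> K"
      using that mult K by (simp add: subgroup.m_closed subgroup.m_inv_closed)
    then have "d \<le> n mod d" unfolding d_def using pos by (intro Least_le) (simp add: d_def)
    then show False using d(1) by (metis mod_less_divisor not_le)
  qed
  then have "c [^] n \<in> K \<longleftrightarrow> d dvd n" for n :: nat using mult by auto
  then show ?thesis by blast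
qed

text \<open>
  Let \<open>p\<close> and \<open>q\<close> be the exponents of \<open>c\<close> and its inverse, and \<open>h\<close> the rest of the product. If it is
  trivial, then \<open>c\<close> to the power \<open>p - q\<close> lies in the span of the remaining list, a subgroup, so \<open>p - q\<close>
  is a multiple of a number \<open>d\<close>, the order of \<open>c\<close> modulo that subgroup (0 if it is infinite). Replacing
  that power of \<open>c\<close> by a power of \<open>c\<^bsup>d\<^esup>\<close> or its inverse, which are fixed elements of the span, leaves a test over the shorter
  list.
\<close>

lemma decidable_eq_one:
  "triangular G (with_inverses G cs) \<Longrightarrow> definable_in G (with_inverses G cs) g \<Longrightarrow>
    decidable (\<lambda>a \<rho>. g a \<rho> = \<one>)"
proof (induction cs arbitrary: g)
  case Nil
  then show ?case by (simp add: definable_const)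
next
  case (Cons c cs)
  let ?cs = "with_inverses G cs"
  have tri: "triangular G ?cs" "triangular G (c # inv c # ?cs)" using Cons.prems by auto
  have c: "c \<in> carrier G" and cs: "set ?cs \<subseteq> carrier G"
    using triangular_carrier[OF tri(2)] by auto
  obtain p q h where p: "definable p" "definable q" "definable_in G ?cs h"
    "\<And>a \<rho>. g a \<rho> = c [^] p a \<rho> \<otimes> (inv c [^] q a \<rho> \<otimes> h a \<rho>)"
    using Cons.prems(2) by (auto; metis)
  have hK: "h a \<rho> \<in> span G ?cs" for a \<rho> by (rule definable_in_span[OF p(3)])
  then have h: "h a \<rho> \<in> carrier G" for a \<rho> using span_carrier[OF cs] by auto
  note K = span_subgroup[OF tri(1)]
  obtain d where d: "\<And>n :: nat. c [^] n \<in> span G ?cs \<longleftrightarrow> d dvd n"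
    using powers_in_subgroup[OF K c] by blast
  have test: "decidable (\<lambda>a \<rho>. \<exists>k<Suc (f a \<rho>). f a \<rho> = f' a \<rho> + d * k \<and> x [^] k \<otimes> h a \<rho> = \<one>)"
    if "definable f" "definable f'" "x \<in> span G ?cs" for f f' x
  proof -
    note closed = product_closed_if_triangular[OF tri(1)]
    have "definable_in G ?cs (\<lambda>a \<rho>. x [^] \<rho> 0 \<otimes> h a (\<lambda>i. \<rho> (Suc i)))"
      by (rule definable_in_mult[OF closed cs definable_in_pow[OF closed cs definable_in_const[OF that(3)] definable_var[of 0]]
          definable_in_shift[OF p(3), of Suc]])
    then have "decidable (\<lambda>a \<rho>. x [^] \<rho> 0 \<otimes> h a (\<lambda>i. \<rho> (Suc i)) = \<one>)"
      by (rule Cons.IH[OF tri(1)])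
    moreover have "decidable (\<lambda>a \<rho>. f a (\<lambda>i. \<rho> (Suc i)) = f' a (\<lambda>i. \<rho> (Suc i)) + d * \<rho> 0)"
      by (rule decidable_eq[OF definable_shift[OF that(1), of Suc]
          definable_add[OF definable_shift[OF that(2), of Suc] definable_mult[OF definable_const definable_var]]])
    ultimately show ?thesis
      by (intro decidable_ex definable_Suc that(1) decidable_conj)
  qed
  have iff: "g a \<rho> = \<one> \<longleftrightarrow>
      (\<exists>k<Suc (p a \<rho>). p a \<rho> = q a \<rho> + d * k \<and> (c [^] d) [^] k \<otimes> h a \<rho> = \<one>) \<or>
      (\<exists>k<Suc (q a \<rho>). q a \<rho> = p a \<rho> + d * k \<and> (inv (c [^] d)) [^] k \<otimes> h a \<rho> = \<one>)" for a \<rho>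
  proof -
    define P Q H where "P = p a \<rho>" and "Q = q a \<rho>" and "H = h a \<rho>"
    have H: "H \<in> carrier G" "H \<in> span G ?cs" using h hK by (simp_all add: H_def)
    have invp: "inv c [^] m = inv (c [^] m)" for m :: nat using c by (simp add: nat_pow_inv)
    have ge: "c [^] (n + m) \<otimes> (inv c [^] m \<otimes> H) = c [^] n \<otimes> H" for m n :: nat
    proof -
      have "c [^] (n + m) \<otimes> (inv c [^] m \<otimes> H) = c [^] n \<otimes> (c [^] m \<otimes> inv (c [^] m)) \<otimes> H"
        using c H unfolding invp nat_pow_mult[OF c, symmetric] by (simp only: m_assoc m_closed inv_closed nat_pow_closed)
      then show ?thesis using c H by simp
    qed
    have le: "c [^] m \<otimes> (inv c [^] (m + n) \<otimes> H) = inv (c [^] n) \<otimes> H" for m n :: nat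
    proof -
      have i: "inv c [^] (m + n) = inv (c [^] m) \<otimes> inv (c [^] n)"
        by (subst nat_pow_mult[OF inv_closed[OF c], symmetric]) (simp only: invp)
      have "c [^] m \<otimes> (inv c [^] (m + n) \<otimes> H) = (c [^] m \<otimes> inv (c [^] m)) \<otimes> (inv (c [^] n) \<otimes> H)"
        using c H unfolding i
        by (simp only: m_assoc m_closed inv_closed nat_pow_closed)
      then show ?thesis using c H by simp
    qed
    \<comment> \<open>for \<open>d = 0\<close> any quotient works, and 0 is one that respects the bound\<close>
    have quot: "\<exists>k<Suc m. m = n + d * k" if "n \<le> m" "d dvd m - n" for m n
    proof -
      obtain j where j: "m - n = d * j" using \<open>d dvd m - n\<close> by auto
      define k where "k = (if d = 0 then 0 else j)"
      have "m = n + d * k" using j that(1) by (auto simp: k_def)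
      moreover have "k \<le> d * k" by (simp add: k_def)
      ultimately have "k < Suc m \<and> m = n + d * k" by linarith
      then show ?thesis by blast
    qed
    have pw: "(c [^] d) [^] k = c [^] (d * k)" for k :: nat using c by (simp add: nat_pow_pow)
    have ipw: "(inv (c [^] d)) [^] k = inv (c [^] (d * k))" for k :: nat
      using c by (simp add: nat_pow_inv nat_pow_pow[symmetric])
    have "c [^] P \<otimes> (inv c [^] Q \<otimes> H) = \<one> \<longleftrightarrow>
      (\<exists>k<Suc P. P = Q + d * k \<and> c [^] (d * k) \<otimes> H = \<one>) \<or>
      (\<exists>k<Suc Q. Q = P + d * k \<and> inv (c [^] (d * k)) \<otimes> H = \<one>)" (is "?L \<longleftrightarrow> ?R")
    proof
      assume L: ?L
      show ?R
      proof (cases "Q \<le> P")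
        case True
        then have 1: "c [^] (P - Q) \<otimes> H = \<one>" using L ge[of "P - Q" Q] by simp
        then have "c [^] (P - Q) = inv H" using c H by (metis inv_equality nat_pow_closed inv_inv inv_closed)
        then have "c [^] (P - Q) \<in> span G ?cs" using H K by (simp add: subgroup.m_inv_closed)
        then have "d dvd P - Q" by (simp add: d)
        then obtain k where "k < Suc P" "P = Q + d * k" using quot[OF True] by blast
        then show ?thesis using 1 by auto
      next
        case False
        then have 1: "inv (c [^] (Q - P)) \<otimes> H = \<one>" using L le[of P "Q - P"] by simp
        then have "c [^] (Q - P) = H" using c H by (metis inv_equality nat_pow_closed inv_inv inv_closed)
        then have "c [^] (Q - P) \<in> span G ?cs" using H by simp
        then have "d dvd Q - P" by (simp add: d)
        then obtain k where "k < Suc Q" "Q = P + d * k" using quot[of P Q] False by auto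
        then show ?thesis using 1 by auto
      qed
    next
      assume ?R
      then show ?L
      proof (elim disjE exE conjE)
        fix k assume "P = Q + d * k" "c [^] (d * k) \<otimes> H = \<one>"
        then show ?L using ge[of "d * k" Q] by (simp add: add.commute)
      next
        fix k assume "Q = P + d * k" "inv (c [^] (d * k)) \<otimes> H = \<one>"
        then show ?L using le[of P "d * k"] by simp
      qed
    qed
    then show ?thesis unfolding pw ipw by (simp only: P_def Q_def H_def p(4))
  qed
  show ?case unfolding iff
    by (intro decidable_disj test p) (use d[of d] K in \<open>auto simp: subgroup.m_inv_closed\<close>)
qed

end

text \<open>
  Exponents are given by a function on all natural numbers; only the first ones matter.
\<close>

primrec power_product :: "('a, 'b) monoid_scheme \<Rightarrow> 'a list \<Rightarrow> (nat \<Rightarrow> nat) \<Rightarrow> 'a" where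
  "power_product G [] e = \<one>\<^bsub>G\<^esub>"
| "power_product G (c # cs) e = c [^]\<^bsub>G\<^esub> e 0 \<otimes>\<^bsub>G\<^esub> power_product G cs (\<lambda>i. e (Suc i))"

lemma definable_in_power_product:
  "(\<And>i. definable (z i)) \<Longrightarrow> definable_in G cs (\<lambda>a \<rho>. power_product G cs (\<lambda>i. z i a \<rho>))"
proof (induction cs arbitrary: z)
  case (Cons c cs)
  have "definable_in G cs (\<lambda>a \<rho>. power_product G cs (\<lambda>i. z (Suc i) a \<rho>))"
    by (rule Cons.IH) (rule Cons.prems)
  then show ?case using Cons.prems[of 0] by auto
qed simp

lemma power_product_bounded:
  assumes "definable_in G cs g"
  shows "\<exists>p :: nat poly. \<forall>a \<rho> N. (\<forall>i. \<rho> i \<le> N) \<longrightarrow>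
    (\<exists>e. (\<forall>i. e i \<le> poly p N) \<and> g a \<rho> = power_product G cs e)"
  using assms
proof (induction cs arbitrary: g)
  case (Cons c cs)
  then obtain z h where z: "definable z" "definable_in G cs h" "\<And>a \<rho>. g a \<rho> = c [^]\<^bsub>G\<^esub> z a \<rho> \<otimes>\<^bsub>G\<^esub> h a \<rho>"
    by auto
  obtain p :: "nat poly" where p: "\<And>a \<rho> N. (\<And>i. \<rho> i \<le> N) \<Longrightarrow> z a \<rho> \<le> poly p N"
    using definable_bounded[OF z(1)] by blast
  obtain q :: "nat poly" where q: "\<And>a \<rho> N. (\<forall>i. \<rho> i \<le> N) \<Longrightarrow>
      \<exists>e. (\<forall>i. e i \<le> poly q N) \<and> h a \<rho> = power_product G cs e"
    using Cons.IH[OF z(2)] by blast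
  show ?case
  proof (intro exI[of _ "p + q"] allI impI)
    fix a and \<rho> :: "nat \<Rightarrow> nat" and N assume N: "\<forall>i. \<rho> i \<le> N"
    obtain e where e: "\<forall>i. e i \<le> poly q N" "h a \<rho> = power_product G cs e" using q[OF N] by blast
    have "\<forall>i. case_nat (z a \<rho>) e i \<le> poly (p + q) N"
      using p[of \<rho> N a] N e(1) by (auto split: nat.split intro: trans_le_add2 trans_le_add1)
    then show "\<exists>e. (\<forall>i. e i \<le> poly (p + q) N) \<and> g a \<rho> = power_product G (c # cs) e"
      using e(2) z(3) by (intro exI[of _ "case_nat (z a \<rho>) e"]) simp
  qed
qed auto

section \<open>Triangular lists in nilpotent groups\<close>

text \<open>
  The new level at stage \<open>n + 1\<close> consists of the commutators of level \<open>n\<close> with everything up to level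
  \<open>n\<close>; the second component collects all levels so far. The level is the only measure kept of a
  commutator. Being coarser than its weight, it avoids the inclusions between commutator subgroups
  of terms of the lower central series.
\<close>

primrec commutator_levels :: "('a, 'b) monoid_scheme \<Rightarrow> 'a list \<Rightarrow> nat \<Rightarrow> 'a list \<times> 'a list" where
  "commutator_levels G ys 0 = (ys, ys)"
| "commutator_levels G ys (Suc n) =
    (let l = fst (commutator_levels G ys n); acc = snd (commutator_levels G ys n);
         l' = [inv\<^bsub>G\<^esub> x \<otimes>\<^bsub>G\<^esub> inv\<^bsub>G\<^esub> y \<otimes>\<^bsub>G\<^esub> x \<otimes>\<^bsub>G\<^esub> y. x \<leftarrow> with_inverses G l, y \<leftarrow> with_inverses G acc]
     in (l', acc @ l'))"

context group
begin

lemma power_product_in_span: "power_product G cs e \<in> span G cs"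
  by (induction cs arbitrary: e) auto

lemma with_inverses_carrier: "set cs \<subseteq> carrier G \<Longrightarrow> set (with_inverses G cs) \<subseteq> carrier G"
  by (induction cs) auto

lemma span_ConsI: "h \<in> span G cs \<Longrightarrow> c [^] (n :: nat) \<otimes> h \<in> span G (c # cs)"
  by auto

lemma span_append: "set ds \<subseteq> carrier G \<Longrightarrow> set cs \<subseteq> carrier G \<Longrightarrow> span G cs \<subseteq> span G (ds @ cs)"
proof (induction ds)
  case (Cons d ds)
  have "h \<in> span G (d # ds @ cs)" if h: "h \<in> span G cs" for h
  proof -
    have "h \<in> span G (ds @ cs)" "h \<in> carrier G" using Cons h span_carrier[of cs] by auto
    then show ?thesis using span_ConsI[of h "ds @ cs" d 0] by simp
  qed
  then show ?case by auto
qed simp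

lemma in_span: "set cs \<subseteq> carrier G \<Longrightarrow> x \<in> set cs \<Longrightarrow> x \<in> span G cs"
proof -
  assume cs: "set cs \<subseteq> carrier G" and "x \<in> set cs"
  then obtain ds es where x: "cs = ds @ x # es" by (meson split_list)
  have "x \<in> span G (x # es)" using span_ConsI[OF one_in_span[of es], of x 1] cs x by simp
  then show ?thesis using span_append[of ds "x # es"] cs x by auto
qed

lemma normalizes_append:
  assumes "set (ds @ cs) \<subseteq> carrier G" "normalizes G c cs"
    "\<And>d. d \<in> set ds \<Longrightarrow> \<exists>r \<in> span G cs. inv c \<otimes> d \<otimes> c = d \<otimes> r"
  shows "normalizes G c (ds @ cs)"
  using assms
proof (induction ds)
  case (Cons d ds)
  have "span G cs \<subseteq> span G (ds @ cs)" using Cons.prems(1) by (intro span_append) auto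
  then show ?case using Cons by fastforce
qed simp

lemma triangular_append:
  assumes "set (ds @ cs) \<subseteq> carrier G" "triangular G cs" "\<And>c. c \<in> set ds \<Longrightarrow> normalizes G c cs"
    "\<And>c d. c \<in> set ds \<Longrightarrow> d \<in> set ds \<Longrightarrow> \<exists>r \<in> span G cs. inv c \<otimes> d \<otimes> c = d \<otimes> r"
  shows "triangular G (ds @ cs)"
  using assms
proof (induction ds)
  case (Cons d ds)
  have "normalizes G d (ds @ cs)" using Cons.prems by (intro normalizes_append) auto
  then show ?case using Cons by simp
qed simp

lemma lower_central_subgroup: "subgroup (lower_central G n) G"
proof (induction n)
  case 0
  then show ?case by (simp add: subgroup_self)
next
  case (Suc n)
  then have "lower_central G n \<subseteq> carrier G" by (simp add: subgroup.subset)
  then show ?case by (auto intro!: generate_is_subgroup)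
qed

lemma commutator_levels_lower_central:
  assumes "set ys \<subseteq> carrier G"
  shows "set (fst (commutator_levels G ys n)) \<subseteq> lower_central G n \<and>
    set (snd (commutator_levels G ys n)) \<subseteq> carrier G"
proof (induction n)
  case 0
  then show ?case using assms by simp
next
  case (Suc n)
  let ?l = "fst (commutator_levels G ys n)" and ?acc = "snd (commutator_levels G ys n)"
  note sub = lower_central_subgroup[of n]
  have "inv x \<otimes> inv y \<otimes> x \<otimes> y \<in> lower_central G (Suc n)"
    if x: "x \<in> set (with_inverses G ?l)" and y: "y \<in> set (with_inverses G ?acc)" for x y
  proof -
    have "x \<in> lower_central G n"
      using x Suc sub by (auto simp: with_inverses_def subgroup.m_inv_closed)
    then have xi: "inv x \<in> lower_central G n" "x \<in> carrier G"
      using sub by (auto simp: subgroup.m_inv_closed subgroup.mem_carrier)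
    have yc: "y \<in> carrier G" using y Suc with_inverses_carrier by blast
    have "inv x \<otimes> inv y \<otimes> x \<otimes> y = inv x \<otimes> inv y \<otimes> inv (inv x) \<otimes> inv (inv y)"
      using xi yc by simp
    then show ?thesis
      unfolding lower_central.simps using xi yc by (intro generate.incl) blast
  qed
  moreover have "lower_central G (Suc n) \<subseteq> carrier G"
    using lower_central_subgroup[of "Suc n"] by (rule subgroup.subset)
  ultimately show ?case
    using Suc by (auto simp: Let_def simp del: lower_central.simps)
qed

text \<open>
  For \<open>c\<close> up to level \<open>n\<close> and \<open>d\<close> in level \<open>n\<close>, the correction in \<open>c\<^sup>-\<^sup>1 d c = d [d, c]\<close> is itself an
  entry of level \<open>n + 1\<close>, hence it comes later in the list, or it is trivial if the lower central series
  has ended. The list is built from its end.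
\<close>

lemma nilpotent_triangular:
  assumes nil: "nilpotent_group G" and ys: "set ys \<subseteq> carrier G"
  shows "\<exists>cs. triangular G (with_inverses G cs) \<and> set ys \<subseteq> span G (with_inverses G cs)"
proof -
  obtain s where s: "lower_central G s = {\<one>}" using nil by (auto simp: nilpotent_group_def)
  let ?l = "\<lambda>n. fst (commutator_levels G ys n)" and ?acc = "\<lambda>n. snd (commutator_levels G ys n)"
  define T where "T n = with_inverses G (concat (map ?l [n..<s]))" for n
  have lc: "set (?l n) \<subseteq> carrier G" "set (?acc n) \<subseteq> carrier G" for n
    using commutator_levels_lower_central[OF ys, of n] lower_central_subgroup[of n]
    by (auto dest: subgroup.mem_carrier)
  have T: "set (T n) \<subseteq> carrier G" for n
    unfolding T_def by (intro with_inverses_carrier) (use lc in auto)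
  have acc: "set (?l n) \<subseteq> set (?acc n)" for n by (cases n) (auto simp: Let_def)
  have acc': "set (?acc n) \<subseteq> set (?acc (Suc n))" for n by (auto simp: Let_def)
  have WI_mono: "set (with_inverses G as) \<subseteq> set (with_inverses G bs)" if "set as \<subseteq> set bs" for as bs
    using that by (auto simp: with_inverses_def)
  have main: "triangular G (T n) \<and> (\<forall>c \<in> set (with_inverses G (?acc n)). normalizes G c (T n))"
    if "n \<le> s" for n
    using that
  proof (induction n rule: inc_induct)
    case base
    then show ?case by (simp add: T_def)
  next
    case (step n)
    have Tn: "T n = with_inverses G (?l n) @ T (Suc n)"
      using step.hyps by (simp add: T_def upt_conv_Cons)
    have WIl: "set (with_inverses G (?l n)) \<subseteq> carrier G" by (intro with_inverses_carrier lc)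
    have r: "\<exists>r \<in> span G (T (Suc n)). inv c \<otimes> d \<otimes> c = d \<otimes> r"
      if c: "c \<in> set (with_inverses G (?acc n))" and d: "d \<in> set (with_inverses G (?l n))" for c d
    proof
      let ?r = "inv d \<otimes> inv c \<otimes> d \<otimes> c"
      have cd: "c \<in> carrier G" "d \<in> carrier G" using c d with_inverses_carrier lc by blast+
      then have "d \<otimes> ?r = (d \<otimes> inv d) \<otimes> inv c \<otimes> d \<otimes> c"
        by (simp only: m_assoc m_closed inv_closed)
      then show "inv c \<otimes> d \<otimes> c = d \<otimes> ?r" using cd by simp
      have l: "?r \<in> set (?l (Suc n))" using c d by (auto simp: Let_def)
      show "?r \<in> span G (T (Suc n))"
      proof (cases "Suc n < s")
        case True
        then have "set (?l (Suc n)) \<subseteq> set (T (Suc n))"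
          by (auto simp: T_def with_inverses_def upt_conv_Cons)
        then show ?thesis using l in_span[OF T] by blast
      next
        case False
        then have "Suc n = s" using step.hyps by simp
        then have "?r = \<one>"
          using l commutator_levels_lower_central[OF ys, of "Suc n"] s by auto
        then show ?thesis using one_in_span[OF T] by simp
      qed
    qed
    have nrm: "normalizes G c (T (Suc n))" if "c \<in> set (with_inverses G (?acc n))" for c
      using that step.IH WI_mono[OF acc'] by blast
    have carr: "set (with_inverses G (?l n) @ T (Suc n)) \<subseteq> carrier G" using WIl T by simp
    show ?case
    proof (intro conjI ballI)
      show "triangular G (T n)"
        unfolding Tn using carr step.IH nrm r WI_mono[OF acc]
        by (intro triangular_append) blast+
      show "normalizes G c (T n)" if "c \<in> set (with_inverses G (?acc n))" for c
        unfolding Tn using carr nrm r that by (intro normalizes_append) blast+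
    qed
  qed
  show ?thesis
  proof (cases s)
    case 0
    then have "set ys \<subseteq> {\<one>}" using s ys by simp
    then show ?thesis by (intro exI[of _ "[]"]) simp
  next
    case (Suc s')
    then have "[0..<s] = 0 # [1..<s]" by (simp add: upt_conv_Cons del: upt_Suc)
    then have "set ys \<subseteq> set (T 0)" by (auto simp: T_def with_inverses_def)
    then have "set ys \<subseteq> span G (T 0)" using in_span[OF T] by blast
    then show ?thesis using main[of 0] unfolding T_def by blast
  qed
qed

end

context group
begin

section \<open>Polynomial bounds for exponents\<close>

text \<open>
  A letter of a finite alphabet is stored in a 0/1 array as a mark at the position of its number, so
  that a word of any length becomes one array.
\<close>

primrec select :: "'a list \<Rightarrow> (nat \<Rightarrow> bool) \<Rightarrow> nat \<Rightarrow> 'a" where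
  "select [] b p = \<one>"
| "select (h # hs) b p = (if b p then h else select hs b (Suc p))"

lemma definable_in_select:
  assumes cs: "set cs \<subseteq> carrier G" and hs: "set hs \<subseteq> span G cs" and f: "definable f"
  shows "definable_in G cs (\<lambda>a \<rho>. select hs (a False) (f a \<rho>))"
  using hs f
proof (induction hs arbitrary: f)
  case Nil
  then show ?case using definable_in_const[OF one_in_span[OF cs]] by simp
next
  case (Cons h hs)
  have "definable_in G cs (\<lambda>a \<rho>. if a False (f a \<rho>) then h else select hs (a False) (Suc (f a \<rho>)))"
    using Cons by (intro definable_in_if decidable_array definable_in_const Cons.IH definable_Suc) auto
  then show ?case by simp
qed

lemma select_nth:
  "i < length hs \<Longrightarrow> (\<And>j. j < i \<Longrightarrow> \<not> b (p + j)) \<Longrightarrow> b (p + i) \<Longrightarrow> select hs b p = hs ! i"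
proof (induction hs arbitrary: i p)
  case (Cons h hs)
  show ?case
  proof (cases i)
    case (Suc i')
    have "\<not> b (Suc p + j)" if "j < i'" for j using Cons.prems(2)[of "Suc j"] that Suc by simp
    moreover have "\<not> b p" using Cons.prems(2)[of 0] Suc by simp
    ultimately show ?thesis using Cons.prems(1,3) Cons.IH[of i' "Suc p"] Suc by simp
  qed (use Cons.prems in auto)
qed simp

text \<open>
  A word over \<open>S\<close> can be stored in an array, and its product is then an iterated product of a definable
  family. The bound for the exponents holds for all arrays at once, hence for all words.
\<close>

lemma bounded_products:
  assumes tri: "triangular G cs" and S: "finite S" "S \<subseteq> span G cs"
  shows "\<exists>p :: nat poly. \<forall>xs. set xs \<subseteq> S \<longrightarrow>
    (\<exists>e. (\<forall>i. e i \<le> poly p (length xs)) \<and> gprod G (nth xs) (length xs) = power_product G cs e)"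
proof -
  obtain hs where hs: "set hs = S" using finite_list[OF S(1)] by blast
  define M where "M = length hs"
  note cs = triangular_carrier[OF tri]
  have "definable_in G cs (\<lambda>a \<rho>. select hs (a False) (\<rho> 0 * M))"
    using hs S by (intro definable_in_select cs definable_mult definable_var definable_const) auto
  from definable_in_gprod[OF product_closed_if_triangular[OF tri] this definable_var[of 0]]
  have "definable_in G cs (\<lambda>a \<rho>. gprod G (\<lambda>t. select hs (a False) (t * M)) (\<rho> 0))" by simp
  from power_product_bounded[OF this] obtain p :: "nat poly" where p: "\<forall>a (\<rho> :: nat \<Rightarrow> nat) N. (\<forall>i. \<rho> i \<le> N) \<longrightarrow>
      (\<exists>e. (\<forall>i. e i \<le> poly p N) \<and> gprod G (\<lambda>t. select hs (a False) (t * M)) (\<rho> 0) = power_product G cs e)" ..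
  have "\<exists>e. (\<forall>i. e i \<le> poly p (length xs)) \<and> gprod G (nth xs) (length xs) = power_product G cs e"
    if xs: "set xs \<subseteq> S" for xs
  proof -
    have "\<exists>i<M. hs ! i = xs ! t" if "t < length xs" for t
      using subsetD[OF xs nth_mem[OF that]] unfolding hs[symmetric] M_def in_set_conv_nth .
    then obtain ix where ix: "\<And>t. t < length xs \<Longrightarrow> ix t < M \<and> hs ! ix t = xs ! t" by metis
    define a :: arrays where "a = (\<lambda>_ p. p mod M = ix (p div M))"
    have sel: "select hs (a False) (t * M) = xs ! t" if "t < length xs" for t
    proof -
      have i: "ix t < M" "hs ! ix t = xs ! t" using ix[OF that] by auto
      have "a False (t * M + j) \<longleftrightarrow> j = ix t" if "j < M" for j using that by (simp add: a_def)
      with i have "select hs (a False) (t * M) = hs ! ix t"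
        by (intro select_nth) (auto simp: M_def)
      then show ?thesis using i by simp
    qed
    have "gprod G (\<lambda>t. select hs (a False) (t * M)) n = gprod G (nth xs) n" if "n \<le> length xs" for n
      using that by (induction n) (auto simp: sel)
    from this[OF order_refl] show ?thesis
      using p[rule_format, of "\<lambda>_. length xs" "length xs" a] by simp
  qed
  then show ?thesis by blast
qed

end

section \<open>Reading words in a group with a nilpotent subgroup of finite index\<close>

definition labels :: "'a set \<Rightarrow> 'a letter option set" where
  "labels X = {l. \<forall>x. l = Some x \<longrightarrow> generator x \<in> X}"

lemma finite_labels: "finite X \<Longrightarrow> finite (labels X)"
proof -
  assume "finite X"
  have "labels X \<subseteq> insert None (Some ` (Gen ` X \<union> Inv ` X))"
  proof
    fix l assume "l \<in> labels X"
    then show "l \<in> insert None (Some ` (Gen ` X \<union> Inv ` X))"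
      by (cases l; cases "the l") (auto simp: labels_def)
  qed
  from finite_subset[OF this] \<open>finite X\<close> show ?thesis by simp
qed

text \<open>
  Right cosets of \<open>H\<close> are numbered from 0 to \<open>m - 1\<close>, with representatives \<open>rep j\<close>. In coset \<open>j\<close> a label \<open>l\<close>
  leads to coset \<open>nxt j l\<close> and contributes the factor \<open>elt j l\<close> in \<open>H\<close>.
\<close>

locale coset_transducer = group G for G :: "('a, 'b) monoid_scheme" (structure) +
  fixes H :: "'a set" and cs :: "'a list" and X :: "'a set"
    and m :: nat and rep :: "nat \<Rightarrow> 'a" and j0 :: nat
    and nxt :: "nat \<Rightarrow> 'a letter option \<Rightarrow> nat" and elt :: "nat \<Rightarrow> 'a letter option \<Rightarrow> 'a"
  assumes H: "subgroup H G"
    and tri: "triangular (G\<lparr>carrier := H\<rparr>) (with_inverses (G\<lparr>carrier := H\<rparr>) cs)"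
    and X: "finite X" "X \<subseteq> carrier G"
    and rep: "\<And>j. j < m \<Longrightarrow> rep j \<in> carrier G"
    and j0: "j0 < m" "rep j0 = \<one>"
    and rep_unique: "\<And>i j h k. \<lbrakk>i < m; j < m; h \<in> H; k \<in> H; h \<otimes> rep i = k \<otimes> rep j\<rbrakk> \<Longrightarrow> i = j"
    and nxt: "\<And>j l. \<lbrakk>j < m; \<And>x. l = Some x \<Longrightarrow> generator x \<in> X\<rbrakk> \<Longrightarrow> nxt j l < m \<and>
       elt j l \<in> span (G\<lparr>carrier := H\<rparr>) (with_inverses (G\<lparr>carrier := H\<rparr>) cs) \<and>
       rep j \<otimes> (case l of None \<Rightarrow> \<one> | Some x \<Rightarrow> letter_value G x) = elt j l \<otimes> rep (nxt j l)"

lemma coset_transducer_exists: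
  fixes G :: "('a, 'b) monoid_scheme"
  assumes G: "group G" and vn: "virtually_nilpotent G" and X: "finite X" "X \<subseteq> carrier G"
  shows "\<exists>H cs m rep j0 nxt elt. coset_transducer G H cs X m rep j0 nxt elt"
proof -
  interpret group G by (rule G)
  obtain H where H: "subgroup H G" "finite (rcosets\<^bsub>G\<^esub> H)" and nil: "nilpotent_group (G\<lparr>carrier := H\<rparr>)"
    using vn unfolding virtually_nilpotent_def by blast
  let ?K = "G\<lparr>carrier := H\<rparr>"
  interpret K: group ?K using subgroup_imp_group[OF H(1)] .
  define m where "m = card (rcosets\<^bsub>G\<^esub> H)"
  obtain f where f: "bij_betw f {0..<m} (rcosets\<^bsub>G\<^esub> H)"
    using ex_bij_betw_nat_finite[OF H(2)] unfolding m_def by blast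
  \<comment> \<open>the representative 1 makes an element trivial only if it is in the coset \<open>H\<close> and its factor from \<open>H\<close> is trivial\<close>
  define rep where "rep j = (if f j = H then \<one>\<^bsub>G\<^esub> else SOME g. g \<in> f j)" for j
  have coset: "f j \<in> rcosets\<^bsub>G\<^esub> H" if "j < m" for j
    using bij_betwE[OF f] that by simp
  have rep_in: "rep j \<in> f j" if j: "j < m" for j
  proof (cases "f j = H")
    case True
    then show ?thesis using subgroup.one_closed[OF H(1)] by (simp add: rep_def)
  next
    case False
    obtain g where g: "g \<in> carrier G" "f j = H #>\<^bsub>G\<^esub> g" using coset[OF j] by (auto simp: RCOSETS_def)
    have "g \<in> f j" using rcos_self[OF g(1) H(1)] g(2) by simp
    then have "(SOME g. g \<in> f j) \<in> f j" by (rule someI)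
    then show ?thesis using False by (simp add: rep_def)
  qed
  have rep: "rep j \<in> carrier G" if j: "j < m" for j
  proof -
    obtain g where g: "g \<in> carrier G" "f j = H #>\<^bsub>G\<^esub> g" using coset[OF j] by (auto simp: RCOSETS_def)
    then show ?thesis
      using rep_in[OF j] r_coset_subset_G[OF subgroup.subset[OF H(1)] g(1)] by auto
  qed
  have f_rep: "f j = H #>\<^bsub>G\<^esub> rep j" if j: "j < m" for j
  proof -
    obtain g where g: "g \<in> carrier G" "f j = H #>\<^bsub>G\<^esub> g" using coset[OF j] by (auto simp: RCOSETS_def)
    have "H #>\<^bsub>G\<^esub> g = H #>\<^bsub>G\<^esub> rep j"
      by (rule repr_independence[OF _ g(1) H(1)]) (use rep_in[OF j] g(2) in blast)
    with g(2) show ?thesis by (rule trans)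
  qed
  have ex: "\<exists>j<m. g \<otimes>\<^bsub>G\<^esub> inv\<^bsub>G\<^esub> rep j \<in> H" if g: "g \<in> carrier G" for g
  proof -
    have "H #>\<^bsub>G\<^esub> g \<in> rcosets\<^bsub>G\<^esub> H" using g subgroup.subset[OF H(1)] by (simp add: rcosetsI)
    then obtain j where j: "j < m" "f j = H #>\<^bsub>G\<^esub> g" using f by (metis atLeastLessThan_iff bij_betw_def imageE)
    have "g \<in> H #>\<^bsub>G\<^esub> rep j" using rcos_self[OF g H(1)] j f_rep by simp
    then show ?thesis using subgroup.rcos_module[OF H(1) G rep[OF j(1)] g] j(1) by auto
  qed
  have "H \<in> rcosets\<^bsub>G\<^esub> H" using subgroup.subgroup_in_rcosets[OF H(1) G] .
  then obtain j0 where j0: "j0 < m" "f j0 = H" using f by (metis atLeastLessThan_iff bij_betw_def imageE)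
  have unique: "i = j" if "i < m" "j < m" "h \<in> H" "k \<in> H" "h \<otimes>\<^bsub>G\<^esub> rep i = k \<otimes>\<^bsub>G\<^esub> rep j" for i j h k
  proof -
    have "h \<otimes>\<^bsub>G\<^esub> rep i \<in> H #>\<^bsub>G\<^esub> rep i" "k \<otimes>\<^bsub>G\<^esub> rep j \<in> H #>\<^bsub>G\<^esub> rep j"
      unfolding r_coset_def using that(3,4) by blast+
    then have "f i \<inter> f j \<noteq> {}" using that f_rep by auto
    then have "f i = f j"
      using pairwiseD[OF rcos_disjoint[OF H(1)] coset[OF that(1)] coset[OF that(2)]] by (auto simp: disjnt_def)
    then show ?thesis using f that(1,2) by (auto simp: bij_betw_def inj_on_def)
  qed
  define val where "val l = (case l of None \<Rightarrow> \<one>\<^bsub>G\<^esub> | Some x \<Rightarrow> letter_value G x)" for l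
  have val: "val l \<in> carrier G" if "\<And>x. l = Some x \<Longrightarrow> generator x \<in> X" for l
    using that X(2) by (cases l; cases "the l") (auto simp: val_def)
  define nxt where "nxt j l = (SOME i. i < m \<and> rep j \<otimes>\<^bsub>G\<^esub> val l \<otimes>\<^bsub>G\<^esub> inv\<^bsub>G\<^esub> rep i \<in> H)" for j l
  define elt where "elt j l = rep j \<otimes>\<^bsub>G\<^esub> val l \<otimes>\<^bsub>G\<^esub> inv\<^bsub>G\<^esub> rep (nxt j l)" for j l
  have nxt: "nxt j l < m \<and> elt j l \<in> H" if "j < m" "\<And>x. l = Some x \<Longrightarrow> generator x \<in> X" for j l
    using someI_ex[OF ex[of "rep j \<otimes>\<^bsub>G\<^esub> val l"]] rep[OF that(1)] val[OF that(2)]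
    by (simp add: nxt_def elt_def)
  have "finite ((\<lambda>(j, l). elt j l) ` ({..<m} \<times> labels X))" using finite_labels[OF X(1)] by simp
  from finite_list[OF this] obtain ys where ys: "set ys = (\<lambda>(j, l). elt j l) ` ({..<m} \<times> labels X)" ..
  have "set ys \<subseteq> carrier ?K" using nxt by (auto simp: ys labels_def)
  then obtain cs where cs: "triangular ?K (with_inverses ?K cs)" "set ys \<subseteq> span ?K (with_inverses ?K cs)"
    using K.nilpotent_triangular[OF nil, of ys] by blast
  have "coset_transducer G H cs X m rep j0 nxt elt"
  proof (intro coset_transducer.intro[OF G] coset_transducer_axioms.intro)
    show "rep j0 = \<one>\<^bsub>G\<^esub>" using j0 by (simp add: rep_def)
    fix j l assume j: "j < m" and l: "\<And>x. l = Some x \<Longrightarrow> generator x \<in> X"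
    have "rep j \<otimes>\<^bsub>G\<^esub> val l = elt j l \<otimes>\<^bsub>G\<^esub> rep (nxt j l)"
      using rep[OF j] val[OF l] nxt[OF j l] rep[of "nxt j l"] by (simp add: elt_def m_assoc)
    moreover have "elt j l \<in> set ys" using j l by (auto simp: ys labels_def)
    ultimately show "nxt j l < m \<and> elt j l \<in> span ?K (with_inverses ?K cs) \<and>
       rep j \<otimes>\<^bsub>G\<^esub> (case l of None \<Rightarrow> \<one>\<^bsub>G\<^esub> | Some x \<Rightarrow> letter_value G x) = elt j l \<otimes>\<^bsub>G\<^esub> rep (nxt j l)"
      using nxt[OF j l] cs(2) by (auto simp: val_def)
  qed (use H(1) cs(1) X rep j0(1) unique in blast)+
  then show ?thesis by blast
qed

section \<open>Decoding the input\<close>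

text \<open>
  The number of blocks that end before position \<open>q\<close>, in the unary code of a list of numbers.
\<close>

definition separators :: "(nat \<Rightarrow> bool) \<Rightarrow> nat \<Rightarrow> nat" where
  "separators b q = (\<Sum>p<q. of_bool (\<not> b p))"

text \<open>
  The length of block \<open>j\<close> is counted by its positions. This makes entry \<open>j\<close> of the encoded
  list available as a bounded sum, without any parsing.
\<close>

definition block :: "(nat \<Rightarrow> bool) \<Rightarrow> nat \<Rightarrow> nat \<Rightarrow> nat" where
  "block b n j = (\<Sum>q<n. of_bool (separators b q = j \<and> b q))"

lemma separators_Suc: "separators b (Suc q) = separators b q + of_bool (\<not> b q)"
  by (simp add: separators_def)

lemma block_Suc: "block b (Suc n) j = block b n j + of_bool (separators b n = j \<and> b n)"
  by (simp add: block_def)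

lemma block_run:
  "(\<And>i. i < k \<Longrightarrow> b (n + i)) \<Longrightarrow> separators b (n + k) = separators b n \<and>
    block b (n + k) j = block b n j + (if separators b n = j then k else 0)"
  by (induction k) (auto simp: separators_Suc block_Suc)

lemma encode_nats_snoc: "encode_nats (ns @ [k]) = encode_nats ns @ replicate k True @ [False]"
  by (simp add: encode_nats_def)

lemma block_encode_nats:
  assumes "\<And>p. p < length (encode_nats ns) \<Longrightarrow> b p = encode_nats ns ! p"
  shows "separators b (length (encode_nats ns)) = length ns \<and>
    (\<forall>j. block b (length (encode_nats ns)) j = (if j < length ns then ns ! j else 0))"
  using assms
proof (induction ns rule: rev_induct)
  case Nil
  then show ?case by (simp add: encode_nats_Nil separators_def block_def)
next
  case (snoc k ns)
  let ?n = "length (encode_nats ns)"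
  have b: "b p = (encode_nats ns @ replicate k True @ [False]) ! p" if "p < ?n + k + 1" for p
    using snoc.prems[of p] that by (simp add: encode_nats_snoc)
  have IH: "separators b ?n = length ns" "\<And>j. block b ?n j = (if j < length ns then ns ! j else 0)"
    using snoc.IH b by (auto simp: nth_append)
  have "b (?n + i)" if "i < k" for i using b[of "?n + i"] that by (simp add: nth_append)
  from block_run[of k b ?n, OF this] have 1: "separators b (?n + k) = length ns"
    "\<And>j. block b (?n + k) j = (if j < length ns then ns ! j else if j = length ns then k else 0)"
    using IH by auto
  have 2: "\<not> b (?n + k)" using b[of "?n + k"] by (simp add: nth_append)
  have "length (encode_nats (ns @ [k])) = Suc (?n + k)" by (simp add: encode_nats_snoc)
  then show ?case using 1 2 by (auto simp: separators_Suc block_Suc nth_append)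
qed

lemma encode_nats_surj: "w = [] \<or> \<not> last w \<Longrightarrow> \<exists>ns. w = encode_nats ns"
proof (induction w)
  case Nil
  then show ?case by (metis encode_nats_Nil)
next
  case (Cons x w)
  then obtain ns where ns: "w = encode_nats ns" by (auto split: if_splits)
  show ?case
  proof (cases x)
    case False
    then show ?thesis using ns by (intro exI[of _ "0 # ns"]) (simp add: encode_nats_Cons)
  next
    case True
    then have "w \<noteq> []" using Cons.prems by auto
    then obtain k ns' where "ns = k # ns'" using ns by (cases ns) (auto simp: encode_nats_Nil)
    then show ?thesis using ns True
      by (intro exI[of _ "Suc k # ns'"]) (simp add: encode_nats_Cons)
  qed
qed

lemma last_encode_nats: "ns \<noteq> [] \<Longrightarrow> \<not> last (encode_nats ns)"
  by (induction ns rule: rev_induct) (auto simp: encode_nats_snoc)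

lemma encode_nats_eq_Nil: "encode_nats ns = [] \<longleftrightarrow> ns = []"
  by (cases ns) (auto simp: encode_nats_Cons encode_nats_Nil)

lemma concat_triples:
  "length zs = 3 * k \<Longrightarrow> concat (map (\<lambda>i. [zs ! (3 * i), zs ! (3 * i + 1), zs ! (3 * i + 2)]) [0..<k]) = zs"
proof (induction k arbitrary: zs)
  case (Suc k)
  define ys where "ys = take (3 * k) zs"
  have len: "length ys = 3 * k" using Suc.prems by (simp add: ys_def)
  have "concat (map (\<lambda>i. [zs ! (3 * i), zs ! (3 * i + 1), zs ! (3 * i + 2)]) [0..<k]) =
      concat (map (\<lambda>i. [ys ! (3 * i), ys ! (3 * i + 1), ys ! (3 * i + 2)]) [0..<k])"
    by (intro arg_cong[where f = concat] map_cong) (auto simp: ys_def)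
  also have "\<dots> = ys" by (rule Suc.IH[OF len])
  finally have 1: "concat (map (\<lambda>i. [zs ! (3 * i), zs ! (3 * i + 1), zs ! (3 * i + 2)]) [0..<k]) = ys" .
  have "zs = ys @ [zs ! (3 * k), zs ! (3 * k + 1), zs ! (3 * k + 2)]"
    using Suc.prems by (intro nth_equalityI) (auto simp: ys_def nth_append nth_Cons numeral_eq_Suc less_Suc_eq split: nat.split)
  then show ?case using 1 by simp
qed simp

text \<open>
  Along a walk the number of vertices reachable in at least one step decreases strictly, and the
  first vertex is not among those reachable from it.
\<close>

lemma walk_length_acyclic:
  assumes r: "acyclic r" "r \<subseteq> {..<V} \<times> {..<V :: nat}" and walk: "(x, y) \<in> r ^^ n" and n: "n > 0"
  shows "n < V"
proof -
  have fin: "finite {z. (x, z) \<in> r\<^sup>+}" for x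
  proof (rule finite_subset)
    show "{z. (x, z) \<in> r\<^sup>+} \<subseteq> {..<V}" using trancl_mono[OF _ r(2)] trancl_subset_Sigma[OF r(2)] by auto
  qed simp
  have "n + card {z. (y, z) \<in> r\<^sup>+} \<le> card {z. (x, z) \<in> r\<^sup>+}"
    using walk
  proof (induction n arbitrary: y)
    case (Suc n)
    then obtain u where u: "(x, u) \<in> r ^^ n" "(u, y) \<in> r" by auto
    have "{z. (y, z) \<in> r\<^sup>+} \<subset> {z. (u, z) \<in> r\<^sup>+}"
    proof
      show "{z. (y, z) \<in> r\<^sup>+} \<subseteq> {z. (u, z) \<in> r\<^sup>+}" using u(2) by (auto intro: trancl_into_trancl2)
      have "y \<in> {z. (u, z) \<in> r\<^sup>+}" "y \<notin> {z. (y, z) \<in> r\<^sup>+}" using u(2) r(1) by (auto simp: acyclic_def)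
      then show "{z. (y, z) \<in> r\<^sup>+} \<noteq> {z. (u, z) \<in> r\<^sup>+}" by blast
    qed
    from psubset_card_mono[OF fin this] Suc.IH[OF u(1)] show ?case by simp
  qed simp
  moreover have "card {z. (x, z) \<in> r\<^sup>+} < V"
  proof -
    have "(x, y) \<in> r\<^sup>+" using walk n relpow_imp_rtrancl by (metis trancl_power)
    then have x: "x < V" using trancl_subset_Sigma[OF r(2)] by auto
    have "{z. (x, z) \<in> r\<^sup>+} \<subseteq> {..<V} - {x}"
      using trancl_subset_Sigma[OF r(2)] r(1) by (auto simp: acyclic_def)
    then have "card {z. (x, z) \<in> r\<^sup>+} \<le> card ({..<V} - {x})" by (intro card_mono) auto
    then show ?thesis using x by simp
  qed
  ultimately show ?thesis by simp
qed

lemma walk_if_cyclic: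
  assumes "\<not> acyclic r"
  shows "\<exists>x y. (x, y) \<in> r ^^ n"
proof -
  obtain x where x: "(x, x) \<in> r\<^sup>+" using assms by (auto simp: acyclic_def)
  have "\<exists>y. (y, y) \<in> r\<^sup>+ \<and> (x, y) \<in> r ^^ n"
  proof (induction n)
    case (Suc n)
    then obtain y where y: "(y, y) \<in> r\<^sup>+" "(x, y) \<in> r ^^ n" by blast
    obtain z where z: "(y, z) \<in> r" "(z, y) \<in> r\<^sup>*" using y(1) by (meson tranclD)
    have "(z, z) \<in> r\<^sup>+" using z by (meson rtrancl_into_trancl1)
    then show ?case using y(2) z(1) by auto
  qed (use x in auto)
  then show ?thesis by blast
qed

lemma digits_exist:
  fixes B :: nat
  assumes "\<And>i. i < r \<Longrightarrow> \<delta> i < B"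
  shows "\<exists>s<B ^ r. \<forall>i<r. (s div B ^ i) mod B = \<delta> i"
  using assms
proof (induction r arbitrary: \<delta>)
  case (Suc r)
  obtain s where s: "s < B ^ r" "\<And>i. i < r \<Longrightarrow> (s div B ^ i) mod B = \<delta> (Suc i)"
    using Suc.IH[of "\<lambda>i. \<delta> (Suc i)"] Suc.prems by auto
  have \<delta>0: "\<delta> 0 < B" by (rule Suc.prems) simp
  have div: "(\<delta> 0 + B * s) div B = s" using \<delta>0 by simp
  have "B * Suc s \<le> B * B ^ r" using s(1) by (intro mult_le_mono2) simp
  then have "\<delta> 0 + B * s < B ^ Suc r" using \<delta>0 by simp
  moreover have "((\<delta> 0 + B * s) div B ^ i) mod B = \<delta> i" if "i < Suc r" for i
  proof (cases i)
    case 0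
    then show ?thesis using \<delta>0 by simp
  next
    case (Suc i')
    then show ?thesis using s(2)[of i'] that div by (simp add: div_mult2_eq)
  qed
  ultimately show ?case by blast
qed simp

lemma table_iff:
  "table \<phi> w t i \<longleftrightarrow>
    i < t \<and> \<phi> (arrays_of w (table \<phi> w i)) (case_nat i (case_nat (length w) (\<lambda>_. 0))) \<noteq> 0"
  by (induction t) (auto simp: less_Suc_eq)

lemma power_product_cong:
  "(\<And>i. i < length cs \<Longrightarrow> e i = e' i) \<Longrightarrow> power_product G cs e = power_product G cs e'"
proof (induction cs arbitrary: e e')
  case (Cons c cs)
  have "power_product G cs (\<lambda>i. e (Suc i)) = power_product G cs (\<lambda>i. e' (Suc i))"
    by (rule Cons.IH) (use Cons.prems in auto)
  then show ?case using Cons.prems[of 0] by simp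
qed simp

definition label_word :: "'a letter option \<Rightarrow> 'a letter list" where
  "label_word l = (case l of None \<Rightarrow> [] | Some x \<Rightarrow> [x])"

text \<open>
  Paths that grow at their end and count their edges, as in the dynamic programming below.
\<close>

inductive npath :: "'a edge set \<Rightarrow> nat \<Rightarrow> nat \<Rightarrow> 'a letter list \<Rightarrow> nat \<Rightarrow> bool" for E s where
  npath_0: "npath E s 0 [] s"
| npath_Suc: "npath E s d u v \<Longrightarrow> (v, l, v') \<in> E \<Longrightarrow> npath E s (Suc d) (u @ label_word l) v'"

lemma labeled_path_snoc:
  "labeled_path E s u v \<Longrightarrow> (v, l, v') \<in> E \<Longrightarrow> labeled_path E s (u @ label_word l) v'"
proof (induction rule: labeled_path.induct)
  case (path_empty u)
  then show ?case
    by (cases l) (auto simp: label_word_def intro: labeled_path.intros)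
qed (auto intro: labeled_path.intros)

lemma npath_Cons:
  "npath E s' d u v \<Longrightarrow> (s, l, s') \<in> E \<Longrightarrow> npath E s (Suc d) (label_word l @ u) v"
proof (induction rule: npath.induct)
  case npath_0
  then show ?case using npath.npath_Suc[OF npath.npath_0, of s l s' E] by simp
next
  case (npath_Suc d u v l' v')
  then show ?case using npath.npath_Suc[of E s "Suc d" "label_word l @ u" v l' v'] by simp
qed

lemma labeled_path_iff_npath: "labeled_path E s u v \<longleftrightarrow> (\<exists>d. npath E s d u v)"
proof
  show "\<exists>d. npath E s d u v" if "labeled_path E s u v"
    using that
  proof (induction rule: labeled_path.induct)
    case (path_eps u v w z)
    then show ?case using npath_Cons[of E v _ w z u None] by (auto simp: label_word_def)
  next
    case (path_letter u a v w z)
    then show ?case using npath_Cons[of E v _ w z u "Some a"] by (auto simp: label_word_def)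
  qed (auto intro: npath_0)
  have "npath E s d u v \<Longrightarrow> labeled_path E s u v" for d
    by (induction rule: npath.induct) (auto intro: labeled_path_snoc path_empty)
  then show "\<exists>d. npath E s d u v \<Longrightarrow> labeled_path E s u v" by blast
qed

lemma npath_relpow: "npath E s d u v \<Longrightarrow> (s, v) \<in> {(u, v). \<exists>l. (u, l, v) \<in> E} ^^ d"
  by (induction rule: npath.induct) auto

lemma gprod_cong: "(\<And>t. t < n \<Longrightarrow> f t = g t) \<Longrightarrow> gprod G f n = gprod G g n"
  by (induction n) auto

lemma definable_poly [definable_intros]:
  "definable f \<Longrightarrow> definable (\<lambda>a \<rho>. poly q (f a \<rho>))"
  by (induction q) (auto intro: definable_intros)

lemma definable_comp4:
  assumes "definable (\<lambda>a \<rho>. F a (\<rho> 0) (\<rho> 1) (\<rho> 2) (\<rho> 3))"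
    "definable f" "definable g" "definable h" "definable k"
  shows "definable (\<lambda>a \<rho>. F a (f a \<rho>) (g a \<rho>) (h a \<rho>) (k a \<rho>))"
  using definable_substitute[OF assms(1), of "\<lambda>i. if i = 0 then f else if i = 1 then g else if i = 2 then h else k"]
    assms by simp

lemma definable_separators [definable_intros]:
  assumes "definable f"
  shows "definable (\<lambda>a \<rho>. separators (a False) (f a \<rho>))"
proof -
  have "definable (\<lambda>a \<rho>. separators (a False) (\<rho> 0))"
    unfolding separators_def by (intro definable_intros)
  then show ?thesis using assms by (rule definable_comp1)
qed

lemma definable_block [definable_intros]:
  assumes "definable f" "definable g"
  shows "definable (\<lambda>a \<rho>. block (a False) (f a \<rho>) (g a \<rho>))"
proof -
  have "definable (\<lambda>a \<rho>. block (a False) (\<rho> 0) (\<rho> 1))"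
    unfolding block_def by (intro definable_intros)
  then show ?thesis using assms by (rule definable_comp2)
qed

definition num_edges :: "(nat \<Rightarrow> bool) \<Rightarrow> nat \<Rightarrow> nat" where
  "num_edges b n = (separators b n - 3) div 3"

text \<open>
  The first three numbers of an encoded instance are its vertex count, source and target, so that the
  edges start with number 3.
\<close>

definition is_edge :: "(nat \<Rightarrow> bool) \<Rightarrow> nat \<Rightarrow> nat \<Rightarrow> nat \<Rightarrow> nat \<Rightarrow> bool" where
  "is_edge b n u l v \<longleftrightarrow> (\<exists>i<num_edges b n.
     block b n (3 * i + 3) = u \<and> block b n (3 * i + 4) = l \<and> block b n (3 * i + 5) = v)"

definition is_arc :: "(nat \<Rightarrow> bool) \<Rightarrow> nat \<Rightarrow> nat \<Rightarrow> nat \<Rightarrow> bool" where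
  "is_arc b n u v \<longleftrightarrow> (\<exists>i<num_edges b n. block b n (3 * i + 3) = u \<and> block b n (3 * i + 5) = v)"

lemma definable_num_edges [definable_intros]:
  "definable f \<Longrightarrow> definable (\<lambda>a \<rho>. num_edges (a False) (f a \<rho>))"
  unfolding num_edges_def by (intro definable_intros)

lemma decidable_is_edge [definable_intros]:
  assumes "definable f" "definable g" "definable h" "definable k"
  shows "decidable (\<lambda>a \<rho>. is_edge (a False) (f a \<rho>) (g a \<rho>) (h a \<rho>) (k a \<rho>))"
proof -
  have "decidable (\<lambda>a \<rho>. is_edge (a False) (\<rho> 0) (\<rho> 1) (\<rho> 2) (\<rho> 3))"
    unfolding is_edge_def by (intro definable_intros)
  then show ?thesis using assms by (rule definable_comp4)
qed

lemma decidable_is_arc [definable_intros]: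
  assumes "definable f" "definable g" "definable h"
  shows "decidable (\<lambda>a \<rho>. is_arc (a False) (f a \<rho>) (g a \<rho>) (h a \<rho>))"
proof -
  have "decidable (\<lambda>a \<rho>. is_arc (a False) (\<rho> 0) (\<rho> 1) (\<rho> 2))"
    unfolding is_arc_def by (intro definable_intros)
  then show ?thesis
    using definable_comp4[of "\<lambda>a x y z _. of_bool (is_arc (a False) x y z)" f g h h] assms by simp
qed

text \<open>
  All that \<^const>\<open>wf_instance\<close> requires except acyclicity, which is not a local condition.
\<close>

definition well_labeled_instance :: "'a set \<Rightarrow> 'a instance_graph \<Rightarrow> bool" where
  "well_labeled_instance X \<Gamma> \<longleftrightarrow> source \<Gamma> < num_vertices \<Gamma> \<and> target \<Gamma> < num_vertices \<Gamma> \<and>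
     (\<forall>(u, l, v) \<in> set (edges \<Gamma>).
        u < num_vertices \<Gamma> \<and> v < num_vertices \<Gamma> \<and> (\<forall>a. l = Some a \<longrightarrow> generator a \<in> X))"

definition arcs :: "'a instance_graph \<Rightarrow> (nat \<times> nat) set" where
  "arcs \<Gamma> = {(u, v). \<exists>l. (u, l, v) \<in> set (edges \<Gamma>)}"

lemma wf_instance_iff: "wf_instance X \<Gamma> \<longleftrightarrow> well_labeled_instance X \<Gamma> \<and> acyclic (arcs \<Gamma>)"
  by (auto simp: wf_instance_def well_labeled_instance_def arcs_def)

definition valid_code :: "'a set \<Rightarrow> ('a \<Rightarrow> nat) \<Rightarrow> (nat \<Rightarrow> bool) \<Rightarrow> nat \<Rightarrow> bool" where
  "valid_code X c b n \<longleftrightarrow> n \<noteq> 0 \<and> \<not> b (n - 1) \<and> 3 \<le> separators b n \<and> (separators b n - 3) mod 3 = 0 \<and>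
     block b n 1 < block b n 0 \<and> block b n 2 < block b n 0 \<and>
     (\<forall>i<num_edges b n. block b n (3 * i + 3) < block b n 0 \<and> block b n (3 * i + 5) < block b n 0 \<and>
        (\<exists>l\<in>labels X. block b n (3 * i + 4) = label_code c l))"

lemma decidable_valid_code:
  assumes "finite X" "definable f"
  shows "decidable (\<lambda>a \<rho>. valid_code X c (a False) (f a \<rho>))"
proof -
  have "decidable (\<lambda>a \<rho>. valid_code X c (a False) (\<rho> 0))"
    unfolding valid_code_def
    by (intro definable_intros decidable_bex_finite finite_labels assms(1))
  then show ?thesis using assms(2) by (rule definable_comp1)
qed

lemma nth_triples:
  "i < length es \<Longrightarrow> concat (map (\<lambda>(u, l, v). [u, f l, v]) es) ! (3 * i) = fst (es ! i) \<and>
    concat (map (\<lambda>(u, l, v). [u, f l, v]) es) ! (3 * i + 1) = f (fst (snd (es ! i))) \<and>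
    concat (map (\<lambda>(u, l, v). [u, f l, v]) es) ! (3 * i + 2) = snd (snd (es ! i))"
proof (induction es arbitrary: i)
  case (Cons e es)
  then show ?case by (cases i) (auto simp: split_beta)
qed simp

lemma length_triples: "length (concat (map (\<lambda>(u, l, v). [u, f l, v]) es)) = 3 * length es"
  by (induction es) auto

context
  fixes X :: "'a set" and c :: "'a \<Rightarrow> nat" and w :: "bool list" and b :: "nat \<Rightarrow> bool" and n :: nat
  assumes b: "b = (\<lambda>p. p < length w \<and> w ! p)" and n: "n = length w"
begin

lemma decode_numbers:
  assumes "w = encode_nats ns"
  shows "separators b n = length ns" "block b n j = (if j < length ns then ns ! j else 0)"
  using block_encode_nats[of ns b] assms by (auto simp: b n)

lemma decode_instance:
  assumes w: "w = encode_instance c \<Gamma>"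
  shows "separators b n = 3 + 3 * length (edges \<Gamma>)" "num_edges b n = length (edges \<Gamma>)"
    "block b n 0 = num_vertices \<Gamma>" "block b n 1 = source \<Gamma>" "block b n 2 = target \<Gamma>"
    "i < length (edges \<Gamma>) \<Longrightarrow> block b n (3 * i + 3) = fst (edges \<Gamma> ! i) \<and>
       block b n (3 * i + 4) = label_code c (fst (snd (edges \<Gamma> ! i))) \<and>
       block b n (3 * i + 5) = snd (snd (edges \<Gamma> ! i))"
    "num_vertices \<Gamma> < n"
proof -
  let ?ns = "instance_nats c \<Gamma>"
  note dec = decode_numbers[OF w[unfolded encode_instance_def]]
  have len: "length ?ns = 3 + 3 * length (edges \<Gamma>)"
    by (simp add: instance_nats_def length_triples)
  show sep: "separators b n = 3 + 3 * length (edges \<Gamma>)" using dec len by simp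
  then show "num_edges b n = length (edges \<Gamma>)" by (simp add: num_edges_def)
  show "block b n 0 = num_vertices \<Gamma>" "block b n 1 = source \<Gamma>" "block b n 2 = target \<Gamma>"
    using dec len by (auto simp: instance_nats_def)
  have "3 * i + 3 = Suc (Suc (Suc (3 * i)))" "3 * i + 4 = Suc (Suc (Suc (3 * i + 1)))"
    "3 * i + 5 = Suc (Suc (Suc (3 * i + 2)))" by simp_all
  then show "i < length (edges \<Gamma>) \<Longrightarrow> block b n (3 * i + 3) = fst (edges \<Gamma> ! i) \<and>
       block b n (3 * i + 4) = label_code c (fst (snd (edges \<Gamma> ! i))) \<and>
       block b n (3 * i + 5) = snd (snd (edges \<Gamma> ! i))"
    using dec len nth_triples[of i "edges \<Gamma>" "label_code c"] by (simp add: instance_nats_def)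
  show "num_vertices \<Gamma> < n"
    using w by (simp add: n encode_instance_def length_encode_nats instance_nats_def)
qed

lemma decode_edges:
  assumes w: "w = encode_instance c \<Gamma>"
  shows "is_edge b n u k v \<longleftrightarrow> (\<exists>l. (u, l, v) \<in> set (edges \<Gamma>) \<and> label_code c l = k)"
    "is_arc b n u v \<longleftrightarrow> (u, v) \<in> arcs \<Gamma>"
proof -
  have nth: "(\<exists>i<length es. P (es ! i)) \<longleftrightarrow> (\<exists>e\<in>set es. P e)" for es and P :: "'a edge \<Rightarrow> bool"
    by (metis in_set_conv_nth)
  have "is_edge b n u k v \<longleftrightarrow> (\<exists>i<length (edges \<Gamma>). fst (edges \<Gamma> ! i) = u \<and>
      label_code c (fst (snd (edges \<Gamma> ! i))) = k \<and> snd (snd (edges \<Gamma> ! i)) = v)"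
    unfolding is_edge_def decode_instance(2)[OF w] using decode_instance(6)[OF w] by (metis (no_types, lifting))
  also have "\<dots> \<longleftrightarrow> (\<exists>e\<in>set (edges \<Gamma>). fst e = u \<and> label_code c (fst (snd e)) = k \<and> snd (snd e) = v)"
    by (rule nth)
  also have "\<dots> \<longleftrightarrow> (\<exists>l. (u, l, v) \<in> set (edges \<Gamma>) \<and> label_code c l = k)"
    by (auto simp: Bex_def)
  finally show "is_edge b n u k v \<longleftrightarrow> (\<exists>l. (u, l, v) \<in> set (edges \<Gamma>) \<and> label_code c l = k)" .
  have "is_arc b n u v \<longleftrightarrow> (\<exists>i<length (edges \<Gamma>). fst (edges \<Gamma> ! i) = u \<and> snd (snd (edges \<Gamma> ! i)) = v)"
    unfolding is_arc_def decode_instance(2)[OF w] using decode_instance(6)[OF w] by (metis (no_types, lifting))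
  also have "\<dots> \<longleftrightarrow> (\<exists>e\<in>set (edges \<Gamma>). fst e = u \<and> snd (snd e) = v)"
    by (rule nth)
  also have "\<dots> \<longleftrightarrow> (u, v) \<in> arcs \<Gamma>"
    by (auto simp: Bex_def arcs_def)
  finally show "is_arc b n u v \<longleftrightarrow> (u, v) \<in> arcs \<Gamma>" .
qed

lemma valid_code_iff:
  "valid_code X c b n \<longleftrightarrow> (\<exists>\<Gamma>. well_labeled_instance X \<Gamma> \<and> w = encode_instance c \<Gamma>)"
proof
  assume "\<exists>\<Gamma>. well_labeled_instance X \<Gamma> \<and> w = encode_instance c \<Gamma>"
  then obtain \<Gamma> where \<Gamma>: "well_labeled_instance X \<Gamma>" and w: "w = encode_instance c \<Gamma>" by blast
  note dec = decode_instance[OF w]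
  have "instance_nats c \<Gamma> \<noteq> []" by (simp add: instance_nats_def)
  then have "w \<noteq> []" "\<not> last w"
    unfolding w encode_instance_def by (simp_all add: encode_nats_eq_Nil last_encode_nats)
  then have "n \<noteq> 0" "\<not> b (n - 1)" by (auto simp: b n last_conv_nth)
  moreover have "\<forall>i<num_edges b n. block b n (3 * i + 3) < block b n 0 \<and> block b n (3 * i + 5) < block b n 0 \<and>
        (\<exists>l\<in>labels X. block b n (3 * i + 4) = label_code c l)"
  proof (intro allI impI)
    fix i assume "i < num_edges b n"
    then have i: "i < length (edges \<Gamma>)" using dec(2) by simp
    obtain u l v where e: "edges \<Gamma> ! i = (u, l, v)" by (metis prod.collapse)
    then have "(u, l, v) \<in> set (edges \<Gamma>)" using i by (metis nth_mem)
    then have "u < num_vertices \<Gamma>" "v < num_vertices \<Gamma>" "l \<in> labels X"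
      using \<Gamma> by (auto simp: well_labeled_instance_def labels_def)
    then show "block b n (3 * i + 3) < block b n 0 \<and> block b n (3 * i + 5) < block b n 0 \<and>
        (\<exists>l\<in>labels X. block b n (3 * i + 4) = label_code c l)"
      using dec(3) dec(6)[OF i] e by auto
  qed
  ultimately show "valid_code X c b n"
    using dec(1,3-5) \<Gamma> by (simp add: valid_code_def well_labeled_instance_def)
next
  assume v: "valid_code X c b n"
  then have "w = [] \<or> \<not> last w" by (auto simp: valid_code_def b n last_conv_nth)
  then obtain ns where ns: "w = encode_nats ns" using encode_nats_surj by blast
  note dec = decode_numbers[OF ns]
  define E where "E = num_edges b n"
  have len: "length ns = 3 + 3 * E"
    using v dec(1) by (auto simp: valid_code_def E_def num_edges_def)
  define lab where "lab k = (SOME l. l \<in> labels X \<and> k = label_code c l)" for k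
  have lab: "lab (ns ! (3 * i + 4)) \<in> labels X \<and> label_code c (lab (ns ! (3 * i + 4))) = ns ! (3 * i + 4)"
    if "i < E" for i
  proof -
    have "\<exists>l\<in>labels X. block b n (3 * i + 4) = label_code c l"
      using v that unfolding valid_code_def E_def by blast
    then have "\<exists>l. l \<in> labels X \<and> ns ! (3 * i + 4) = label_code c l"
      using that dec(2)[of "3 * i + 4"] len by auto
    from someI_ex[OF this] show ?thesis by (simp add: lab_def)
  qed
  define \<Gamma> where "\<Gamma> = \<lparr>num_vertices = ns ! 0,
    edges = map (\<lambda>i. (ns ! (3 * i + 3), lab (ns ! (3 * i + 4)), ns ! (3 * i + 5))) [0..<E],
    source = ns ! 1, target = ns ! 2\<rparr>"
  have lt: "ns ! 1 < ns ! 0" "ns ! 2 < ns ! 0"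
    "\<And>i. i < E \<Longrightarrow> ns ! (3 * i + 3) < ns ! 0 \<and> ns ! (3 * i + 5) < ns ! 0"
    using v len dec(2) by (auto simp: valid_code_def E_def[symmetric])
  then have "well_labeled_instance X \<Gamma>"
    using lab by (auto simp: well_labeled_instance_def \<Gamma>_def labels_def)
  moreover have "instance_nats c \<Gamma> = ns"
  proof -
    obtain x y z zs where zs: "ns = x # y # z # zs"
      using len by (cases ns; cases "tl ns"; cases "tl (tl ns)") auto
    have idx: "3 * i + 3 = Suc (Suc (Suc (3 * i)))" "3 * i + 4 = Suc (Suc (Suc (3 * i + 1)))"
      "3 * i + 5 = Suc (Suc (Suc (3 * i + 2)))" for i by simp_all
    have "concat (map (\<lambda>(u, l, v). [u, label_code c l, v]) (edges \<Gamma>)) =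
        concat (map (\<lambda>i. [zs ! (3 * i), zs ! (3 * i + 1), zs ! (3 * i + 2)]) [0..<E])"
      unfolding \<Gamma>_def using lab
      by (auto simp: comp_def intro!: arg_cong[where f = concat] map_cong) (simp_all add: zs idx)
    also have "\<dots> = zs" using len zs by (intro concat_triples) simp
    finally show ?thesis by (simp add: instance_nats_def zs) (simp add: \<Gamma>_def zs)
  qed
  ultimately show "\<exists>\<Gamma>. well_labeled_instance X \<Gamma> \<and> w = encode_instance c \<Gamma>"
    using ns by (auto simp: encode_instance_def)
qed

end

context group
begin

lemma decidable_in_eq:
  assumes tri: "triangular G (with_inverses G cs)"
    and g: "definable_in G (with_inverses G cs) g" and h: "definable_in G (with_inverses G cs) h"
  shows "decidable (\<lambda>a \<rho>. g a \<rho> = h a \<rho>)"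
proof -
  note cs = triangular_carrier[OF tri]
  have carr: "g a \<rho> \<in> carrier G" "h a \<rho> \<in> carrier G" for a \<rho>
    using definable_in_span[OF g] definable_in_span[OF h] span_carrier[OF cs] by auto
  have "definable_in G (with_inverses G cs) (\<lambda>a \<rho>. g a \<rho> \<otimes> inv (h a \<rho>))"
    by (rule definable_in_mult[OF product_closed_if_triangular[OF tri] cs g definable_in_inverse[OF tri h]])
  then have "decidable (\<lambda>a \<rho>. g a \<rho> \<otimes> inv (h a \<rho>) = \<one>)" by (rule decidable_eq_one[OF tri])
  moreover have "g a \<rho> \<otimes> inv (h a \<rho>) = \<one> \<longleftrightarrow> g a \<rho> = h a \<rho>" for a \<rho>
    using carr[of a \<rho>] by (metis inv_closed inv_equality inv_inv r_inv)
  ultimately show ?thesis by simp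
qed

lemma word_value_append:
  "\<lbrakk>\<And>x. x \<in> set u \<union> set v \<Longrightarrow> letter_value G x \<in> carrier G\<rbrakk> \<Longrightarrow>
    word_value G v \<in> carrier G \<and> word_value G (u @ v) = word_value G u \<otimes> word_value G v \<and> word_value G u \<in> carrier G"
proof (induction u)
  case Nil
  then have "word_value G v \<in> carrier G"
    by (induction v) (auto simp: word_value_def)
  then show ?case by (simp add: word_value_def)
next
  case (Cons x u)
  then show ?case by (auto simp: word_value_def m_assoc)
qed

lemma power_product_zero: "set cs \<subseteq> carrier G \<Longrightarrow> power_product G cs (\<lambda>i. 0) = \<one>"
  by (induction cs) auto

end

section \<open>Dynamic programming\<close>

definition labeled_over :: "'a set \<Rightarrow> 'a edge set \<Rightarrow> bool" where
  "labeled_over X E \<longleftrightarrow> (\<forall>(u, l, v) \<in> E. l \<in> labels X)"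

context coset_transducer
begin

abbreviation "K \<equiv> G\<lparr>carrier := H\<rparr>"
abbreviation "ds \<equiv> with_inverses (G\<lparr>carrier := H\<rparr>) cs"

sublocale K: group K
  by (rule subgroup_imp_group[OF H])

lemma ds_carrier: "set ds \<subseteq> H"
  using K.triangular_carrier[OF tri] by simp

lemma span_H: "span K ds \<subseteq> H"
  using K.span_carrier[OF K.triangular_carrier[OF tri]] by simp

lemma H_carrier: "H \<subseteq> carrier G"
  by (rule subgroup.subset[OF H])

definition label_value :: "'a letter option \<Rightarrow> 'a" where
  "label_value l = (case l of None \<Rightarrow> \<one> | Some x \<Rightarrow> letter_value G x)"

lemma letter_value_closed: "generator x \<in> X \<Longrightarrow> letter_value G x \<in> carrier G"
  using X(2) by (cases x) auto

lemma label_value_closed: "l \<in> labels X \<Longrightarrow> label_value l \<in> carrier G"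
  by (auto simp: labels_def label_value_def letter_value_closed split: option.split)

lemma nxt_less: "j < m \<Longrightarrow> l \<in> labels X \<Longrightarrow> nxt j l < m"
  and elt_span: "j < m \<Longrightarrow> l \<in> labels X \<Longrightarrow> elt j l \<in> span K ds"
  and rep_label: "j < m \<Longrightarrow> l \<in> labels X \<Longrightarrow> rep j \<otimes> label_value l = elt j l \<otimes> rep (nxt j l)"
  using nxt[of j l] by (auto simp: labels_def label_value_def)

lemma elt_carrier: "j < m \<Longrightarrow> l \<in> labels X \<Longrightarrow> elt j l \<in> carrier G"
  using elt_span span_H H_carrier by blast

lemma npath_letters:
  "npath E s d u v \<Longrightarrow> labeled_over X E \<Longrightarrow> x \<in> set u \<Longrightarrow> generator x \<in> X"
proof (induction rule: npath.induct)
  case (npath_Suc d u v l v')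
  have "l \<in> labels X" using npath_Suc.hyps(2) npath_Suc.prems(1) by (auto simp: labeled_over_def)
  then show ?case using npath_Suc by (auto simp: label_word_def labels_def split: option.splits)
qed simp

lemma word_value_snoc:
  assumes "\<And>x. x \<in> set u \<Longrightarrow> generator x \<in> X" "l \<in> labels X"
  shows "word_value G (u @ label_word l) = word_value G u \<otimes> label_value l \<and> word_value G u \<in> carrier G"
proof -
  have l: "x \<in> set (label_word l) \<Longrightarrow> generator x \<in> X" for x
    using assms(2) by (auto simp: label_word_def labels_def split: option.splits)
  have "letter_value G x \<in> carrier G" if "x \<in> set u \<union> set (label_word l)" for x
    using that assms(1) l letter_value_closed by blast
  from word_value_append[OF this, of u "label_word l"]
  have "word_value G (u @ label_word l) = word_value G u \<otimes> word_value G (label_word l)"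
    "word_value G u \<in> carrier G" by auto
  moreover have "word_value G (label_word l) = label_value l"
    using label_value_closed[OF assms(2)]
    by (cases l) (auto simp: word_value_def label_word_def label_value_def)
  ultimately show ?thesis by simp
qed

lemma npath_product:
  assumes "npath E s d u v" "labeled_over X E"
  shows "\<exists>xs j. set xs \<subseteq> (\<lambda>(j, l). elt j l) ` ({..<m} \<times> labels X) \<and> length xs = d \<and> j < m \<and>
    gprod K (nth xs) d \<in> H \<and> word_value G u = gprod K (nth xs) d \<otimes> rep j"
  using assms(1)
proof (induction rule: npath.induct)
  case npath_0
  then show ?case
    using j0 subgroup.one_closed[OF H] by (intro exI[of _ "[]"] exI[of _ j0]) (auto simp: word_value_def)
next
  case (npath_Suc d u v l v')
  then obtain xs j where xs: "set xs \<subseteq> (\<lambda>(j, l). elt j l) ` ({..<m} \<times> labels X)" "length xs = d" "j < m"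
    "gprod K (nth xs) d \<in> H" "word_value G u = gprod K (nth xs) d \<otimes> rep j" by blast
  have l: "l \<in> labels X" using npath_Suc.hyps(2) assms(2) by (auto simp: labeled_over_def)
  have gp: "gprod K (nth (xs @ [elt j l])) (Suc d) = gprod K (nth xs) d \<otimes> elt j l"
    using xs(2) gprod_cong[of d "nth (xs @ [elt j l])" "nth xs" K] by (simp add: nth_append)
  have eH: "elt j l \<in> H" using elt_span[OF xs(3) l] span_H by blast
  have carr: "gprod K (nth xs) d \<in> carrier G" "elt j l \<in> carrier G" "rep j \<in> carrier G" "rep (nxt j l) \<in> carrier G"
    using xs(4) eH H_carrier rep xs(3) nxt_less[OF xs(3) l] by auto
  have "word_value G (u @ label_word l) = word_value G u \<otimes> label_value l"
    using word_value_snoc[OF npath_letters[OF npath_Suc.hyps(1) assms(2)] l] by blast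
  also have "\<dots> = gprod K (nth xs) d \<otimes> (rep j \<otimes> label_value l)"
    using xs(5) carr label_value_closed[OF l] by (simp add: m_assoc)
  also have "\<dots> = (gprod K (nth xs) d \<otimes> elt j l) \<otimes> rep (nxt j l)"
    using carr by (simp add: rep_label[OF xs(3) l] m_assoc)
  finally show ?case
    using xs(1-3) l nxt_less[OF xs(3) l] gp subgroup.m_closed[OF H xs(4) eH]
    by (intro exI[of _ "xs @ [elt j l]"] exI[of _ "nxt j l"]) auto
qed

text \<open>
  The factors from \<open>H\<close> that are picked up along a path come from a finite set, so the bound for products
  applies.
\<close>

lemma polynomial_growth:
  "\<exists>q :: nat poly. \<forall>E s d u v. labeled_over X E \<longrightarrow> npath E s d u v \<longrightarrow>
    (\<exists>e j. j < m \<and> (\<forall>i. e i \<le> poly q d) \<and> word_value G u = power_product K ds e \<otimes> rep j)"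
proof -
  let ?S = "(\<lambda>(j, l). elt j l) ` ({..<m} \<times> labels X)"
  have "finite ?S" using finite_labels[OF X(1)] by simp
  moreover have "?S \<subseteq> span K ds" using elt_span by auto
  ultimately obtain q :: "nat poly" where q: "\<forall>xs. set xs \<subseteq> ?S \<longrightarrow>
      (\<exists>e. (\<forall>i. e i \<le> poly q (length xs)) \<and> gprod K (nth xs) (length xs) = power_product K ds e)"
    using K.bounded_products[OF tri, of ?S] by blast
  show ?thesis
  proof (intro exI[of _ q] allI impI)
    fix E s d u v assume "labeled_over X E" "npath E s d u v"
    from npath_product[OF this(2,1)] obtain xs j where xs: "set xs \<subseteq> ?S" "length xs = d" "j < m"
      "word_value G u = gprod K (nth xs) d \<otimes> rep j" by blast
    from q xs(1,2) obtain e where "\<forall>i. e i \<le> poly q d" "gprod K (nth xs) d = power_product K ds e" by blast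
    then show "\<exists>e j. j < m \<and> (\<forall>i. e i \<le> poly q d) \<and> word_value G u = power_product K ds e \<otimes> rep j"
      using xs(3,4) by auto
  qed
qed

end

locale bounded_transducer = coset_transducer G H cs X m rep j0 nxt elt
  for G :: "('a, 'b) monoid_scheme" (structure) and H cs X m rep j0 nxt elt +
  fixes c :: "'a \<Rightarrow> nat" and q :: "nat poly"
  assumes inj: "inj_on c X"
    and growth: "\<And>E s d u v. labeled_over X E \<Longrightarrow> npath E s d u v \<Longrightarrow>
      \<exists>e j. j < m \<and> (\<forall>i. e i \<le> poly q d) \<and> word_value G u = power_product K ds e \<otimes> rep j"
begin

text \<open>
  States are numbers written in base \<open>base n\<close>, where \<open>n\<close> is the length of the input. Digit 0 is the number of
  a coset, or \<open>m\<close> for the states that only look for walks; digit 1 is a vertex; the other digits are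
  exponents. The base exceeds all numbers that can occur there.
\<close>

definition base :: "nat \<Rightarrow> nat" where
  "base n = poly q n + n + m + 1"

definition digit :: "nat \<Rightarrow> nat \<Rightarrow> nat \<Rightarrow> nat" where
  "digit n s i = (s div base n ^ i) mod base n"

definition num_states :: "nat \<Rightarrow> nat" where
  "num_states n = base n ^ (length ds + 2)"

definition element :: "nat \<Rightarrow> nat \<Rightarrow> 'a" where
  "element n s = power_product K ds (\<lambda>i. digit n s (i + 2))"

definition initial :: "(nat \<Rightarrow> bool) \<Rightarrow> nat \<Rightarrow> nat \<Rightarrow> bool" where
  "initial b n s \<longleftrightarrow> (digit n s 0 = j0 \<and> digit n s 1 = block b n 1 \<and> element n s = \<one>) \<or> digit n s 0 = m"

text \<open>
  Either an arc is followed in search of long walks, or nothing happens, or an edge is read. Letting a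
  state stay as it is makes reachability in at most \<open>n\<close> steps the same as in exactly \<open>n\<close> steps. When an
  edge is read, the new exponents may be any that describe the right element.
\<close>

definition transition :: "(nat \<Rightarrow> bool) \<Rightarrow> nat \<Rightarrow> nat \<Rightarrow> nat \<Rightarrow> bool" where
  "transition b n s' s \<longleftrightarrow>
     (digit n s' 0 = m \<and> digit n s 0 = m \<and> is_arc b n (digit n s' 1) (digit n s 1)) \<or>
     (digit n s' 0 < m \<and> s = s') \<or>
     (\<exists>p \<in> {..<m} \<times> labels X. digit n s' 0 = fst p \<and> digit n s 0 = nxt (fst p) (snd p) \<and>
        is_edge b n (digit n s' 1) (label_code c (snd p)) (digit n s 1) \<and>
        element n s' \<otimes> elt (fst p) (snd p) = element n s)"

primrec reach :: "(nat \<Rightarrow> bool) \<Rightarrow> nat \<Rightarrow> nat \<Rightarrow> nat \<Rightarrow> bool" where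
  "reach b n 0 s = initial b n s"
| "reach b n (Suc d) s = (\<exists>s'<num_states n. reach b n d s' \<and> transition b n s' s)"

text \<open>
  Entry \<open>d * num_states n + \<kappa>\<close> of the table says whether state \<open>\<kappa>\<close> is reachable in \<open>d\<close> steps.
\<close>

definition cell :: "arrays \<Rightarrow> nat \<Rightarrow> nat \<Rightarrow> bool" where
  "cell a t n \<longleftrightarrow>
     (t div num_states n = 0 \<and> initial (a False) n (t mod num_states n)) \<or>
     (t div num_states n \<noteq> 0 \<and> (\<exists>s'<num_states n. a True ((t div num_states n - 1) * num_states n + s') \<and>
        transition (a False) n s' (t mod num_states n)))"

definition accepting :: "arrays \<Rightarrow> nat \<Rightarrow> bool" where
  "accepting a n \<longleftrightarrow> valid_code X c (a False) n \<and>
     (\<exists>s<num_states n. a True (n * num_states n + s) \<and> digit n s 0 = j0 \<and>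
        digit n s 1 = block (a False) n 2 \<and> element n s = \<one>) \<and>
     \<not> (\<exists>s<num_states n. a True (n * num_states n + s) \<and> digit n s 0 = m)"

lemma definable_base [definable_intros]: "definable f \<Longrightarrow> definable (\<lambda>a \<rho>. base (f a \<rho>))"
  unfolding base_def by (intro definable_intros)

lemma definable_num_states [definable_intros]:
  "definable f \<Longrightarrow> definable (\<lambda>a \<rho>. num_states (f a \<rho>))"
  unfolding num_states_def by (intro definable_intros)

lemma definable_digit [definable_intros]:
  "definable f \<Longrightarrow> definable g \<Longrightarrow> definable (\<lambda>a \<rho>. digit (f a \<rho>) (g a \<rho>) i)"
  unfolding digit_def by (intro definable_intros)

lemma definable_element:
  "definable f \<Longrightarrow> definable g \<Longrightarrow> definable_in K ds (\<lambda>a \<rho>. element (f a \<rho>) (g a \<rho>))"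
  unfolding element_def by (intro definable_in_power_product definable_digit)

lemma decidable_element_one [definable_intros]:
  assumes "definable f" "definable g"
  shows "decidable (\<lambda>a \<rho>. element (f a \<rho>) (g a \<rho>) = \<one>)"
  using K.decidable_eq_one[OF tri definable_element[OF assms]] by simp

lemma decidable_initial [definable_intros]:
  assumes "definable f" "definable g"
  shows "decidable (\<lambda>a \<rho>. initial (a False) (f a \<rho>) (g a \<rho>))"
  unfolding initial_def by (intro definable_intros assms)

lemma decidable_transition [definable_intros]:
  assumes "definable f" "definable g" "definable h"
  shows "decidable (\<lambda>a \<rho>. transition (a False) (f a \<rho>) (g a \<rho>) (h a \<rho>))"
proof -
  have mult: "decidable (\<lambda>a \<rho>. element (f a \<rho>) (g a \<rho>) \<otimes> elt (fst p) (snd p) = element (f a \<rho>) (h a \<rho>))"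
    if p: "p \<in> {..<m} \<times> labels X" for p
  proof -
    have "elt (fst p) (snd p) \<in> span K ds" using p elt_span by auto
    from K.definable_in_mult[OF K.product_closed_if_triangular[OF tri] K.triangular_carrier[OF tri]
        definable_element[OF assms(1,2)] K.definable_in_const[OF this]]
    have "definable_in K ds (\<lambda>a \<rho>. element (f a \<rho>) (g a \<rho>) \<otimes> elt (fst p) (snd p))" by simp
    from K.decidable_in_eq[OF tri this definable_element[OF assms(1,3)]] show ?thesis .
  qed
  have fin: "finite ({..<m} \<times> labels X)" using finite_labels[OF X(1)] by simp
  show ?thesis
    unfolding transition_def
    by (intro decidable_disj decidable_conj decidable_bex_finite[OF fin] decidable_eq decidable_less
        decidable_is_arc decidable_is_edge definable_digit definable_const assms mult)
qed

lemma decidable_cell: "decidable (\<lambda>a \<rho>. cell a (\<rho> 0) (\<rho> 1))"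
  unfolding cell_def by (intro definable_intros)

lemma decidable_accepting: "decidable (\<lambda>a \<rho>. accepting a (\<rho> 0))"
  unfolding accepting_def by (intro definable_intros decidable_valid_code X(1))

lemma table_reach:
  fixes w
  defines "n \<equiv> length w"
  assumes "d \<le> n" "s < num_states n"
  shows "table (\<lambda>a \<rho>. of_bool (cell a (\<rho> 0) (\<rho> 1))) w ((n + 1) * num_states n) (d * num_states n + s) \<longleftrightarrow>
    reach (\<lambda>p. p < length w \<and> w ! p) n d s"
  using assms(2,3)
proof (induction d arbitrary: s)
  case 0
  then show ?case
    by (subst table_iff) (auto simp: cell_def arrays_of_def n_def[symmetric])
next
  case (Suc d)
  let ?t = "table (\<lambda>a \<rho>. of_bool (cell a (\<rho> 0) (\<rho> 1))) w" and ?S = "num_states n"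
  let ?i = "Suc d * ?S + s"
  have div: "?i div ?S = Suc d" "?i mod ?S = s" using Suc.prems by (simp_all del: mult_Suc)
  have i: "?i < (n + 1) * ?S"
  proof -
    have "?i < (Suc d + 1) * ?S" using Suc.prems by simp
    also have "\<dots> \<le> (n + 1) * ?S" using Suc.prems by (intro mult_le_mono1) simp
    finally show ?thesis .
  qed
  have prev: "?t ?i (d * ?S + s') \<longleftrightarrow> reach (\<lambda>p. p < length w \<and> w ! p) n d s'" if "s' < ?S" for s'
  proof -
    have "d * ?S + s' < ?i" using that by simp
    then have "?t ?i (d * ?S + s') \<longleftrightarrow> ?t ((n + 1) * ?S) (d * ?S + s')"
      using i by (subst (1 2) table_iff) auto
    then show ?thesis using Suc.IH[OF _ that] Suc.prems by simp
  qed
  have "?t ((n + 1) * ?S) ?i \<longleftrightarrow> cell (arrays_of w (?t ?i)) ?i n"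
    using i by (subst table_iff) (simp add: n_def)
  also have "\<dots> \<longleftrightarrow> (\<exists>s'<?S. ?t ?i (d * ?S + s') \<and> transition (\<lambda>p. p < length w \<and> w ! p) n s' s)"
    unfolding cell_def div by (simp add: arrays_of_def)
  also have "\<dots> \<longleftrightarrow> reach (\<lambda>p. p < length w \<and> w ! p) n (Suc d) s"
    using prev by auto
  finally show ?case .
qed

lemma state_exists:
  assumes "i < base n" "v < base n" "\<And>k. e k < base n"
  shows "\<exists>s<num_states n. digit n s 0 = i \<and> digit n s 1 = v \<and> element n s = power_product K ds e"
proof -
  let ?\<delta> = "case_nat i (case_nat v e)"
  have "?\<delta> k < base n" for k using assms by (auto split: nat.split)
  then obtain s where s: "s < num_states n" "\<And>k. k < length ds + 2 \<Longrightarrow> digit n s k = ?\<delta> k"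
    using digits_exist[of "length ds + 2" ?\<delta> "base n"] unfolding num_states_def digit_def by blast
  have "element n s = power_product K ds e"
    unfolding element_def by (rule power_product_cong) (use s(2) in simp)
  moreover have "digit n s 0 = i" "digit n s 1 = v" using s(2)[of 0] s(2)[of 1] by simp_all
  ultimately show ?thesis using s(1) by blast
qed

lemma element_H: "element n s \<in> H"
  unfolding element_def using K.power_product_in_span[of ds] span_H by blast

lemma element_carrier: "element n s \<in> carrier G"
  using element_H H_carrier by blast

context
  fixes \<Gamma> :: "'a instance_graph" and w :: "bool list" and b :: "nat \<Rightarrow> bool" and n :: nat
  assumes pre: "well_labeled_instance X \<Gamma>" and w: "w = encode_instance c \<Gamma>"
    and b: "b = (\<lambda>p. p < length w \<and> w ! p)" and n: "n = length w"
begin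

lemmas dec = decode_instance[OF b n w] and dec_edges = decode_edges[OF b n w]

lemma labeled_over_edges: "labeled_over X (set (edges \<Gamma>))"
  using pre by (auto simp: labeled_over_def well_labeled_instance_def labels_def)

text \<open>
  A state with a coset describes the value of some path from the source. This path can have fewer than
  \<open>d\<close> edges because of the steps in which nothing happens.
\<close>

lemma reach_sound:
  "reach b n d s \<Longrightarrow>
    (digit n s 0 < m \<longrightarrow> (\<exists>d' u. npath (set (edges \<Gamma>)) (source \<Gamma>) d' u (digit n s 1) \<and>
       word_value G u = element n s \<otimes> rep (digit n s 0))) \<and>
    (digit n s 0 = m \<longrightarrow> (\<exists>x. (x, digit n s 1) \<in> arcs \<Gamma> ^^ d))"
proof (induction d arbitrary: s)
  case 0
  then show ?case
    using j0 dec(4) npath_0[of "set (edges \<Gamma>)" "source \<Gamma>"]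
    by (auto simp: initial_def word_value_def intro!: exI[of _ 0] exI[of _ "[]"])
next
  case (Suc d)
  then obtain s' where s': "reach b n d s'" "transition b n s' s" by auto
  note IH = Suc.IH[OF s'(1)]
  from s'(2) consider
      "digit n s' 0 = m" "digit n s 0 = m" "is_arc b n (digit n s' 1) (digit n s 1)"
    | "digit n s' 0 < m" "s = s'"
    | j l where "j < m" "l \<in> labels X" "digit n s' 0 = j" "digit n s 0 = nxt j l"
        "is_edge b n (digit n s' 1) (label_code c l) (digit n s 1)" "element n s' \<otimes> elt j l = element n s"
    unfolding transition_def by auto
  then show ?case
  proof cases
    case 1
    then show ?thesis using IH dec_edges(2) by auto
  next
    case 2
    then show ?thesis using IH by auto
  next
    case 3
    obtain d' u where u: "npath (set (edges \<Gamma>)) (source \<Gamma>) d' u (digit n s' 1)"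
      "word_value G u = element n s' \<otimes> rep j" using IH 3 by auto
    obtain l' where l': "(digit n s' 1, l', digit n s 1) \<in> set (edges \<Gamma>)" "label_code c l' = label_code c l"
      using 3(5) dec_edges(1) by auto
    have "l' \<in> labels X" using l'(1) labeled_over_edges by (auto simp: labeled_over_def)
    then have "l' = l"
      using label_code_inj[OF inj, of l' l] l'(2) 3(2) by (auto simp: labels_def)
    then have path: "npath (set (edges \<Gamma>)) (source \<Gamma>) (Suc d') (u @ label_word l) (digit n s 1)"
      using npath_Suc[OF u(1)] l'(1) by blast
    have "word_value G (u @ label_word l) = element n s' \<otimes> rep j \<otimes> label_value l"
      using word_value_snoc[OF npath_letters[OF u(1) labeled_over_edges] 3(2)] u(2) by simp
    also have "\<dots> = element n s' \<otimes> (elt j l \<otimes> rep (nxt j l))"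
      using element_carrier rep[OF 3(1)] label_value_closed[OF 3(2)] rep_label[OF 3(1,2)] by (simp add: m_assoc)
    also have "\<dots> = element n s \<otimes> rep (digit n s 0)"
      using element_carrier elt_carrier[OF 3(1,2)] rep[OF nxt_less[OF 3(1,2)]]
      by (simp add: 3(4) 3(6)[symmetric] m_assoc)
    finally show ?thesis using path nxt_less[OF 3(1,2)] 3(4) by auto
  qed
qed

text \<open>
  All states that describe the value of a path are reached, not just one with particular exponents. In the
  induction step, polynomial growth provides some state for the path without its last edge; the
  induction hypothesis applies to it, and the transition into the given state only requires that the
  elements agree.
\<close>

lemma reach_complete:
  "npath (set (edges \<Gamma>)) (source \<Gamma>) d u v \<Longrightarrow> d \<le> n \<Longrightarrow> s < num_states n \<Longrightarrow> digit n s 0 < m \<Longrightarrow>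
    digit n s 1 = v \<Longrightarrow> word_value G u = element n s \<otimes> rep (digit n s 0) \<Longrightarrow> reach b n d s"
proof (induction arbitrary: s rule: npath.induct)
  case npath_0
  have eq: "element n s \<otimes> rep (digit n s 0) = \<one>"
    using npath_0.prems(5)[symmetric] by (simp add: word_value_def)
  then have "element n s \<otimes> rep (digit n s 0) = \<one> \<otimes> rep j0"
    by (simp only: j0(2) l_one one_closed)
  then have "digit n s 0 = j0"
    by (rule rep_unique[OF npath_0.prems(3) j0(1) element_H subgroup.one_closed[OF H]])
  then have "element n s = \<one>"
    using eq j0(2) element_carrier by simp
  then show ?case using \<open>digit n s 0 = j0\<close> npath_0.prems(4) dec(4) by (simp add: initial_def)
next
  case (npath_Suc d u v l v')
  have l: "l \<in> labels X" using npath_Suc.hyps(2) labeled_over_edges by (auto simp: labeled_over_def)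
  obtain e j where e: "j < m" "\<And>i. e i \<le> poly q d" "word_value G u = power_product K ds e \<otimes> rep j"
    using growth[OF labeled_over_edges npath_Suc.hyps(1)] by blast
  have "poly q d \<le> poly q n" using npath_Suc.prems(1) by (intro poly_nat_mono) simp
  then have e': "e i < base n" for i using e(2)[of i] by (simp add: base_def)
  have "v < num_vertices \<Gamma>" using npath_Suc.hyps(2) pre by (auto simp: well_labeled_instance_def)
  then have "v < base n" using dec(7) by (simp add: base_def)
  then obtain s' where s': "s' < num_states n" "digit n s' 0 = j" "digit n s' 1 = v"
      "element n s' = power_product K ds e"
    using state_exists[of j n v e] e(1) e' by (auto simp: base_def)
  have reach: "reach b n d s'"
    using npath_Suc.IH[of s'] s' e npath_Suc.prems(1) by simp
  have carr: "rep j \<in> carrier G" "elt j l \<in> carrier G" "rep (nxt j l) \<in> carrier G" "label_value l \<in> carrier G"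
    using rep e(1) l elt_carrier nxt_less label_value_closed by auto
  have "word_value G (u @ label_word l) = element n s' \<otimes> rep j \<otimes> label_value l"
    using word_value_snoc[OF npath_letters[OF npath_Suc.hyps(1) labeled_over_edges] l] e(3) s'(4) by simp
  also have "\<dots> = (element n s' \<otimes> elt j l) \<otimes> rep (nxt j l)"
    using carr element_carrier rep_label[OF e(1) l] by (simp add: m_assoc)
  finally have eq: "element n s \<otimes> rep (digit n s 0) = (element n s' \<otimes> elt j l) \<otimes> rep (nxt j l)"
    using npath_Suc.prems(5) by simp
  have "elt j l \<in> H" using elt_span[OF e(1) l] span_H by blast
  then have "digit n s 0 = nxt j l"
    using rep_unique[OF npath_Suc.prems(3) nxt_less[OF e(1) l] element_H _ eq] subgroup.m_closed[OF H element_H] by blast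
  moreover from this have "element n s' \<otimes> elt j l = element n s"
    using eq carr element_carrier by simp
  moreover have "is_edge b n v (label_code c l) v'" using dec_edges(1) npath_Suc.hyps(2) by blast
  ultimately have "transition b n s' s"
    unfolding transition_def using e(1) l s' npath_Suc.prems(4)
    by (intro disjI2 bexI[of _ "(j, l)"]) auto
  then show ?case using reach s'(1) by auto
qed

lemma reach_walk:
  "(x, y) \<in> arcs \<Gamma> ^^ d \<Longrightarrow> x < num_vertices \<Gamma> \<Longrightarrow>
    \<exists>s<num_states n. reach b n d s \<and> digit n s 0 = m \<and> digit n s 1 = y \<and> y < num_vertices \<Gamma>"
proof (induction d arbitrary: y)
  case 0
  then have "y < base n" using dec(7) by (simp add: base_def)
  then show ?case
    using 0 state_exists[of m n y "\<lambda>_. 0"] by (auto simp: base_def initial_def)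
next
  case (Suc d)
  then obtain z where z: "(x, z) \<in> arcs \<Gamma> ^^ d" "(z, y) \<in> arcs \<Gamma>" by auto
  obtain s' where s': "s' < num_states n" "reach b n d s'" "digit n s' 0 = m" "digit n s' 1 = z"
    using Suc.IH[OF z(1) Suc.prems(2)] by blast
  have y: "y < num_vertices \<Gamma>" using z(2) pre by (auto simp: arcs_def well_labeled_instance_def)
  then obtain s where s: "s < num_states n" "digit n s 0 = m" "digit n s 1 = y"
    using state_exists[of m n y "\<lambda>_. 0"] dec(7) by (auto simp: base_def)
  have "transition b n s' s"
    using s s' z(2) dec_edges(2) by (simp add: transition_def)
  then show ?case using s s' y by auto
qed

lemma reach_stutter: "digit n s 0 < m \<Longrightarrow> s < num_states n \<Longrightarrow> reach b n d s \<Longrightarrow> reach b n (d + k) s"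
proof (induction k)
  case (Suc k)
  then have "reach b n (d + k) s" "transition b n s s" by (auto simp: transition_def)
  then show ?case using Suc.prems(2) by auto
qed simp

lemma arcs_bounded: "arcs \<Gamma> \<subseteq> {..<num_vertices \<Gamma>} \<times> {..<num_vertices \<Gamma>}"
  using pre by (auto simp: arcs_def well_labeled_instance_def)

lemma n_pos: "n > 0"
  using dec(7) by simp

text \<open>
  The input is longer than the number of vertices, so that a walk of that many edges repeats a
  vertex.
\<close>

lemma cyclic_iff: "\<not> acyclic (arcs \<Gamma>) \<longleftrightarrow> (\<exists>s<num_states n. reach b n n s \<and> digit n s 0 = m)"
proof
  assume "\<not> acyclic (arcs \<Gamma>)"
  then obtain x y where xy: "(x, y) \<in> arcs \<Gamma> ^^ n" using walk_if_cyclic by blast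
  then obtain z where "(x, z) \<in> arcs \<Gamma>" using n_pos by (metis gr0_conv_Suc relpow_Suc_D2)
  then have "x < num_vertices \<Gamma>" using arcs_bounded by auto
  then show "\<exists>s<num_states n. reach b n n s \<and> digit n s 0 = m" using reach_walk[OF xy] by blast
next
  assume "\<exists>s<num_states n. reach b n n s \<and> digit n s 0 = m"
  then obtain x y where "(x, y) \<in> arcs \<Gamma> ^^ n" using reach_sound by blast
  then show "\<not> acyclic (arcs \<Gamma>)"
    using walk_length_acyclic[OF _ arcs_bounded _ n_pos] dec(7) by fastforce
qed

lemma yes_iff:
  assumes "acyclic (arcs \<Gamma>)"
  shows "yes_instance G \<Gamma> \<longleftrightarrow> (\<exists>s<num_states n. reach b n n s \<and> digit n s 0 = j0 \<and>
    digit n s 1 = target \<Gamma> \<and> element n s = \<one>)"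
proof
  assume "yes_instance G \<Gamma>"
  then obtain d u where u: "npath (set (edges \<Gamma>)) (source \<Gamma>) d u (target \<Gamma>)" "word_value G u = \<one>"
    by (auto simp: yes_instance_def labeled_path_iff_npath)
  have walk: "(source \<Gamma>, target \<Gamma>) \<in> arcs \<Gamma> ^^ d"
    using npath_relpow[OF u(1)] by (simp add: arcs_def)
  have d: "d \<le> n"
  proof (cases "d = 0")
    case False
    then show ?thesis using walk_length_acyclic[OF assms arcs_bounded walk] dec(7) by simp
  qed simp
  have "target \<Gamma> < base n" using pre dec(7) by (simp add: well_labeled_instance_def base_def)
  then obtain s where s: "s < num_states n" "digit n s 0 = j0" "digit n s 1 = target \<Gamma>"
      "element n s = power_product K ds (\<lambda>i. 0)"
    using state_exists[of j0 n "target \<Gamma>" "\<lambda>_. 0"] j0(1) by (auto simp: base_def)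
  have one: "element n s = \<one>" using s(4) K.power_product_zero[of ds] ds_carrier by simp
  have "word_value G u = element n s \<otimes> rep (digit n s 0)"
    unfolding u(2) one s(2) j0(2) by simp
  then have "reach b n d s"
    using reach_complete[OF u(1) d s(1) _ s(3)] s(2) j0(1) by simp
  then have "reach b n (d + (n - d)) s" using s(1,2) j0(1) by (intro reach_stutter) simp_all
  then show "\<exists>s<num_states n. reach b n n s \<and> digit n s 0 = j0 \<and>
    digit n s 1 = target \<Gamma> \<and> element n s = \<one>" using d s(1-3) one by auto
next
  assume "\<exists>s<num_states n. reach b n n s \<and> digit n s 0 = j0 \<and> digit n s 1 = target \<Gamma> \<and> element n s = \<one>"
  then obtain d u where "npath (set (edges \<Gamma>)) (source \<Gamma>) d u (target \<Gamma>)" "word_value G u = \<one>"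
    using reach_sound j0 by (metis l_one one_closed)
  then show "yes_instance G \<Gamma>" by (auto simp: yes_instance_def labeled_path_iff_npath)
qed

end

theorem AGWP_in_PTIME: "AGWP G X c \<in> PTIME"
proof (rule PTIME_if_table)
  let ?T = "\<lambda>(a :: arrays) \<rho>. (\<rho> 0 + 1) * num_states (\<rho> 0)"
  let ?\<phi> = "\<lambda>a \<rho>. of_bool (cell a (\<rho> 0) (\<rho> 1))"
  show "definable ?T" by (intro definable_intros)
  show "definable ?\<phi>" by (rule decidable_cell)
  show "definable (\<lambda>a \<rho>. of_bool (accepting a (\<rho> 0)))" by (rule decidable_accepting)
  fix w :: "bool list"
  define n where "n = length w"
  define b where "b = (\<lambda>p. p < length w \<and> w ! p)"
  define a where "a = arrays_of w (table ?\<phi> w ((n + 1) * num_states n))"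
  have a: "a False = b" by (simp add: a_def arrays_of_def b_def)
  have reach: "a True (n * num_states n + s) \<longleftrightarrow> reach b n n s" if "s < num_states n" for s
    using table_reach[of n w s] that by (simp add: a_def arrays_of_def b_def n_def)
  have acc: "accepting a n \<longleftrightarrow> valid_code X c b n \<and>
     (\<exists>s<num_states n. reach b n n s \<and> digit n s 0 = j0 \<and>
        digit n s 1 = block b n 2 \<and> element n s = \<one>) \<and>
     \<not> (\<exists>s<num_states n. reach b n n s \<and> digit n s 0 = m)"
    unfolding accepting_def a using reach by blast
  have "w \<in> AGWP G X c \<longleftrightarrow> accepting a n"
  proof
    assume "w \<in> AGWP G X c"
    then obtain \<Gamma> where \<Gamma>: "w = encode_instance c \<Gamma>" "wf_instance X \<Gamma>" "yes_instance G \<Gamma>"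
      by (auto simp: AGWP_def)
    then have pre: "well_labeled_instance X \<Gamma>" and acyc: "acyclic (arcs \<Gamma>)" by (auto simp: wf_instance_iff)
    show "accepting a n"
      unfolding acc using valid_code_iff[OF b_def n_def] pre \<Gamma>(1)
        cyclic_iff[OF pre \<Gamma>(1) b_def n_def] acyc yes_iff[OF pre \<Gamma>(1) b_def n_def acyc] \<Gamma>(3)
        decode_instance(5)[OF b_def n_def \<Gamma>(1)] by auto
  next
    assume A: "accepting a n"
    then obtain \<Gamma> where pre: "well_labeled_instance X \<Gamma>" and w: "w = encode_instance c \<Gamma>"
      using valid_code_iff[OF b_def n_def] unfolding acc by blast
    have acyc: "acyclic (arcs \<Gamma>)" using A cyclic_iff[OF pre w b_def n_def] unfolding acc by blast
    have "yes_instance G \<Gamma>"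
      using A yes_iff[OF pre w b_def n_def acyc] decode_instance(5)[OF b_def n_def w] unfolding acc by auto
    then show "w \<in> AGWP G X c" using pre acyc w by (auto simp: AGWP_def wf_instance_iff)
  qed
  then show "w \<in> AGWP G X c \<longleftrightarrow> of_bool (accepting (arrays_of w (table ?\<phi> w
      (?T (arrays_of w (\<lambda>_. False)) (case_nat (length w) (\<lambda>_. 0))))) (case_nat (length w) (\<lambda>_. 0) 0)) \<noteq> (0 :: nat)"
    by (simp add: a_def n_def)
qed

end

theorem proposition2:
  fixes G :: "('a, 'b) monoid_scheme" and X :: "'a set" and c :: "'a \<Rightarrow> nat"
  assumes "group G"
    and "virtually_nilpotent G"
    and "finite X" and "X \<subseteq> carrier G" and "generate G X = carrier G"
    and "inj_on c X"
  shows "AGWP G X c \<in> PTIME"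
proof -
  obtain H cs m rep j0 nxt elt where T: "coset_transducer G H cs X m rep j0 nxt elt"
    using coset_transducer_exists[OF assms(1-4)] by blast
  obtain q :: "nat poly" where q: "\<forall>E s d u v. labeled_over X E \<longrightarrow> npath E s d u v \<longrightarrow>
      (\<exists>e j. j < m \<and> (\<forall>i. e i \<le> poly q d) \<and>
        word_value G u = power_product (G\<lparr>carrier := H\<rparr>) (with_inverses (G\<lparr>carrier := H\<rparr>) cs) e \<otimes>\<^bsub>G\<^esub> rep j)"
    using coset_transducer.polynomial_growth[OF T] by blast
  interpret coset_transducer G H cs X m rep j0 nxt elt by (rule T)
  interpret bounded_transducer G H cs X m rep j0 nxt elt c q
    by unfold_locales (use assms(6) q in blast)+
  show ?thesis by (rule AGWP_in_PTIME)
qed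

end
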